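(* Let $(\pi:A\to M,\varrho,\alpha)$ be an involution algebroid in a tangent category with negatives that has a unit object $R$. For sections $X,Y\in\Gamma(\pi)$ let $[X,Y]_\alpha\in\Gamma(\pi)$ be the section determined by $\lambda[X,Y]_\alpha=\bigl(\alpha(X,T(Y)\varrho X)-_pT(X)\varrho Y\bigr)-_{T(\pi)}0X$. Then this bracket satisfies the Leibniz law: for all $X,Y\in\Gamma(\pi)$ and every arrow $f:M\to R$, $$[X,f\bullet_\pi Y]_\alpha=f\bullet_\pi[X,Y]_\alpha+_\pi\mathcal L_{\varrho X}(f)\bullet_\pi Y,\qquad \mathcal L_{\varrho X}(f)=\hat p\,T(f)\varrho X .$$
   Context: Conventions: composition is juxtaposition in applicative order ($gf$: first $f$, then $g$); subscripts of natural transformations are omitted; equations may be read on generalised elements. An additive bundle over $M$ is a commutative monoid in the slice category over $M$: an arrow $q:E\to M$, zero $\xi:M\to E$, addition $+_q:E\times_ME\to E$. A morphism is a commuting square $(\phi_1,\phi_0)$ preserving zero and addition. A tangent category is a category with an endofunctor $T$ and natural transformations $p:T\Rightarrow\mathrm{id}$, $0:\mathrm{id}\Rightarrow T$, $+:T\times_{p,p}T\Rightarrow T$, $l:T\Rightarrow T^2$, $c:T^2\Rightarrow T^2$ such that: pullback powers of $p$ exist and are preserved by $T$; each $(p_M,0_M,+_M)$ is an additive bundle; $(l,0):p\Rightarrow T(p)$ and $(c,\mathrm{id}):T(p)\Rightarrow p$ are additive bundle morphisms; $cc=\mathrm{id}$, $T(c)cT(c)=cT(c)c$, $cl=l$, $T(l)l=ll$,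 $cT(c)l=T(l)c$; and $\mu(a,b)=T(+)(0b,la)$, $T(M)\times_MT(M)\to T^2(M)$, is an equaliser of $T(p)$ and $0pp$. Standing assumptions: negatives (all additive bundles are commutative groups in the slice) and all limits used exist and are preserved by $T$. A differential bundle is an additive bundle $q:E\to M$ with a lift $\lambda:E\to T(E)$ such that $(\lambda,0):q\Rightarrow T(q)$ and $(\lambda,\xi):q\Rightarrow p$ are additive bundle morphisms, $T(\lambda)\lambda=l\lambda$, and $\mu(a,b)=T(+_q)(0a,\lambda b)$, $E\times_ME\to T(E)$, is an equaliser of $T(q)$ and $0qp$. A morphism is a commuting square $(\phi_1,\phi_0)$; it is linear if $T(\phi_1)\lambda=\lambda'\phi_1$. $(T(M),p)$ with lift $l$ and $(T(E),T(q))$ with addition $T(+_q)$, zero $T(\xi)$, lift $cT(\lambda)$ are differential bundles. $+_p,-_p$ and $+_{T(q)},-_{T(q)}$ denote the fibrewise operations of $p:T(E)\to E$ and $T(q):T(E)\to T(M)$. Anchored bundle: a differential bundle $\pi:A\to M$ with a linear morphism $\varrho:A\to T(M)$ over $\mathrm{id}_M$. Prolongation: the pullback $P=A\times_{\varrho,T(\pi)}T(A)$ of $\varrho$ and $T(\pi):T(A)\to T(M)$, projections $\pi_0,\pi_1$. It carries two differential bundle structures over $A$: $(P,\pi_0)$ with lift $0\times cT(\lambda)$, and $(P,p\pi_1)$ with lift $\lambda\times l$. Involution algebroid: an anchored bundle with $\alpha:P\to T(A)$ such that $(\alpha,\mathrm{id}):(P,\pi_0)\Rightarrow(T(A),p)$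 and $(\alpha,\varrho):(P,p\pi_1)\Rightarrow(T(A),T(\pi))$ are linear bundle morphisms and: $T(\varrho)\alpha=cT(\varrho)\pi_1$; $\alpha(\xi\pi,\lambda)=\lambda$; $\alpha(p\pi_1,\alpha)=\pi_1$; $T(\alpha)(\alpha(v,w),x)=cT(\alpha)(\alpha(v,px),cT(\alpha)(w,cx))$ whenever $\varrho v=T(\pi)w$ and $cT^2(\pi)x=T(\varrho)w$. $\Gamma(\pi)$ is the set of sections of $\pi$; existence and uniqueness of $[X,Y]_\alpha$ come from the universal property of $\lambda$. Unit objects. A differential object is a differential bundle over the terminal object; for such $E$ the map $\mu:E\times E\to T(E)$ is an isomorphism and $\hat p:T(E)\to E$ denotes the second component of $\mu^{-1}$ (so $\hat p\lambda=\mathrm{id}$). The slice tangent category over $M$ has objects the arrows $q:E\to M$ and tangent functor sending $q$ to the pullback of $T(q)$ along $0:M\to T(M)$; its differential objects are the differential bundles over $M$. A non-fibred unit object in a tangent category is a differential object $R$ with a point $u:1\to R$ such that for all differential objects $V,W,E$ and every arrow $f:V\times W\to E$ there is a unique $\hat f:R\times(V\times W)\to E$ that is linear in $R$ (i.e. $T(\hat f)(\lambda_R\times 0)=\lambda_E\hat f$) with $\hat f(u,v,w)=f(v,w)$; if moreover $f$ is linear in $W$ then so is $\hat f$. Scalar multiplication $\bullet_V:R\times V\to V$ on a differential object $V$ is $\widehat{\mathrm{id}_V}$. A (fibred) unit object, called simply unit object, is a differential object $R$ with a point $u:1\to R$ such that: (1) for each $M$ the trivial bundle $R\times M\to M$ is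 a non-fibred unit object in the slice tangent category over $M$, yielding for each differential bundle $\pi:A\to M$ a scalar multiplication $\bullet_\pi:R\times A\to A$; (2) if $f:N\to M$ and $h_f:f^*A\to A$ is the canonical map from the pulled-back bundle, then $h_f(r\bullet a)=r\bullet_\pi h_f(a)$; (3) (torsion-free) writing $\bullet^T_\pi=T(\bullet_\pi):T(R)\times T(A)\to T(A)$ and $\bullet_{T(\pi)}$ for the scalar multiplication of $T(\pi)$, one has $\lambda_R(r)\bullet^T_\pi v=r\bullet_{T(\pi)}\lambda pv+_pT(\xi\pi)v$ for $r\in R$, $v\in T(A)$. For $f:M\to R$ and $Y\in\Gamma(\pi)$, $f\bullet_\pi Y$ is the section $m\mapsto f(m)\bullet_\pi Y(m)$. *)

theory Defs
  imports Main
begin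

text \<open>
  Generalised elements are used throughout: an element of \<open>E\<close> at stage \<open>Z\<close> is an arrow
  \<open>Z \<rightarrow> E\<close>, and an arrow acts on it by composition.  Composition \<open>g \<cdot> f\<close> means first \<open>f\<close>,
  then \<open>g\<close>.

  A \<open>bundle_data\<close> record holds the data of a differential bundle \<open>q : E \<rightarrow> M\<close>.  The pullback
  \<open>E \<times>\<^sub>M E\<close> that is the domain of the addition belongs to the data, so that applying \<open>T\<close> to a
  bundle (which turns \<open>E \<times>\<^sub>M E\<close> into \<open>T (E \<times>\<^sub>M E)\<close>) requires no transport along an isomorphism.
  Additive bundles ignore the component \<open>lft\<close>.
\<close>

record ('o, 'm) bundle_data =
  tot :: 'o                \<comment> \<open>\<open>E\<close>\<close>
  base :: 'o               \<comment> \<open>\<open>M\<close>\<close>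
  prj :: 'm                \<comment> \<open>\<open>q : E \<rightarrow> M\<close>\<close>
  zer :: 'm                \<comment> \<open>\<open>\<xi> : M \<rightarrow> E\<close>\<close>
  tot2 :: 'o               \<comment> \<open>\<open>E \<times>\<^sub>M E\<close>\<close>
  fst2 :: 'm               \<comment> \<open>first projection \<open>E \<times>\<^sub>M E \<rightarrow> E\<close>\<close>
  snd2 :: 'm               \<comment> \<open>second projection \<open>E \<times>\<^sub>M E \<rightarrow> E\<close>\<close>
  addn :: 'm               \<comment> \<open>\<open>+\<^sub>q : E \<times>\<^sub>M E \<rightarrow> E\<close>\<close>
  nega :: 'm               \<comment> \<open>fibrewise negation \<open>E \<rightarrow> E\<close>\<close>
  lft :: 'm                \<comment> \<open>the lift \<open>\<lambda> : E \<rightarrow> T(E)\<close>\<close>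

record ('o, 'm) category =
  Ob :: "'o set"
  Ar :: "'m set"
  Dom :: "'m \<Rightarrow> 'o"
  Cod :: "'m \<Rightarrow> 'o"
  Id :: "'o \<Rightarrow> 'm"
  Comp :: "'m \<Rightarrow> 'm \<Rightarrow> 'm"  (infixr "\<cdot>\<index>" 70)

text \<open>
  \<open>tb M\<close> is the tangent bundle \<open>(p\<^sub>M, 0\<^sub>M, +\<^sub>M)\<close>, with \<open>T(M) \<times>\<^sub>M T(M)\<close>, the negation, and the
  vertical lift \<open>l\<^sub>M\<close> as its component \<open>lft\<close>.
\<close>

record ('o, 'm) tangent = "('o, 'm) category" +
  TO :: "'o \<Rightarrow> 'o"
  TA :: "'m \<Rightarrow> 'm"
  tb :: "'o \<Rightarrow> ('o, 'm) bundle_data"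
  cflip :: "'o \<Rightarrow> 'm"

section \<open>Categories and limits\<close>

context
  fixes C :: "('o, 'm, 'z) category_scheme" (structure)
begin

definition hom :: "'o \<Rightarrow> 'o \<Rightarrow> 'm set" where
  "hom X Y = {f \<in> Ar C. Dom C f = X \<and> Cod C f = Y}"

definition is_category :: bool where
  "is_category \<longleftrightarrow>
     (\<forall>f \<in> Ar C. Dom C f \<in> Ob C \<and> Cod C f \<in> Ob C) \<and>
     (\<forall>X \<in> Ob C. Id C X \<in> hom X X) \<and>
     (\<forall>X Y Z f g. f \<in> hom X Y \<longrightarrow> g \<in> hom Y Z \<longrightarrow> g \<cdot> f \<in> hom X Z) \<and>
     (\<forall>X Y f. f \<in> hom X Y \<longrightarrow> f \<cdot> Id C X = f \<and> Id C Y \<cdot> f = f) \<and>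
     (\<forall>W X Y Z f g h. f \<in> hom W X \<longrightarrow> g \<in> hom X Y \<longrightarrow> h \<in> hom Y Z \<longrightarrow>
        h \<cdot> (g \<cdot> f) = (h \<cdot> g) \<cdot> f)"

definition is_terminal :: "'o \<Rightarrow> bool" where
  "is_terminal I \<longleftrightarrow> I \<in> Ob C \<and> (\<forall>X \<in> Ob C. \<exists>!f. f \<in> hom X I)"

definition is_pullback :: "'m \<Rightarrow> 'm \<Rightarrow> 'o \<Rightarrow> 'm \<Rightarrow> 'm \<Rightarrow> bool" where
  "is_pullback f g P a b \<longleftrightarrow>
     f \<in> Ar C \<and> g \<in> Ar C \<and> Cod C f = Cod C g \<and>
     a \<in> hom P (Dom C f) \<and> b \<in> hom P (Dom C g) \<and> f \<cdot> a = g \<cdot> b \<and>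
     (\<forall>Z x y. x \<in> hom Z (Dom C f) \<longrightarrow> y \<in> hom Z (Dom C g) \<longrightarrow> f \<cdot> x = g \<cdot> y \<longrightarrow>
        (\<exists>!h. h \<in> hom Z P \<and> a \<cdot> h = x \<and> b \<cdot> h = y))"

text \<open>The \<open>n\<close>-fold pullback power of \<open>q\<close>, for \<open>n \<ge> 1\<close>, with projections \<open>w 0, \<dots>, w (n - 1)\<close>.\<close>

definition is_power :: "nat \<Rightarrow> 'm \<Rightarrow> 'o \<Rightarrow> (nat \<Rightarrow> 'm) \<Rightarrow> bool" where
  "is_power n q P w \<longleftrightarrow>
     q \<in> Ar C \<and>
     (\<forall>i<n. w i \<in> hom P (Dom C q)) \<and> (\<forall>i<n. \<forall>j<n. q \<cdot> w i = q \<cdot> w j) \<and>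
     (\<forall>Z x. (\<forall>i<n. x i \<in> hom Z (Dom C q)) \<longrightarrow> (\<forall>i<n. \<forall>j<n. q \<cdot> x i = q \<cdot> x j) \<longrightarrow>
        (\<exists>!h. h \<in> hom Z P \<and> (\<forall>i<n. w i \<cdot> h = x i)))"

definition is_equaliser :: "'m \<Rightarrow> 'm \<Rightarrow> 'o \<Rightarrow> 'm \<Rightarrow> bool" where
  "is_equaliser f g P e \<longleftrightarrow>
     f \<in> Ar C \<and> g \<in> hom (Dom C f) (Cod C f) \<and> e \<in> hom P (Dom C f) \<and> f \<cdot> e = g \<cdot> e \<and>
     (\<forall>Z x. x \<in> hom Z (Dom C f) \<longrightarrow> f \<cdot> x = g \<cdot> x \<longrightarrow> (\<exists>!h. h \<in> hom Z P \<and> e \<cdot> h = x))"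

text \<open>The element \<open>(x, y)\<close> of a pullback with projections \<open>a\<close> and \<open>b\<close>.\<close>

definition pair :: "'m \<Rightarrow> 'm \<Rightarrow> 'm \<Rightarrow> 'm \<Rightarrow> 'm" where
  "pair a b x y = (THE h. h \<in> hom (Dom C x) (Dom C a) \<and> a \<cdot> h = x \<and> b \<cdot> h = y)"

section \<open>Additive bundles\<close>

definition plus_in :: "('o, 'm) bundle_data \<Rightarrow> 'm \<Rightarrow> 'm \<Rightarrow> 'm" where
  "plus_in B x y = addn B \<cdot> pair (fst2 B) (snd2 B) x y"

definition minus_in :: "('o, 'm) bundle_data \<Rightarrow> 'm \<Rightarrow> 'm \<Rightarrow> 'm" where
  "minus_in B x y = plus_in B x (nega B \<cdot> y)"

text \<open>
  The standing assumption that negatives exist is built in: an additive bundle is a commutative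
  group in the slice.
\<close>

definition additive_bundle :: "('o, 'm) bundle_data \<Rightarrow> bool" where
  "additive_bundle B \<longleftrightarrow>
     prj B \<in> hom (tot B) (base B) \<and>
     is_pullback (prj B) (prj B) (tot2 B) (fst2 B) (snd2 B) \<and>
     zer B \<in> hom (base B) (tot B) \<and> prj B \<cdot> zer B = Id C (base B) \<and>
     addn B \<in> hom (tot2 B) (tot B) \<and> prj B \<cdot> addn B = prj B \<cdot> fst2 B \<and>
     nega B \<in> hom (tot B) (tot B) \<and> prj B \<cdot> nega B = prj B \<and>
     (\<forall>Z x y z. x \<in> hom Z (tot B) \<longrightarrow> y \<in> hom Z (tot B) \<longrightarrow> z \<in> hom Z (tot B) \<longrightarrow>
        prj B \<cdot> x = prj B \<cdot> y \<longrightarrow> prj B \<cdot> y = prj B \<cdot> z \<longrightarrow>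
        plus_in B (plus_in B x y) z = plus_in B x (plus_in B y z) \<and>
        plus_in B x y = plus_in B y x \<and>
        plus_in B x (zer B \<cdot> prj B \<cdot> x) = x \<and>
        plus_in B x (nega B \<cdot> x) = zer B \<cdot> prj B \<cdot> x)"

definition bundle_mor :: "'m \<Rightarrow> 'm \<Rightarrow> 'm \<Rightarrow> 'm \<Rightarrow> bool" where
  "bundle_mor q q' \<phi>\<^sub>1 \<phi>\<^sub>0 \<longleftrightarrow>
     \<phi>\<^sub>1 \<in> hom (Dom C q) (Dom C q') \<and> \<phi>\<^sub>0 \<in> hom (Cod C q) (Cod C q') \<and> q' \<cdot> \<phi>\<^sub>1 = \<phi>\<^sub>0 \<cdot> q"

definition additive_mor :: "('o, 'm) bundle_data \<Rightarrow> ('o, 'm) bundle_data \<Rightarrow> 'm \<Rightarrow> 'm \<Rightarrow> bool" where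
  "additive_mor B B' \<phi>\<^sub>1 \<phi>\<^sub>0 \<longleftrightarrow>
     bundle_mor (prj B) (prj B') \<phi>\<^sub>1 \<phi>\<^sub>0 \<and>
     \<phi>\<^sub>1 \<cdot> zer B = zer B' \<cdot> \<phi>\<^sub>0 \<and>
     \<phi>\<^sub>1 \<cdot> addn B = plus_in B' (\<phi>\<^sub>1 \<cdot> fst2 B) (\<phi>\<^sub>1 \<cdot> snd2 B)"

end

section \<open>Tangent categories\<close>

abbreviation tprj :: "('o, 'm, 'z) tangent_scheme \<Rightarrow> 'o \<Rightarrow> 'm" ("\<p>\<index>") where
  "\<p>\<^bsub>C\<^esub> X \<equiv> prj (tb C X)"

abbreviation tzer :: "('o, 'm, 'z) tangent_scheme \<Rightarrow> 'o \<Rightarrow> 'm" ("\<o>\<index>") where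
  "\<o>\<^bsub>C\<^esub> X \<equiv> zer (tb C X)"

abbreviation tlft :: "('o, 'm, 'z) tangent_scheme \<Rightarrow> 'o \<Rightarrow> 'm" ("\<l>\<index>") where
  "\<l>\<^bsub>C\<^esub> X \<equiv> lft (tb C X)"

abbreviation tflip :: "('o, 'm, 'z) tangent_scheme \<Rightarrow> 'o \<Rightarrow> 'm" ("\<c>\<index>") where
  "\<c>\<^bsub>C\<^esub> X \<equiv> cflip C X"

context
  fixes C :: "('o, 'm, 'z) tangent_scheme" (structure)
begin

abbreviation T0 :: "'o \<Rightarrow> 'o" where "T0 \<equiv> TO C"
abbreviation T1 :: "'m \<Rightarrow> 'm" where "T1 \<equiv> TA C"

text \<open>Limits that exist and are preserved by \<open>T\<close>, hence by all iterates \<open>T\<^sup>k\<close>.\<close>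

definition stable_pullback :: "'m \<Rightarrow> 'm \<Rightarrow> 'o \<Rightarrow> 'm \<Rightarrow> 'm \<Rightarrow> bool" where
  "stable_pullback f g P a b \<longleftrightarrow>
     (\<forall>k. is_pullback C ((T1 ^^ k) f) ((T1 ^^ k) g) ((T0 ^^ k) P) ((T1 ^^ k) a) ((T1 ^^ k) b))"

definition stable_equaliser :: "'m \<Rightarrow> 'm \<Rightarrow> 'o \<Rightarrow> 'm \<Rightarrow> bool" where
  "stable_equaliser f g P e \<longleftrightarrow>
     (\<forall>k. is_equaliser C ((T1 ^^ k) f) ((T1 ^^ k) g) ((T0 ^^ k) P) ((T1 ^^ k) e))"

definition has_stable_powers :: "'m \<Rightarrow> bool" where
  "has_stable_powers q \<longleftrightarrow>
     (\<forall>n\<ge>1. \<exists>P w. \<forall>k. is_power C n ((T1 ^^ k) q) ((T0 ^^ k) P) (\<lambda>i. (T1 ^^ k) (w i)))"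

text \<open>The bundle \<open>T(q)\<close>, with addition \<open>T(+\<^sub>q)\<close>, zero \<open>T(\<xi>)\<close> and lift \<open>c T(\<lambda>)\<close>.\<close>

definition T_bundle :: "('o, 'm) bundle_data \<Rightarrow> ('o, 'm) bundle_data" where
  "T_bundle B =
     \<lparr>tot = T0 (tot B), base = T0 (base B), prj = T1 (prj B), zer = T1 (zer B),
      tot2 = T0 (tot2 B), fst2 = T1 (fst2 B), snd2 = T1 (snd2 B),
      addn = T1 (addn B), nega = T1 (nega B), lft = \<c> (tot B) \<cdot> T1 (lft B)\<rparr>"

definition is_functor :: bool where
  "is_functor \<longleftrightarrow>
     (\<forall>X \<in> Ob C. T0 X \<in> Ob C \<and> T1 (Id C X) = Id C (T0 X)) \<and>
     (\<forall>X Y f. f \<in> hom C X Y \<longrightarrow> T1 f \<in> hom C (T0 X) (T0 Y)) \<and>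
     (\<forall>X Y Z f g. f \<in> hom C X Y \<longrightarrow> g \<in> hom C Y Z \<longrightarrow> T1 (g \<cdot> f) = T1 g \<cdot> T1 f)"

text \<open>
  Naturality of \<open>p\<close>, \<open>0\<close> and \<open>+\<close> says exactly that every \<open>(T(f), f)\<close> is a morphism of additive
  bundles.
\<close>

definition tangent_category :: bool where
  "tangent_category \<longleftrightarrow>
     is_category C \<and> is_functor \<and>
     (\<forall>M \<in> Ob C.
        tot (tb C M) = T0 M \<and> base (tb C M) = M \<and>
        additive_bundle C (tb C M) \<and>
        has_stable_powers (\<p> M) \<and>
        stable_pullback (\<p> M) (\<p> M) (tot2 (tb C M)) (fst2 (tb C M)) (snd2 (tb C M)) \<and>
        \<l> M \<in> hom C (T0 M) (T0 (T0 M)) \<and>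
        \<c> M \<in> hom C (T0 (T0 M)) (T0 (T0 M)) \<and>
        additive_mor C (tb C M) (T_bundle (tb C M)) (\<l> M) (\<o> M) \<and>
        additive_mor C (T_bundle (tb C M)) (tb C (T0 M)) (\<c> M) (Id C (T0 M)) \<and>
        \<c> M \<cdot> \<c> M = Id C (T0 (T0 M)) \<and>
        T1 (\<c> M) \<cdot> \<c> (T0 M) \<cdot> T1 (\<c> M) = \<c> (T0 M) \<cdot> T1 (\<c> M) \<cdot> \<c> (T0 M) \<and>
        \<c> M \<cdot> \<l> M = \<l> M \<and>
        T1 (\<l> M) \<cdot> \<l> M = \<l> (T0 M) \<cdot> \<l> M \<and>
        \<c> (T0 M) \<cdot> T1 (\<c> M) \<cdot> \<l> (T0 M) = T1 (\<l> M) \<cdot> \<c> M \<and>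
        stable_equaliser (T1 (\<p> M)) (\<o> M \<cdot> \<p> M \<cdot> \<p> (T0 M)) (tot2 (tb C M))
          (plus_in C (T_bundle (tb C M))
             (\<o> (T0 M) \<cdot> snd2 (tb C M)) (\<l> M \<cdot> fst2 (tb C M)))) \<and>
     (\<forall>M N f. f \<in> hom C M N \<longrightarrow>
        additive_mor C (tb C M) (tb C N) (T1 f) f \<and>
        T1 (T1 f) \<cdot> \<l> M = \<l> N \<cdot> T1 f \<and>
        T1 (T1 f) \<cdot> \<c> M = \<c> N \<cdot> T1 (T1 f))"

section \<open>Differential bundles\<close>

definition mu :: "('o, 'm) bundle_data \<Rightarrow> 'm" where
  "mu B = plus_in C (T_bundle B) (\<o> (tot B) \<cdot> fst2 B) (lft B \<cdot> snd2 B)"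

definition differential_bundle :: "('o, 'm) bundle_data \<Rightarrow> bool" where
  "differential_bundle B \<longleftrightarrow>
     additive_bundle C B \<and>
     has_stable_powers (prj B) \<and>
     stable_pullback (prj B) (prj B) (tot2 B) (fst2 B) (snd2 B) \<and>
     lft B \<in> hom C (tot B) (T0 (tot B)) \<and>
     additive_mor C B (T_bundle B) (lft B) (\<o> (base B)) \<and>
     additive_mor C B (tb C (tot B)) (lft B) (zer B) \<and>
     T1 (lft B) \<cdot> lft B = \<l> (tot B) \<cdot> lft B \<and>
     stable_equaliser (T1 (prj B)) (\<o> (base B) \<cdot> prj B \<cdot> \<p> (tot B)) (tot2 B) (mu B)"

text \<open>
  Linearity involves only projections and lifts, so a bundle is given here by this pair.
\<close>

definition linear_mor :: "'m \<Rightarrow> 'm \<Rightarrow> 'm \<Rightarrow> 'm \<Rightarrow> 'm \<Rightarrow> 'm \<Rightarrow> bool" where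
  "linear_mor q lam q' lam' \<phi>\<^sub>1 \<phi>\<^sub>0 \<longleftrightarrow>
     bundle_mor C q q' \<phi>\<^sub>1 \<phi>\<^sub>0 \<and> T1 \<phi>\<^sub>1 \<cdot> lam = lam' \<cdot> \<phi>\<^sub>1"

text \<open>
  The standing assumption on limits.  Apart from pullback powers and the equalisers \<open>mu\<close>, which
  belong to the definitions above, every limit used below is a terminal object or a pullback of a
  differential bundle along an arrow (products with a differential object being pullbacks over
  the terminal object).
\<close>

definition limits_exist :: bool where
  "limits_exist \<longleftrightarrow>
     (\<forall>I. is_terminal C I \<longrightarrow> is_terminal C (T0 I)) \<and>
     (\<forall>B f. differential_bundle B \<longrightarrow> f \<in> Ar C \<longrightarrow> Cod C f = base B \<longrightarrow>
        (\<exists>P a b. stable_pullback f (prj B) P a b))"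

definition chosen_pullback :: "'m \<Rightarrow> 'm \<Rightarrow> 'o \<times> 'm \<times> 'm" where
  "chosen_pullback f g = (SOME (P, a, b). stable_pullback f g P a b)"

text \<open>The canonical map \<open>h\<^sub>f : f\<^sup>*E \<rightarrow> E\<close> and the bundle \<open>f\<^sup>*E\<close>.\<close>

definition pull_map :: "'m \<Rightarrow> ('o, 'm) bundle_data \<Rightarrow> 'm" where
  "pull_map f B = (case chosen_pullback f (prj B) of (P, a, b) \<Rightarrow> b)"

definition pull_bundle :: "'m \<Rightarrow> ('o, 'm) bundle_data \<Rightarrow> ('o, 'm) bundle_data" where
  "pull_bundle f B =
     (case chosen_pullback f (prj B) of (P, a, b) \<Rightarrow>
      case chosen_pullback a a of (P2, s, t) \<Rightarrow>
      \<lparr>tot = P, base = Dom C f, prj = a,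
       zer = pair C a b (Id C (Dom C f)) (zer B \<cdot> f),
       tot2 = P2, fst2 = s, snd2 = t,
       addn = pair C a b (a \<cdot> s) (plus_in C B (b \<cdot> s) (b \<cdot> t)),
       nega = pair C a b a (nega B \<cdot> b),
       lft = pair C (T1 a) (T1 b) (\<o> (Dom C f) \<cdot> a) (lft B \<cdot> b)\<rparr>)"

section \<open>Unit objects\<close>

definition differential_object :: "('o, 'm) bundle_data \<Rightarrow> bool" where
  "differential_object R \<longleftrightarrow> differential_bundle R \<and> is_terminal C (base R)"

definition phat :: "('o, 'm) bundle_data \<Rightarrow> 'm" where
  "phat R = snd2 R \<cdot>
     (THE i. i \<in> hom C (T0 (tot R)) (tot2 R) \<and>
        i \<cdot> mu R = Id C (tot2 R) \<and> mu R \<cdot> i = Id C (T0 (tot R)))"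

text \<open>
  The next two definitions speak about the slice tangent category over \<open>M\<close>.  Its differential
  objects are the differential bundles over \<open>M\<close>, its products are fibre products over \<open>M\<close>, and a
  point \<open>1 \<rightarrow> R\<close> is a section of \<open>R\<close>.  An element of the slice tangent object \<open>T\<^sub>M(E)\<close>, the
  pullback of \<open>T(q)\<close> along \<open>0 : M \<rightarrow> T(M)\<close>, is an element \<open>w\<close> of \<open>T(E)\<close> with \<open>T(q) w\<close> a zero
  vector; \<open>T\<^sub>M(g)\<close> sends \<open>w\<close> to \<open>T(g) w\<close>, and the zero and the lifts are those of the ambient
  category.  Hence equations in \<open>T\<^sub>M(E)\<close> are written in \<open>T(E)\<close>.

  \<open>is_hat R u x E f Y y\<^sub>0 y\<^sub>1 g\<close>: for \<open>x : X \<rightarrow> M\<close> and \<open>Y = R \<times>\<^sub>M X\<close> with projections \<open>y\<^sub>0\<close>, \<open>y\<^sub>1\<close>,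
  the arrow \<open>g : Y \<rightarrow> E\<close> over \<open>M\<close> is linear in \<open>R\<close> and extends \<open>f : X \<rightarrow> E\<close> along the point \<open>u\<close>.
\<close>

definition is_hat ::
  "('o, 'm) bundle_data \<Rightarrow> 'm \<Rightarrow> 'm \<Rightarrow> ('o, 'm) bundle_data \<Rightarrow> 'm \<Rightarrow> 'o \<Rightarrow> 'm \<Rightarrow> 'm \<Rightarrow> 'm \<Rightarrow> bool" where
  "is_hat R u x E f Y y\<^sub>0 y\<^sub>1 g \<longleftrightarrow>
     g \<in> hom C Y (tot E) \<and> prj E \<cdot> g = x \<cdot> y\<^sub>1 \<and>
     T1 g \<cdot> pair C (T1 y\<^sub>0) (T1 y\<^sub>1) (lft R \<cdot> y\<^sub>0) (\<o> (Dom C x) \<cdot> y\<^sub>1) = lft E \<cdot> g \<and>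
     g \<cdot> pair C y\<^sub>0 y\<^sub>1 (u \<cdot> x) (Id C (Dom C x)) = f"

text \<open>
  \<open>R\<close> with the point \<open>u\<close> is a non-fibred unit object in the slice over \<open>M\<close>; here
  \<open>X = V \<times>\<^sub>M W\<close> with projections \<open>v\<close>, \<open>w\<close>, and \<open>Y = R \<times>\<^sub>M X\<close>.
\<close>

definition slice_unit :: "'o \<Rightarrow> ('o, 'm) bundle_data \<Rightarrow> 'm \<Rightarrow> bool" where
  "slice_unit M R u \<longleftrightarrow>
     differential_bundle R \<and> base R = M \<and> u \<in> hom C M (tot R) \<and> prj R \<cdot> u = Id C M \<and>
     (\<forall>V W E X v w f Y y\<^sub>0 y\<^sub>1.
        differential_bundle V \<longrightarrow> base V = M \<longrightarrow>
        differential_bundle W \<longrightarrow> base W = M \<longrightarrow>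
        differential_bundle E \<longrightarrow> base E = M \<longrightarrow>
        stable_pullback (prj V) (prj W) X v w \<longrightarrow>
        stable_pullback (prj R) (prj V \<cdot> v) Y y\<^sub>0 y\<^sub>1 \<longrightarrow>
        f \<in> hom C X (tot E) \<longrightarrow> prj E \<cdot> f = prj V \<cdot> v \<longrightarrow>
        (\<exists>!g. is_hat R u (prj V \<cdot> v) E f Y y\<^sub>0 y\<^sub>1 g) \<and>
        (T1 f \<cdot> pair C (T1 v) (T1 w) (\<o> (tot V) \<cdot> v) (lft W \<cdot> w) = lft E \<cdot> f \<longrightarrow>
         (\<forall>g. is_hat R u (prj V \<cdot> v) E f Y y\<^sub>0 y\<^sub>1 g \<longrightarrow>
            T1 g \<cdot> pair C (T1 y\<^sub>0) (T1 y\<^sub>1) (\<o> (tot R) \<cdot> y\<^sub>0)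
                     (pair C (T1 v) (T1 w) (\<o> (tot V) \<cdot> v \<cdot> y\<^sub>1) (lft W \<cdot> w \<cdot> y\<^sub>1))
              = lft E \<cdot> g)))"

definition bang :: "('o, 'm) bundle_data \<Rightarrow> 'o \<Rightarrow> 'm" where
  "bang R X = (THE f. f \<in> hom C X (base R))"

text \<open>
  The trivial bundle \<open>R \<times> X \<rightarrow> X\<close>; its projection to \<open>X\<close> is \<open>prj (trivial R X)\<close>, that to \<open>R\<close> is
  \<open>to_R R X\<close>, and \<open>elt R X r x\<close> is the element \<open>(r, x)\<close> of \<open>R \<times> X\<close>.
\<close>

definition trivial :: "('o, 'm) bundle_data \<Rightarrow> 'o \<Rightarrow> ('o, 'm) bundle_data" where
  "trivial R X = pull_bundle (bang R X) R"

definition to_R :: "('o, 'm) bundle_data \<Rightarrow> 'o \<Rightarrow> 'm" where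
  "to_R R X = pull_map (bang R X) R"

definition elt :: "('o, 'm) bundle_data \<Rightarrow> 'o \<Rightarrow> 'm \<Rightarrow> 'm \<Rightarrow> 'm" where
  "elt R X r x = pair C (to_R R X) (prj (trivial R X)) r x"

text \<open>
  Scalar multiplication \<open>R \<times> A \<rightarrow> A\<close> of a bundle over \<open>M\<close>: the hat of \<open>id\<^sub>A\<close> in the slice over \<open>M\<close>,
  where \<open>R \<times> A\<close> is the fibre product \<open>(R \<times> M) \<times>\<^sub>M A\<close> with projections \<open>(r, a) \<mapsto> (r, \<pi> a)\<close> and
  \<open>(r, a) \<mapsto> a\<close>.
\<close>

definition point_over :: "('o, 'm) bundle_data \<Rightarrow> 'm \<Rightarrow> 'o \<Rightarrow> 'm" where
  "point_over R u M = elt R M (u \<cdot> bang R M) (Id C M)"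

definition scal :: "('o, 'm) bundle_data \<Rightarrow> 'm \<Rightarrow> ('o, 'm) bundle_data \<Rightarrow> 'm" where
  "scal R u A =
     (THE s. is_hat (trivial R (base A)) (point_over R u (base A)) (prj A) A (Id C (tot A))
        (tot (trivial R (tot A)))
        (elt R (base A) (to_R R (tot A)) (prj A \<cdot> prj (trivial R (tot A))))
        (prj (trivial R (tot A))) s)"

definition smul :: "('o, 'm) bundle_data \<Rightarrow> 'm \<Rightarrow> ('o, 'm) bundle_data \<Rightarrow> 'm \<Rightarrow> 'm \<Rightarrow> 'm" where
  "smul R u A r a = scal R u A \<cdot> elt R (tot A) r a"

definition smul_T :: "('o, 'm) bundle_data \<Rightarrow> 'm \<Rightarrow> ('o, 'm) bundle_data \<Rightarrow> 'm \<Rightarrow> 'm \<Rightarrow> 'm" where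
  "smul_T R u A s v =
     T1 (scal R u A) \<cdot> pair C (T1 (to_R R (tot A))) (T1 (prj (trivial R (tot A)))) s v"

definition unit_object :: "('o, 'm) bundle_data \<Rightarrow> 'm \<Rightarrow> bool" where
  "unit_object R u \<longleftrightarrow>
     differential_object R \<and> u \<in> hom C (base R) (tot R) \<and>
     (\<forall>M \<in> Ob C. slice_unit M (trivial R M) (point_over R u M)) \<and>
     (\<forall>A N f Z r a.
        differential_bundle A \<longrightarrow> f \<in> hom C N (base A) \<longrightarrow>
        r \<in> hom C Z (tot R) \<longrightarrow> a \<in> hom C Z (tot (pull_bundle f A)) \<longrightarrow>
        pull_map f A \<cdot> smul R u (pull_bundle f A) r a = smul R u A r (pull_map f A \<cdot> a)) \<and>
     (\<forall>A Z r v.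
        differential_bundle A \<longrightarrow> r \<in> hom C Z (tot R) \<longrightarrow> v \<in> hom C Z (T0 (tot A)) \<longrightarrow>
        smul_T R u A (lft R \<cdot> r) v =
          plus_in C (tb C (tot A))
            (smul R u (T_bundle A) r (lft A \<cdot> \<p> (tot A) \<cdot> v))
            (T1 (zer A \<cdot> prj A) \<cdot> v))"

section \<open>Involution algebroids\<close>

definition anchored_bundle :: "('o, 'm) bundle_data \<Rightarrow> 'm \<Rightarrow> bool" where
  "anchored_bundle A \<rho> \<longleftrightarrow>
     differential_bundle A \<and>
     linear_mor (prj A) (lft A) (\<p> (base A)) (\<l> (base A)) \<rho> (Id C (base A))"

text \<open>
  \<open>P\<close> with projections \<open>\<pi>\<^sub>0\<close>, \<open>\<pi>\<^sub>1\<close> is the prolongation \<open>A \<times>\<^bsub>\<rho>,T(\<pi>)\<^esub> T(A)\<close>; its two lifts are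
  \<open>0 \<times> c T(\<lambda>)\<close> and \<open>\<lambda> \<times> l\<close>.
\<close>

definition involution_algebroid ::
  "('o, 'm) bundle_data \<Rightarrow> 'm \<Rightarrow> 'o \<Rightarrow> 'm \<Rightarrow> 'm \<Rightarrow> 'm \<Rightarrow> bool" where
  "involution_algebroid A \<rho> P \<pi>\<^sub>0 \<pi>\<^sub>1 \<alpha> \<longleftrightarrow>
     anchored_bundle A \<rho> \<and>
     stable_pullback \<rho> (T1 (prj A)) P \<pi>\<^sub>0 \<pi>\<^sub>1 \<and>
     \<alpha> \<in> hom C P (T0 (tot A)) \<and>
     linear_mor
       \<pi>\<^sub>0 (pair C (T1 \<pi>\<^sub>0) (T1 \<pi>\<^sub>1) (\<o> (tot A) \<cdot> \<pi>\<^sub>0) ((\<c> (tot A) \<cdot> T1 (lft A)) \<cdot> \<pi>\<^sub>1))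
       (\<p> (tot A)) (\<l> (tot A)) \<alpha> (Id C (tot A)) \<and>
     linear_mor
       (\<p> (tot A) \<cdot> \<pi>\<^sub>1) (pair C (T1 \<pi>\<^sub>0) (T1 \<pi>\<^sub>1) (lft A \<cdot> \<pi>\<^sub>0) (\<l> (tot A) \<cdot> \<pi>\<^sub>1))
       (T1 (prj A)) (\<c> (tot A) \<cdot> T1 (lft A)) \<alpha> \<rho> \<and>
     T1 \<rho> \<cdot> \<alpha> = \<c> (base A) \<cdot> T1 \<rho> \<cdot> \<pi>\<^sub>1 \<and>
     \<alpha> \<cdot> pair C \<pi>\<^sub>0 \<pi>\<^sub>1 (zer A \<cdot> prj A) (lft A) = lft A \<and>
     \<alpha> \<cdot> pair C \<pi>\<^sub>0 \<pi>\<^sub>1 (\<p> (tot A) \<cdot> \<pi>\<^sub>1) \<alpha> = \<pi>\<^sub>1 \<and>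
     (\<forall>Z v w x.
        v \<in> hom C Z (tot A) \<longrightarrow> w \<in> hom C Z (T0 (tot A)) \<longrightarrow>
        x \<in> hom C Z (T0 (T0 (tot A))) \<longrightarrow>
        \<rho> \<cdot> v = T1 (prj A) \<cdot> w \<longrightarrow>
        \<c> (base A) \<cdot> T1 (T1 (prj A)) \<cdot> x = T1 \<rho> \<cdot> w \<longrightarrow>
        T1 \<alpha> \<cdot> pair C (T1 \<pi>\<^sub>0) (T1 \<pi>\<^sub>1) (\<alpha> \<cdot> pair C \<pi>\<^sub>0 \<pi>\<^sub>1 v w) x =
        \<c> (tot A) \<cdot> T1 \<alpha> \<cdot> pair C (T1 \<pi>\<^sub>0) (T1 \<pi>\<^sub>1)
          (\<alpha> \<cdot> pair C \<pi>\<^sub>0 \<pi>\<^sub>1 v (\<p> (T0 (tot A)) \<cdot> x))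
          (\<c> (tot A) \<cdot> T1 \<alpha> \<cdot> pair C (T1 \<pi>\<^sub>0) (T1 \<pi>\<^sub>1) w (\<c> (tot A) \<cdot> x)))"

definition sections :: "('o, 'm) bundle_data \<Rightarrow> 'm set" where
  "sections A = {X \<in> hom C (base A) (tot A). prj A \<cdot> X = Id C (base A)}"

definition bracket ::
  "('o, 'm) bundle_data \<Rightarrow> 'm \<Rightarrow> 'm \<Rightarrow> 'm \<Rightarrow> 'm \<Rightarrow> 'm \<Rightarrow> 'm \<Rightarrow> 'm" where
  "bracket A \<rho> \<pi>\<^sub>0 \<pi>\<^sub>1 \<alpha> X Y =
     (THE Z. Z \<in> sections A \<and>
        lft A \<cdot> Z =
          minus_in C (T_bundle A)
            (minus_in C (tb C (tot A))
               (\<alpha> \<cdot> pair C \<pi>\<^sub>0 \<pi>\<^sub>1 X (T1 Y \<cdot> \<rho> \<cdot> X))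
               (T1 X \<cdot> \<rho> \<cdot> Y))
            (\<o> (tot A) \<cdot> X))"

definition lie_derivative :: "('o, 'm) bundle_data \<Rightarrow> 'm \<Rightarrow> 'm \<Rightarrow> 'm" where
  "lie_derivative R \<chi> f = phat R \<cdot> T1 f \<cdot> \<chi>"

end

end

theory Submission
  imports Defs
begin

text \<open>
  All computations are made on generalised elements.  The two main tools are these.

  \<^item> A lift is monic, because \<open>\<lambda> e = \<mu>(\<xi> q e, e)\<close> and \<open>\<mu>\<close> is an equaliser.  Hence a map \<open>h\<close> that
    commutes with lifts is additive: \<open>\<lambda>'(h(x + y)) = T(h)(\<lambda> x +\<^sub>p \<lambda> y) = \<lambda>'(h x + h y)\<close>
    (\<open>linear_additive\<close>).  This gives both additivity properties of \<open>\<alpha>\<close> (\<open>al_plus_T\<close>, \<open>al_plus_p\<close>)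
    and the additivity of \<open>T(\<bullet>)\<close> in the scalar (\<open>smul_T_plus_T\<close>).
  \<^item> A map \<open>g : R \<times> M \<rightarrow> A\<close> over \<open>M\<close> that is linear in \<open>R\<close> and has \<open>g(u, m) = y(m)\<close> is
    \<open>g(r, m) = r \<bullet> y(m)\<close> (\<open>smul_unique\<close>).

  Write \<open>v = T(Y) \<rho> X\<close> and \<open>s = T(f) \<rho> X\<close>, so that \<open>T(f \<bullet> Y) \<rho> X = T(\<bullet>)(s, v)\<close>.  The
  isomorphism \<open>\<mu> : R \<times> R \<rightarrow> T(R)\<close> decomposes \<open>s\<close> as \<open>0 f + \<lambda> b\<close> for \<open>T(+\<^sub>R)\<close>, where
  \<open>b = \<L>(f)\<close> is the derivative of \<open>f\<close> along \<open>\<rho> X\<close> (\<open>phat_decomposition\<close>).  In the second summand,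
  \<open>(\<lambda> b, v) = (\<lambda> b, 0 Y) +\<^sub>p (0 0, v)\<close>, whence \<open>T(\<bullet>)(\<lambda> b, v) = \<lambda>(b \<bullet> Y) +\<^sub>p T(\<xi>) \<rho> X\<close>
  (\<open>smul_T_lft\<close>).  Linearity of \<open>\<alpha>\<close> and \<open>\<alpha>(\<xi> \<pi>, \<lambda>) = \<lambda>\<close> then give
  \<open>\<alpha>(X, T(f \<bullet> Y) \<rho> X) = \<alpha>(X, T(\<bullet>)(0 f, v)) +\<^sub>p (\<lambda>(b \<bullet> Y) +\<^bsub>T(\<pi>)\<^esub> 0 X)\<close>.

  The remaining part of the bracket is \<open>f \<bullet> [X, Y]\<close>: the map \<open>g : R \<times> M \<rightarrow> A\<close> determined by
  \<open>\<lambda> g(r, m) = (\<alpha>(X, T(\<bullet>)(0 r, v)) -\<^sub>p T(X) \<rho> (r \<bullet> Y)) -\<^bsub>T(\<pi>)\<^esub> 0 X\<close> is linear in \<open>r\<close>, as one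
  sees after applying the monic \<open>T(\<lambda>)\<close>, and \<open>g(u, m) = [X, Y](m)\<close>; by uniqueness
  \<open>g(r, m) = r \<bullet> [X, Y](m)\<close> (\<open>smul_bracket\<close>).  The interchange law for \<open>+\<^sub>p\<close> and \<open>+\<^bsub>T(\<pi>)\<^esub>\<close> combines
  the two parts.
\<close>

locale tangent_setting =
  fixes C :: "('o, 'm, 'z) tangent_scheme" (structure)
  assumes tangent: "tangent_category C"
begin

text \<open>Fibrewise sum and difference of two elements of the total object of a bundle.\<close>

abbreviation plus_at ("(_ \<oplus>\<^bsub>_\<^esub> _)" [66, 0, 67] 66) where
  "x \<oplus>\<^bsub>B\<^esub> y \<equiv> plus_in C B x y"

abbreviation minus_at ("(_ \<ominus>\<^bsub>_\<^esub> _)" [66, 0, 67] 66) where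
  "x \<ominus>\<^bsub>B\<^esub> y \<equiv> minus_in C B x y"

section \<open>Generalised elements\<close>

lemma category: "is_category C"
  using tangent by (simp add: tangent_category_def)

lemma hom_iff [simp]: "f \<in> hom C X Y \<longleftrightarrow> f \<in> Ar C \<and> Dom C f = X \<and> Cod C f = Y"
  by (simp add: hom_def)

lemma category_laws:
  shows "f \<in> Ar C \<Longrightarrow> Dom C f \<in> Ob C" "f \<in> Ar C \<Longrightarrow> Cod C f \<in> Ob C"
    "X \<in> Ob C \<Longrightarrow> Id C X \<in> hom C X X"
    "f \<in> hom C X Y \<Longrightarrow> g \<in> hom C Y Z \<Longrightarrow> g \<cdot> f \<in> hom C X Z"
    "f \<in> hom C X Y \<Longrightarrow> f \<cdot> Id C X = f" "f \<in> hom C X Y \<Longrightarrow> Id C Y \<cdot> f = f"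
    "f \<in> hom C W X \<Longrightarrow> g \<in> hom C X Y \<Longrightarrow> h \<in> hom C Y Z \<Longrightarrow> h \<cdot> (g \<cdot> f) = (h \<cdot> g) \<cdot> f"
  using category unfolding is_category_def by blast+

lemma comp_typing [simp]:
  assumes "f \<in> Ar C" "g \<in> Ar C" "Cod C f = Dom C g"
  shows "g \<cdot> f \<in> Ar C" "Dom C (g \<cdot> f) = Dom C f" "Cod C (g \<cdot> f) = Cod C g"
  using category_laws(4)[of f "Dom C f" "Dom C g" g "Cod C g"] assms by simp_all

lemma Dom_Ob [simp]: "f \<in> Ar C \<Longrightarrow> Dom C f \<in> Ob C"
  and Cod_Ob [simp]: "f \<in> Ar C \<Longrightarrow> Cod C f \<in> Ob C"
  using category_laws(1,2) by auto

lemma Id_typing [simp]: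
  assumes "X \<in> Ob C"
  shows "Id C X \<in> Ar C" "Dom C (Id C X) = X" "Cod C (Id C X) = X"
  using category_laws(3)[OF assms] by simp_all

lemma comp_Id [simp]: "f \<in> Ar C \<Longrightarrow> Dom C f = X \<Longrightarrow> f \<cdot> Id C X = f"
  and Id_comp [simp]: "f \<in> Ar C \<Longrightarrow> Cod C f = X \<Longrightarrow> Id C X \<cdot> f = f"
  using category_laws(5)[of f X "Cod C f"] category_laws(6)[of f "Dom C f" X] by simp_all

lemma comp_assoc [simp]:
  assumes "f \<in> Ar C" "g \<in> Ar C" "h \<in> Ar C" "Cod C f = Dom C g" "Cod C g = Dom C h"
  shows "(h \<cdot> g) \<cdot> f = h \<cdot> (g \<cdot> f)"
  using category_laws(7)[of f "Dom C f" "Dom C g" g "Dom C h" h "Cod C h"] assms by simp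

text \<open>An equation between composites, applied to an element.\<close>

lemma comp_eq_at:
  assumes "g \<cdot> f = k" "f \<in> Ar C" "g \<in> Ar C" "Cod C f = Dom C g" "x \<in> Ar C" "Cod C x = Dom C f"
  shows "g \<cdot> (f \<cdot> x) = k \<cdot> x"
  unfolding assms(1)[symmetric] using assms(2-) by simp

lemma comp_eq_comp_at:
  assumes "g \<cdot> f = g' \<cdot> f'" "f \<in> Ar C" "g \<in> Ar C" "Cod C f = Dom C g"
    "f' \<in> Ar C" "g' \<in> Ar C" "Cod C f' = Dom C g'" "x \<in> Ar C" "Cod C x = Dom C f" "Dom C f' = Dom C f"
  shows "g \<cdot> (f \<cdot> x) = g' \<cdot> (f' \<cdot> x)"
  using comp_eq_at[OF assms(1-4,8,9)] assms by simp

lemma pb_sym: "is_pullback C f g P a b \<Longrightarrow> is_pullback C g f P b a"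
  unfolding is_pullback_def
  apply (elim conjE, intro conjI)
        apply (simp_all del: hom_iff)
  subgoal premises prems
  proof (intro allI impI)
    fix Z x y assume "x \<in> hom C Z (Dom C g)" "y \<in> hom C Z (Dom C f)" "g \<cdot> x = f \<cdot> y"
    then have "\<exists>!h. h \<in> hom C Z P \<and> a \<cdot> h = y \<and> b \<cdot> h = x" using prems by metis
    then show "\<exists>!h. h \<in> hom C Z P \<and> b \<cdot> h = x \<and> a \<cdot> h = y" by (simp only: conj_commute conj_left_commute conj_assoc)
  qed
  done

lemma pb_eqI:
  assumes "is_pullback C f g P a b" "h \<in> Ar C" "h' \<in> Ar C" "Cod C h = P" "Cod C h' = P"
    "Dom C h = Dom C h'" "a \<cdot> h = a \<cdot> h'" "b \<cdot> h = b \<cdot> h'"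
  shows "h = h'"
proof -
  have t: "a \<in> Ar C" "b \<in> Ar C" "f \<in> Ar C" "g \<in> Ar C" "Dom C a = P" "Dom C b = P"
     "Cod C a = Dom C f" "Cod C b = Dom C g" "f \<cdot> a = g \<cdot> b"
    using assms(1) by (auto simp: is_pullback_def)
  have "f \<cdot> (a \<cdot> h) = g \<cdot> (b \<cdot> h)"
    using comp_eq_comp_at[OF t(9)] t assms by simp
  moreover have "a \<cdot> h \<in> hom C (Dom C h) (Dom C f)" "b \<cdot> h \<in> hom C (Dom C h) (Dom C g)"
    using t assms by auto
  ultimately have "\<exists>!k. k \<in> hom C (Dom C h) P \<and> a \<cdot> k = a \<cdot> h \<and> b \<cdot> k = b \<cdot> h"
    using assms(1) unfolding is_pullback_def by blast
  then show ?thesis using assms by (auto simp del: comp_assoc)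
qed

lemma pb_pair:
  assumes "is_pullback C f g P a b" "x \<in> Ar C" "y \<in> Ar C" "Cod C x = Dom C f" "Cod C y = Dom C g"
    "Dom C x = Dom C y" "f \<cdot> x = g \<cdot> y"
  shows "pair C a b x y \<in> Ar C" "Dom C (pair C a b x y) = Dom C x" "Cod C (pair C a b x y) = P"
    "a \<cdot> pair C a b x y = x" "b \<cdot> pair C a b x y = y"
proof -
  have D: "Dom C a = P" using assms(1) by (auto simp: is_pullback_def)
  have "x \<in> hom C (Dom C x) (Dom C f)" "y \<in> hom C (Dom C x) (Dom C g)" using assms by auto
  then have "\<exists>!h. h \<in> hom C (Dom C x) P \<and> a \<cdot> h = x \<and> b \<cdot> h = y"
    using assms(1,7) unfolding is_pullback_def by blast
  from theI'[OF this]
  show "pair C a b x y \<in> Ar C" "Dom C (pair C a b x y) = Dom C x" "Cod C (pair C a b x y) = P"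
    "a \<cdot> pair C a b x y = x" "b \<cdot> pair C a b x y = y"
    unfolding pair_def D by auto
qed

lemma pb_pair_eq:
  assumes "is_pullback C f g P a b" "h \<in> Ar C" "Cod C h = P" "a \<cdot> h = x" "b \<cdot> h = y"
  shows "pair C a b x y = h"
proof -
  have t: "a \<in> Ar C" "b \<in> Ar C" "f \<in> Ar C" "g \<in> Ar C" "Dom C a = P" "Dom C b = P"
     "Cod C a = Dom C f" "Cod C b = Dom C g" "f \<cdot> a = g \<cdot> b"
    using assms(1) by (auto simp: is_pullback_def)
  have "f \<cdot> (a \<cdot> h) = g \<cdot> (b \<cdot> h)"
    using comp_eq_comp_at[OF t(9)] t assms(2,3) by simp
  then have "f \<cdot> x = g \<cdot> y" using assms(4,5) by simp
  note pp = pb_pair[OF assms(1) _ _ _ _ _ this]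
  show ?thesis
    by (rule pb_eqI[OF assms(1)]) (use assms t pp in auto)
qed

lemma pair_comp:
  assumes "is_pullback C f g P a b" "x \<in> Ar C" "y \<in> Ar C" "Cod C x = Dom C f" "Cod C y = Dom C g"
    "Dom C x = Dom C y" "f \<cdot> x = g \<cdot> y" "z \<in> Ar C" "Cod C z = Dom C x"
  shows "pair C a b x y \<cdot> z = pair C a b (x \<cdot> z) (y \<cdot> z)"
proof -
  have t: "a \<in> Ar C" "b \<in> Ar C" "Dom C a = P" "Dom C b = P"
    using assms(1) by (auto simp: is_pullback_def)
  note pp = pb_pair[OF assms(1-7)]
  show ?thesis
    by (rule pb_pair_eq[OF assms(1), symmetric])
      (use assms t pp comp_eq_at[OF pp(4)] comp_eq_at[OF pp(5)] in auto)
qed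

section \<open>Additive bundles\<close>

lemma additive_typing [simp]:
  assumes "additive_bundle C B"
  shows "prj B \<in> Ar C" "Dom C (prj B) = tot B" "Cod C (prj B) = base B"
    "zer B \<in> Ar C" "Dom C (zer B) = base B" "Cod C (zer B) = tot B"
    "fst2 B \<in> Ar C" "Dom C (fst2 B) = tot2 B" "Cod C (fst2 B) = tot B"
    "snd2 B \<in> Ar C" "Dom C (snd2 B) = tot2 B" "Cod C (snd2 B) = tot B"
    "addn B \<in> Ar C" "Dom C (addn B) = tot2 B" "Cod C (addn B) = tot B"
    "nega B \<in> Ar C" "Dom C (nega B) = tot B" "Cod C (nega B) = tot B"
    "tot B \<in> Ob C" "base B \<in> Ob C" "tot2 B \<in> Ob C"
proof -
  have 1: "prj B \<in> hom C (tot B) (base B)" "zer B \<in> hom C (base B) (tot B)"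
    "addn B \<in> hom C (tot2 B) (tot B)" "nega B \<in> hom C (tot B) (tot B)"
    "is_pullback C (prj B) (prj B) (tot2 B) (fst2 B) (snd2 B)"
    using assms unfolding additive_bundle_def by - (elim conjE, assumption)+
  have 2: "fst2 B \<in> hom C (tot2 B) (Dom C (prj B))" "snd2 B \<in> hom C (tot2 B) (Dom C (prj B))"
    using 1(5) unfolding is_pullback_def by - (elim conjE, assumption)+
  show "prj B \<in> Ar C" "Dom C (prj B) = tot B" "Cod C (prj B) = base B"
    "zer B \<in> Ar C" "Dom C (zer B) = base B" "Cod C (zer B) = tot B"
    "fst2 B \<in> Ar C" "Dom C (fst2 B) = tot2 B" "Cod C (fst2 B) = tot B"
    "snd2 B \<in> Ar C" "Dom C (snd2 B) = tot2 B" "Cod C (snd2 B) = tot B"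
    "addn B \<in> Ar C" "Dom C (addn B) = tot2 B" "Cod C (addn B) = tot B"
    "nega B \<in> Ar C" "Dom C (nega B) = tot B" "Cod C (nega B) = tot B"
    using 1(1-4) 2 by simp_all
  show "tot B \<in> Ob C" "base B \<in> Ob C" "tot2 B \<in> Ob C"
    using 1(1-4) Dom_Ob[of "prj B"] Cod_Ob[of "prj B"] Dom_Ob[of "addn B"] by simp_all
qed

lemma additive_prj [simp]:
  assumes "additive_bundle C B"
  shows "prj B \<cdot> zer B = Id C (base B)" "prj B \<cdot> addn B = prj B \<cdot> fst2 B" "prj B \<cdot> nega B = prj B"
    "x \<in> Ar C \<Longrightarrow> Cod C x = base B \<Longrightarrow> prj B \<cdot> (zer B \<cdot> x) = x"
    "x \<in> Ar C \<Longrightarrow> Cod C x = tot B \<Longrightarrow> prj B \<cdot> (nega B \<cdot> x) = prj B \<cdot> x"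
proof -
  show *: "prj B \<cdot> zer B = Id C (base B)" "prj B \<cdot> addn B = prj B \<cdot> fst2 B" "prj B \<cdot> nega B = prj B"
    using assms unfolding additive_bundle_def by - (elim conjE, assumption)+
  show "x \<in> Ar C \<Longrightarrow> Cod C x = base B \<Longrightarrow> prj B \<cdot> (zer B \<cdot> x) = x"
    using comp_eq_at[OF *(1)] assms by simp
  show "x \<in> Ar C \<Longrightarrow> Cod C x = tot B \<Longrightarrow> prj B \<cdot> (nega B \<cdot> x) = prj B \<cdot> x"
    using comp_eq_at[OF *(3)] assms by simp
qed

lemma additive_pb: "additive_bundle C B \<Longrightarrow> is_pullback C (prj B) (prj B) (tot2 B) (fst2 B) (snd2 B)"
  unfolding additive_bundle_def by blast

lemma pair2 [simp]:
  assumes "additive_bundle C B" "x \<in> Ar C" "y \<in> Ar C" "Cod C x = tot B" "Cod C y = tot B"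
    "Dom C x = Dom C y" "prj B \<cdot> x = prj B \<cdot> y"
  shows "pair C (fst2 B) (snd2 B) x y \<in> Ar C" "Dom C (pair C (fst2 B) (snd2 B) x y) = Dom C y"
    "Cod C (pair C (fst2 B) (snd2 B) x y) = tot2 B"
    "fst2 B \<cdot> pair C (fst2 B) (snd2 B) x y = x" "snd2 B \<cdot> pair C (fst2 B) (snd2 B) x y = y"
  using pb_pair[OF additive_pb[OF assms(1)]] assms by auto

lemma plus_typing [simp]:
  assumes "additive_bundle C B" "x \<in> Ar C" "y \<in> Ar C" "Cod C x = tot B" "Cod C y = tot B"
    "Dom C x = Dom C y" "prj B \<cdot> x = prj B \<cdot> y"
  shows "plus_in C B x y \<in> Ar C" "Dom C (plus_in C B x y) = Dom C y"
    "Cod C (plus_in C B x y) = tot B" "prj B \<cdot> plus_in C B x y = prj B \<cdot> y"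
proof -
  show "plus_in C B x y \<in> Ar C" "Dom C (plus_in C B x y) = Dom C y" "Cod C (plus_in C B x y) = tot B"
    using assms by (auto simp: plus_in_def)
  show "prj B \<cdot> plus_in C B x y = prj B \<cdot> y"
    using assms comp_eq_comp_at[OF additive_prj(2)[OF assms(1)]] by (simp add: plus_in_def)
qed

lemma plus_comp:
  assumes "additive_bundle C B" "x \<in> Ar C" "y \<in> Ar C" "Cod C x = tot B" "Cod C y = tot B"
    "Dom C x = Dom C y" "prj B \<cdot> x = prj B \<cdot> y" "z \<in> Ar C" "Cod C z = Dom C x"
  shows "plus_in C B x y \<cdot> z = plus_in C B (x \<cdot> z) (y \<cdot> z)"
  using assms pair_comp[OF additive_pb[OF assms(1)]] by (simp add: plus_in_def)

lemma addn_comp: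
  assumes "additive_bundle C B" "h \<in> Ar C" "Cod C h = tot2 B"
  shows "addn B \<cdot> h = plus_in C B (fst2 B \<cdot> h) (snd2 B \<cdot> h)"
  using assms pb_pair_eq[OF additive_pb[OF assms(1)]] by (simp add: plus_in_def)

lemma group_laws:
  assumes "additive_bundle C B" "x \<in> Ar C" "y \<in> Ar C" "z \<in> Ar C"
    "Cod C x = tot B" "Cod C y = tot B" "Cod C z = tot B"
    "Dom C x = Dom C y" "Dom C y = Dom C z" "prj B \<cdot> x = prj B \<cdot> y" "prj B \<cdot> y = prj B \<cdot> z"
  shows "plus_in C B (plus_in C B x y) z = plus_in C B x (plus_in C B y z)"
    "plus_in C B x y = plus_in C B y x"
    "plus_in C B x (zer B \<cdot> (prj B \<cdot> x)) = x"
    "plus_in C B x (nega B \<cdot> x) = zer B \<cdot> (prj B \<cdot> x)"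
proof -
  have "x \<in> hom C (Dom C x) (tot B)" "y \<in> hom C (Dom C x) (tot B)" "z \<in> hom C (Dom C x) (tot B)"
    using assms by auto
  then have "plus_in C B (plus_in C B x y) z = plus_in C B x (plus_in C B y z) \<and>
        plus_in C B x y = plus_in C B y x \<and>
        plus_in C B x (zer B \<cdot> prj B \<cdot> x) = x \<and>
        plus_in C B x (nega B \<cdot> x) = zer B \<cdot> prj B \<cdot> x"
    using assms(1,10,11) unfolding additive_bundle_def by blast
  then show "plus_in C B (plus_in C B x y) z = plus_in C B x (plus_in C B y z)"
    "plus_in C B x y = plus_in C B y x"
    "plus_in C B x (zer B \<cdot> (prj B \<cdot> x)) = x"
    "plus_in C B x (nega B \<cdot> x) = zer B \<cdot> (prj B \<cdot> x)"
    by auto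
qed

lemma plus_assoc:
  assumes "additive_bundle C B" "x \<in> Ar C" "y \<in> Ar C" "z \<in> Ar C"
    "Cod C x = tot B" "Cod C y = tot B" "Cod C z = tot B"
    "Dom C x = Dom C y" "Dom C y = Dom C z" "prj B \<cdot> x = prj B \<cdot> y" "prj B \<cdot> y = prj B \<cdot> z"
  shows "plus_in C B (plus_in C B x y) z = plus_in C B x (plus_in C B y z)"
  using group_laws(1) assms by simp

lemma plus_comm:
  assumes "additive_bundle C B" "x \<in> Ar C" "y \<in> Ar C" "Cod C x = tot B" "Cod C y = tot B"
    "Dom C x = Dom C y" "prj B \<cdot> x = prj B \<cdot> y"
  shows "plus_in C B x y = plus_in C B y x"
  using group_laws(2)[of B x y y] assms by simp

lemma plus_zer:
  assumes "additive_bundle C B" "x \<in> Ar C" "Cod C x = tot B" "n = prj B \<cdot> x"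
  shows "plus_in C B x (zer B \<cdot> n) = x" "plus_in C B (zer B \<cdot> n) x = x"
proof -
  show 1: "plus_in C B x (zer B \<cdot> n) = x"
    using group_laws(3)[of B x x x] assms by simp
  show "plus_in C B (zer B \<cdot> n) x = x"
    by (subst plus_comm) (use assms 1 in auto)
qed

lemma plus_nega:
  assumes "additive_bundle C B" "x \<in> Ar C" "Cod C x = tot B"
  shows "plus_in C B x (nega B \<cdot> x) = zer B \<cdot> (prj B \<cdot> x)"
    "plus_in C B (nega B \<cdot> x) x = zer B \<cdot> (prj B \<cdot> x)"
proof -
  show 1: "plus_in C B x (nega B \<cdot> x) = zer B \<cdot> (prj B \<cdot> x)"
    using group_laws(4)[of B x x x] assms by simp
  show "plus_in C B (nega B \<cdot> x) x = zer B \<cdot> (prj B \<cdot> x)"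
    by (subst plus_comm) (use assms 1 in auto)
qed

lemma minus_typing [simp]:
  assumes "additive_bundle C B" "x \<in> Ar C" "y \<in> Ar C" "Cod C x = tot B" "Cod C y = tot B"
    "Dom C x = Dom C y" "prj B \<cdot> x = prj B \<cdot> y"
  shows "minus_in C B x y \<in> Ar C" "Dom C (minus_in C B x y) = Dom C y"
    "Cod C (minus_in C B x y) = tot B" "prj B \<cdot> minus_in C B x y = prj B \<cdot> y"
  using assms by (auto simp: minus_in_def)

lemma minus_comp:
  assumes "additive_bundle C B" "x \<in> Ar C" "y \<in> Ar C" "Cod C x = tot B" "Cod C y = tot B"
    "Dom C x = Dom C y" "prj B \<cdot> x = prj B \<cdot> y" "z \<in> Ar C" "Cod C z = Dom C x"
  shows "minus_in C B x y \<cdot> z = minus_in C B (x \<cdot> z) (y \<cdot> z)"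
  using assms by (simp add: minus_in_def plus_comp)

lemma minus_plus_cancel:
  assumes "additive_bundle C B" "x \<in> Ar C" "y \<in> Ar C" "Cod C x = tot B" "Cod C y = tot B"
    "Dom C x = Dom C y" "prj B \<cdot> x = prj B \<cdot> y"
  shows "plus_in C B (minus_in C B x y) y = x" "minus_in C B (plus_in C B x y) y = x"
  using assms by (auto simp: minus_in_def plus_assoc plus_nega plus_zer)

lemma minus_self:
  assumes "additive_bundle C B" "x \<in> Ar C" "Cod C x = tot B"
  shows "minus_in C B x x = zer B \<cdot> (prj B \<cdot> x)"
  using assms by (simp add: minus_in_def plus_nega)

lemma minus_eqI:
  assumes "additive_bundle C B" "z \<in> Ar C" "y \<in> Ar C" "Cod C z = tot B" "Cod C y = tot B"
    "Dom C z = Dom C y" "prj B \<cdot> z = prj B \<cdot> y" "plus_in C B z y = x"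
  shows "minus_in C B x y = z"
  using minus_plus_cancel(2)[OF assms(1-7)] assms(8) by simp

lemma minus_plus_swap:
  assumes "additive_bundle C B" "a \<in> Ar C" "b \<in> Ar C" "c \<in> Ar C" "Cod C a = tot B" "Cod C b = tot B" "Cod C c = tot B"
    "Dom C a = Dom C b" "Dom C b = Dom C c" "prj B \<cdot> a = prj B \<cdot> b" "prj B \<cdot> b = prj B \<cdot> c"
  shows "(a \<oplus>\<^bsub>B\<^esub> b) \<ominus>\<^bsub>B\<^esub> c = (a \<ominus>\<^bsub>B\<^esub> c) \<oplus>\<^bsub>B\<^esub> b"
proof -
  have n: "nega B \<cdot> c \<in> Ar C" "Cod C (nega B \<cdot> c) = tot B" "Dom C (nega B \<cdot> c) = Dom C c" "prj B \<cdot> (nega B \<cdot> c) = prj B \<cdot> c"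
    using assms by simp_all
  have "(a \<oplus>\<^bsub>B\<^esub> b) \<oplus>\<^bsub>B\<^esub> (nega B \<cdot> c) = a \<oplus>\<^bsub>B\<^esub> (b \<oplus>\<^bsub>B\<^esub> (nega B \<cdot> c))"
    by (rule plus_assoc) (use assms n in simp_all)
  also have "b \<oplus>\<^bsub>B\<^esub> (nega B \<cdot> c) = (nega B \<cdot> c) \<oplus>\<^bsub>B\<^esub> b"
    by (rule plus_comm) (use assms n in simp_all)
  also have "a \<oplus>\<^bsub>B\<^esub> ((nega B \<cdot> c) \<oplus>\<^bsub>B\<^esub> b) = (a \<oplus>\<^bsub>B\<^esub> (nega B \<cdot> c)) \<oplus>\<^bsub>B\<^esub> b"
    by (rule plus_assoc[symmetric]) (use assms n in simp_all)
  finally show ?thesis by (simp add: minus_in_def)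
qed

lemma idempotent_zer:
  assumes "additive_bundle C B" "x \<in> Ar C" "Cod C x = tot B" "plus_in C B x x = x"
  shows "x = zer B \<cdot> (prj B \<cdot> x)"
  using minus_plus_cancel(2)[of B x x] minus_self[of B x] assms by simp

lemma additive_mor_typing:
  assumes "additive_mor C B B' \<phi> \<psi>" "additive_bundle C B" "additive_bundle C B'"
  shows "\<phi> \<in> Ar C" "Dom C \<phi> = tot B" "Cod C \<phi> = tot B'"
    "\<psi> \<in> Ar C" "Dom C \<psi> = base B" "Cod C \<psi> = base B'" "prj B' \<cdot> \<phi> = \<psi> \<cdot> prj B"
  using assms by (auto simp: additive_mor_def bundle_mor_def)

lemma additive_mor_prj:
  assumes "additive_mor C B B' \<phi> \<psi>" "additive_bundle C B" "additive_bundle C B'"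
    "x \<in> Ar C" "Cod C x = tot B"
  shows "prj B' \<cdot> (\<phi> \<cdot> x) = \<psi> \<cdot> (prj B \<cdot> x)"
  using comp_eq_comp_at[OF additive_mor_typing(7)[OF assms(1-3)]]
    additive_mor_typing[OF assms(1-3)] assms by simp

lemma additive_mor_zer:
  assumes "additive_mor C B B' \<phi> \<psi>" "additive_bundle C B" "additive_bundle C B'"
    "x \<in> Ar C" "Cod C x = base B"
  shows "\<phi> \<cdot> (zer B \<cdot> x) = zer B' \<cdot> (\<psi> \<cdot> x)"
proof -
  have "\<phi> \<cdot> zer B = zer B' \<cdot> \<psi>" using assms by (simp add: additive_mor_def)
  from comp_eq_comp_at[OF this] show ?thesis
    using additive_mor_typing[OF assms(1-3)] assms by simp
qed

lemma additive_mor_plus: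
  assumes "additive_mor C B B' \<phi> \<psi>" "additive_bundle C B" "additive_bundle C B'"
    "x \<in> Ar C" "y \<in> Ar C" "Cod C x = tot B" "Cod C y = tot B"
    "Dom C x = Dom C y" "prj B \<cdot> x = prj B \<cdot> y"
  shows "\<phi> \<cdot> plus_in C B x y = plus_in C B' (\<phi> \<cdot> x) (\<phi> \<cdot> y)"
proof -
  note t = additive_mor_typing[OF assms(1-3)]
  have e: "prj B \<cdot> fst2 B = prj B \<cdot> snd2 B"
    using additive_pb[OF assms(2)] by (simp add: is_pullback_def)
  have "\<phi> \<cdot> addn B = plus_in C B' (\<phi> \<cdot> fst2 B) (\<phi> \<cdot> snd2 B)"
    using assms by (simp add: additive_mor_def)
  then have "\<phi> \<cdot> (addn B \<cdot> pair C (fst2 B) (snd2 B) x y) =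
     plus_in C B' (\<phi> \<cdot> fst2 B) (\<phi> \<cdot> snd2 B) \<cdot> pair C (fst2 B) (snd2 B) x y"
    using comp_eq_at t assms by simp
  also have "\<dots> = plus_in C B' (\<phi> \<cdot> x) (\<phi> \<cdot> y)"
    using t assms additive_mor_prj[OF assms(1-3)] e by (simp add: plus_comp)
  finally show ?thesis by (simp add: plus_in_def)
qed

lemma additive_mor_nega:
  assumes "additive_mor C B B' \<phi> \<psi>" "additive_bundle C B" "additive_bundle C B'"
    "x \<in> Ar C" "Cod C x = tot B"
  shows "\<phi> \<cdot> (nega B \<cdot> x) = nega B' \<cdot> (\<phi> \<cdot> x)"
proof -
  note t = additive_mor_typing[OF assms(1-3)]
  note p = additive_mor_prj[OF assms(1-3)]
  have "plus_in C B' (\<phi> \<cdot> (nega B \<cdot> x)) (\<phi> \<cdot> x) = \<phi> \<cdot> plus_in C B (nega B \<cdot> x) x"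
    by (subst additive_mor_plus[OF assms(1-3)]) (use assms t in auto)
  also have "\<dots> = zer B' \<cdot> (\<psi> \<cdot> (prj B \<cdot> x))"
    using assms t by (simp add: plus_nega additive_mor_zer[OF assms(1-3)])
  finally have 1: "plus_in C B' (\<phi> \<cdot> (nega B \<cdot> x)) (\<phi> \<cdot> x) = zer B' \<cdot> (\<psi> \<cdot> (prj B \<cdot> x))" .
  have "minus_in C B' (zer B' \<cdot> (\<psi> \<cdot> (prj B \<cdot> x))) (\<phi> \<cdot> x) = \<phi> \<cdot> (nega B \<cdot> x)"
    by (rule minus_eqI) (use assms t p 1 in auto)
  then show ?thesis
    using assms t p by (simp add: minus_in_def plus_zer)
qed

lemma additive_mor_minus:
  assumes "additive_mor C B B' \<phi> \<psi>" "additive_bundle C B" "additive_bundle C B'"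
    "x \<in> Ar C" "y \<in> Ar C" "Cod C x = tot B" "Cod C y = tot B"
    "Dom C x = Dom C y" "prj B \<cdot> x = prj B \<cdot> y"
  shows "\<phi> \<cdot> minus_in C B x y = minus_in C B' (\<phi> \<cdot> x) (\<phi> \<cdot> y)"
  using assms by (simp add: minus_in_def additive_mor_plus additive_mor_nega)

section \<open>The tangent functor on elements\<close>

text \<open>The action of the tangent functor on arrows.\<close>

abbreviation T where "T \<equiv> TA C"

lemma functor_laws:
  shows "X \<in> Ob C \<Longrightarrow> TO C X \<in> Ob C \<and> T (Id C X) = Id C (TO C X)"
    "f \<in> hom C X Y \<Longrightarrow> T f \<in> hom C (TO C X) (TO C Y)"
    "f \<in> hom C X Y \<Longrightarrow> g \<in> hom C Y Z \<Longrightarrow> T (g \<cdot> f) = T g \<cdot> T f"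
  using tangent unfolding tangent_category_def is_functor_def by blast+

lemma T_typing [simp]:
  assumes "f \<in> Ar C"
  shows "T f \<in> Ar C" "Dom C (T f) = TO C (Dom C f)" "Cod C (T f) = TO C (Cod C f)"
  using functor_laws(2)[of f "Dom C f" "Cod C f"] assms by simp_all

lemma T_comp [simp]:
  assumes "f \<in> Ar C" "g \<in> Ar C" "Cod C f = Dom C g"
  shows "T (g \<cdot> f) = T g \<cdot> T f"
  using functor_laws(3)[of f "Dom C f" "Dom C g" g "Cod C g"] assms by simp

lemma T_Id [simp]: "X \<in> Ob C \<Longrightarrow> T (Id C X) = Id C (TO C X)"
  and T_Ob [simp]: "X \<in> Ob C \<Longrightarrow> TO C X \<in> Ob C"
  using functor_laws(1) by auto

lemma T_eq:
  assumes "g \<cdot> f = k" "f \<in> Ar C" "g \<in> Ar C" "Cod C f = Dom C g" "x \<in> Ar C" "Cod C x = TO C (Dom C f)"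
  shows "T g \<cdot> (T f \<cdot> x) = T k \<cdot> x"
  unfolding assms(1)[symmetric] using assms(2-) by simp

lemma tangent_laws:
  assumes "M \<in> Ob C"
  shows "tot (tb C M) = TO C M" "base (tb C M) = M" "additive_bundle C (tb C M)"
    "has_stable_powers C (\<p> M)"
    "stable_pullback C (\<p> M) (\<p> M) (tot2 (tb C M)) (fst2 (tb C M)) (snd2 (tb C M))"
    "\<l> M \<in> hom C (TO C M) (TO C (TO C M))"
    "\<c> M \<in> hom C (TO C (TO C M)) (TO C (TO C M))"
    "additive_mor C (tb C M) (T_bundle C (tb C M)) (\<l> M) (\<o> M)"
    "additive_mor C (T_bundle C (tb C M)) (tb C (TO C M)) (\<c> M) (Id C (TO C M))"
    "\<c> M \<cdot> \<c> M = Id C (TO C (TO C M))"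
    "\<c> M \<cdot> \<l> M = \<l> M"
    "stable_equaliser C (T (\<p> M)) (\<o> M \<cdot> \<p> M \<cdot> \<p> (TO C M))
       (tot2 (tb C M))
       ((\<o> (TO C M) \<cdot> snd2 (tb C M)) \<oplus>\<^bsub>T_bundle C (tb C M)\<^esub> (\<l> M \<cdot> fst2 (tb C M)))"
  using bspec[OF conjunct1[OF conjunct2[OF conjunct2[OF tangent[unfolded tangent_category_def]]]] assms]
  by - (elim conjE, assumption)+

lemma naturality:
  assumes "f \<in> Ar C"
  shows "additive_mor C (tb C (Dom C f)) (tb C (Cod C f)) (T f) f"
    "T (T f) \<cdot> \<l> (Dom C f) = \<l> (Cod C f) \<cdot> T f"
    "T (T f) \<cdot> \<c> (Dom C f) = \<c> (Cod C f) \<cdot> T (T f)"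
proof -
  have "f \<in> hom C (Dom C f) (Cod C f)" using assms by simp
  then have "additive_mor C (tb C (Dom C f)) (tb C (Cod C f)) (T f) f \<and>
      T (T f) \<cdot> \<l> (Dom C f) = \<l> (Cod C f) \<cdot> T f \<and>
      T (T f) \<cdot> \<c> (Dom C f) = \<c> (Cod C f) \<cdot> T (T f)"
    using tangent unfolding tangent_category_def by blast
  then show "additive_mor C (tb C (Dom C f)) (tb C (Cod C f)) (T f) f"
    "T (T f) \<cdot> \<l> (Dom C f) = \<l> (Cod C f) \<cdot> T f"
    "T (T f) \<cdot> \<c> (Dom C f) = \<c> (Cod C f) \<cdot> T (T f)" by auto
qed

lemma tb_simps [simp]:
  assumes "M \<in> Ob C"
  shows "tot (tb C M) = TO C M" "base (tb C M) = M" "additive_bundle C (tb C M)"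
    "\<l> M \<in> Ar C" "Dom C (\<l> M) = TO C M" "Cod C (\<l> M) = TO C (TO C M)"
    "\<c> M \<in> Ar C" "Dom C (\<c> M) = TO C (TO C M)" "Cod C (\<c> M) = TO C (TO C M)"
  using tangent_laws(1-3,6,7)[OF assms] by simp_all

lemma tangent_naturality [simp]:
  assumes "f \<in> Ar C" "x \<in> Ar C"
  shows "Cod C f = N \<Longrightarrow> Cod C x = TO C (Dom C f) \<Longrightarrow>
      \<p> N \<cdot> (T f \<cdot> x) = f \<cdot> (\<p> (Dom C f) \<cdot> x)"
    "Cod C x = M \<Longrightarrow> Dom C f = M \<Longrightarrow> T f \<cdot> (\<o> M \<cdot> x) = \<o> (Cod C f) \<cdot> (f \<cdot> x)"
    "Cod C x = TO C M \<Longrightarrow> Dom C f = M \<Longrightarrow>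
      T (T f) \<cdot> (\<l> M \<cdot> x) = \<l> (Cod C f) \<cdot> (T f \<cdot> x)"
    "Cod C x = TO C (TO C M) \<Longrightarrow> Dom C f = M \<Longrightarrow>
      T (T f) \<cdot> (\<c> M \<cdot> x) = \<c> (Cod C f) \<cdot> (T (T f) \<cdot> x)"
proof -
  note n = naturality[OF assms(1)]
  show "\<p> N \<cdot> (T f \<cdot> x) = f \<cdot> (\<p> (Dom C f) \<cdot> x)"
    if "Cod C f = N" "Cod C x = TO C (Dom C f)"
    using additive_mor_prj[OF n(1), of x] assms that(2) unfolding that(1)[symmetric] by simp
  show "T f \<cdot> (\<o> M \<cdot> x) = \<o> (Cod C f) \<cdot> (f \<cdot> x)"
    if "Cod C x = M" "Dom C f = M"
    using additive_mor_zer[OF n(1), of x] assms that(1) unfolding that(2)[symmetric] by simp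
  show "T (T f) \<cdot> (\<l> M \<cdot> x) = \<l> (Cod C f) \<cdot> (T f \<cdot> x)"
    if "Cod C x = TO C M" "Dom C f = M"
    using comp_eq_comp_at[OF n(2), of x] assms that(1) unfolding that(2)[symmetric] by simp
  show "T (T f) \<cdot> (\<c> M \<cdot> x) = \<c> (Cod C f) \<cdot> (T (T f) \<cdot> x)"
    if "Cod C x = TO C (TO C M)" "Dom C f = M"
    using comp_eq_comp_at[OF n(3), of x] assms that(1) unfolding that(2)[symmetric] by simp
qed

lemma T_plus:
  assumes "f \<in> Ar C" "x \<in> Ar C" "y \<in> Ar C" "Cod C x = TO C M" "Cod C y = TO C M" "Dom C f = M"
    "Dom C x = Dom C y" "\<p> M \<cdot> x = \<p> M \<cdot> y"
  shows "T f \<cdot> (x \<oplus>\<^bsub>tb C M\<^esub> y) = (T f \<cdot> x) \<oplus>\<^bsub>tb C (Cod C f)\<^esub> (T f \<cdot> y)"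
    "T f \<cdot> (x \<ominus>\<^bsub>tb C M\<^esub> y) = (T f \<cdot> x) \<ominus>\<^bsub>tb C (Cod C f)\<^esub> (T f \<cdot> y)"
proof -
  have M: "M \<in> Ob C" using assms by auto
  show "T f \<cdot> (x \<oplus>\<^bsub>tb C M\<^esub> y) = (T f \<cdot> x) \<oplus>\<^bsub>tb C (Cod C f)\<^esub> (T f \<cdot> y)"
    using additive_mor_plus[OF naturality(1)[OF assms(1)], of x y] assms(1-5,7,8) M
    unfolding assms(6) by simp
  show "T f \<cdot> (x \<ominus>\<^bsub>tb C M\<^esub> y) = (T f \<cdot> x) \<ominus>\<^bsub>tb C (Cod C f)\<^esub> (T f \<cdot> y)"
    using additive_mor_minus[OF naturality(1)[OF assms(1)], of x y] assms(1-5,7,8) M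
    unfolding assms(6) by simp
qed

lemma T_bundle_simps [simp]:
  "tot (T_bundle C B) = TO C (tot B)" "base (T_bundle C B) = TO C (base B)"
  "prj (T_bundle C B) = T (prj B)" "zer (T_bundle C B) = T (zer B)"
  "tot2 (T_bundle C B) = TO C (tot2 B)" "fst2 (T_bundle C B) = T (fst2 B)"
  "snd2 (T_bundle C B) = T (snd2 B)" "addn (T_bundle C B) = T (addn B)"
  "nega (T_bundle C B) = T (nega B)" "lft (T_bundle C B) = \<c> (tot B) \<cdot> T (lft B)"
  by (simp_all add: T_bundle_def)

lemma stable_pbD:
  assumes "stable_pullback C f g P a b"
  shows "is_pullback C f g P a b" "is_pullback C (T f) (T g) (TO C P) (T a) (T b)"
    "is_pullback C (T (T f)) (T (T g)) (TO C (TO C P)) (T (T a)) (T (T b))"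
proof -
  note s = assms[unfolded stable_pullback_def, rule_format]
  show "is_pullback C f g P a b" using s[of 0] by simp
  show "is_pullback C (T f) (T g) (TO C P) (T a) (T b)" using s[of 1] by simp
  show "is_pullback C (T (T f)) (T (T g)) (TO C (TO C P)) (T (T a)) (T (T b))"
    using s[of 2] by (simp add: numeral_2_eq_2)
qed

lemma stable_pb_sym: "stable_pullback C f g P a b \<Longrightarrow> stable_pullback C g f P b a"
  unfolding stable_pullback_def using pb_sym by blast

lemma pb_typing:
  assumes "is_pullback C f g P a b"
  shows "f \<in> Ar C" "g \<in> Ar C" "Cod C f = Cod C g" "a \<in> Ar C" "b \<in> Ar C" "Dom C a = P" "Dom C b = P"
    "Cod C a = Dom C f" "Cod C b = Dom C g" "f \<cdot> a = g \<cdot> b"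
  using assms by (auto simp: is_pullback_def)

lemma T_pair:
  assumes "is_pullback C f g P a b" "is_pullback C (T f) (T g) (TO C P) (T a) (T b)"
    "x \<in> Ar C" "y \<in> Ar C" "Cod C x = Dom C f" "Cod C y = Dom C g"
    "Dom C x = Dom C y" "f \<cdot> x = g \<cdot> y"
  shows "T (pair C a b x y) = pair C (T a) (T b) (T x) (T y)"
proof -
  note t = pb_typing[OF assms(1)] and pp = pb_pair[OF assms(1,3-8)]
  show ?thesis
    by (rule pb_pair_eq[OF assms(2), symmetric])
      (use t pp T_comp[of "pair C a b x y" a] T_comp[of "pair C a b x y" b] in \<open>auto simp del: T_comp\<close>)
qed

text \<open>
  Additive bundles to which \<open>T\<close> can be applied: the fibre product \<open>E \<times>\<^sub>M E\<close> and the pullback powers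
  of the projection are preserved by \<open>T\<close>.
\<close>

definition stable_bundle :: "('o, 'm) bundle_data \<Rightarrow> bool" where
  "stable_bundle B \<longleftrightarrow> additive_bundle C B \<and> has_stable_powers C (prj B) \<and>
     stable_pullback C (prj B) (prj B) (tot2 B) (fst2 B) (snd2 B)"

lemma stable_bundle_additive [simp]: "stable_bundle B \<Longrightarrow> additive_bundle C B"
  by (simp add: stable_bundle_def)

lemma stable_bundle_tb [simp]: "M \<in> Ob C \<Longrightarrow> stable_bundle (tb C M)"
  using tangent_laws by (simp add: stable_bundle_def)

lemma T_plus_in:
  assumes "stable_bundle B" "x \<in> Ar C" "y \<in> Ar C" "Cod C x = tot B" "Cod C y = tot B"
    "Dom C x = Dom C y" "prj B \<cdot> x = prj B \<cdot> y"
  shows "T (x \<oplus>\<^bsub>B\<^esub> y) = T x \<oplus>\<^bsub>T_bundle C B\<^esub> T y"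
proof -
  have s: "stable_pullback C (prj B) (prj B) (tot2 B) (fst2 B) (snd2 B)" and B: "additive_bundle C B"
    using assms(1) by (auto simp: stable_bundle_def)
  then show ?thesis
    using assms T_pair[OF stable_pbD(1,2)[OF s]] by (simp add: plus_in_def)
qed

text \<open>
  Each group law of \<open>T(q)\<close> is the image under \<open>T\<close> of the law for the three projections of the third
  pullback power of \<open>q\<close>, evaluated at an arbitrary triple by the universal property of the image
  of that power.
\<close>

lemma T_bundle_additive [simp]:
  assumes "stable_bundle B"
  shows "additive_bundle C (T_bundle C B)"
proof -
  have s: "stable_pullback C (prj B) (prj B) (tot2 B) (fst2 B) (snd2 B)" and B: "additive_bundle C B"
    and h: "has_stable_powers C (prj B)"
    using assms(1) by (auto simp: stable_bundle_def)
  obtain P w where "\<forall>k. is_power C 3 ((T ^^ k) (prj B)) ((TO C ^^ k) P) (\<lambda>i. (T ^^ k) (w i))"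
    using h unfolding has_stable_powers_def by (meson one_le_numeral)
  from spec[OF this, of 0] spec[OF this, of 1]
  have p0: "is_power C 3 (prj B) P w" and p1: "is_power C 3 (T (prj B)) (TO C P) (\<lambda>i. T (w i))" by auto
  have "w i \<in> hom C P (tot B)" if "i < 3" for i
    using p0 that additive_typing(2)[OF B] unfolding is_power_def by metis
  then have w: "w i \<in> Ar C" "Dom C (w i) = P" "Cod C (w i) = tot B" if "i < 3" for i
    using that by simp_all
  have w': "prj B \<cdot> w i = prj B \<cdot> w j" if "i < 3" "j < 3" for i j
    using p0 that unfolding is_power_def by blast
  have laws: "plus_in C (T_bundle C B) (plus_in C (T_bundle C B) x y) z =
        plus_in C (T_bundle C B) x (plus_in C (T_bundle C B) y z) \<and>
      plus_in C (T_bundle C B) x y = plus_in C (T_bundle C B) y x \<and>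
      plus_in C (T_bundle C B) x (T (zer B) \<cdot> T (prj B) \<cdot> x) = x \<and>
      plus_in C (T_bundle C B) x (T (nega B) \<cdot> x) = T (zer B) \<cdot> T (prj B) \<cdot> x"
    if xyz: "x \<in> hom C Z (TO C (tot B))" "y \<in> hom C Z (TO C (tot B))" "z \<in> hom C Z (TO C (tot B))"
      "T (prj B) \<cdot> x = T (prj B) \<cdot> y" "T (prj B) \<cdot> y = T (prj B) \<cdot> z" for Z x y z
  proof -
    define v where "v i = (if i = 0 then x else if i = 1 then y else z)" for i :: nat
    have "\<forall>i<3. v i \<in> hom C Z (Dom C (T (prj B)))" "\<forall>i<3. \<forall>j<3. T (prj B) \<cdot> v i = T (prj B) \<cdot> v j"
      using xyz B by (auto simp: v_def)
    then obtain k where k: "k \<in> hom C Z (TO C P)" "\<forall>i<3. T (w i) \<cdot> k = v i"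
      using p1 unfolding is_power_def by blast
    have v: "T (w 0) \<cdot> k = x" "T (w 1) \<cdot> k = y" "T (w 2) \<cdot> k = z"
      using k(2) by (auto simp: v_def)
    have kt: "k \<in> Ar C" "Cod C k = TO C P" using k by auto
    define a b c where abc: "a = w 0" "b = w 1" "c = w 2"
    have t: "a \<in> Ar C" "b \<in> Ar C" "c \<in> Ar C" "Dom C a = P" "Dom C b = P" "Dom C c = P"
      "Cod C a = tot B" "Cod C b = tot B" "Cod C c = tot B"
      using w[of 0] w[of 1] w[of 2] by (simp_all add: abc)
    have e: "prj B \<cdot> a = prj B \<cdot> b" "prj B \<cdot> b = prj B \<cdot> c"
      using w'[of 0 1] w'[of 1 2] by (simp_all add: abc)
    have pl: "T (p \<oplus>\<^bsub>B\<^esub> q) \<cdot> k = (T p \<cdot> k) \<oplus>\<^bsub>T_bundle C B\<^esub> (T q \<cdot> k)"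
      if "p \<in> Ar C" "q \<in> Ar C" "Dom C p = P" "Dom C q = P" "Cod C p = tot B" "Cod C q = tot B"
        "prj B \<cdot> p = prj B \<cdot> q" for p q
    proof -
      have "T (prj B \<cdot> p) = T (prj B \<cdot> q)" by (simp only: that(7))
      then have "T (prj B) \<cdot> T p = T (prj B) \<cdot> T q" using that(1-6) B by simp
      then show ?thesis
        using that kt B pair_comp[OF stable_pbD(2)[OF s], of "T p" "T q" k]
          pb_pair[OF stable_pbD(2)[OF s], of "T p" "T q"]
        by (subst T_plus_in[OF assms]) (auto simp: plus_in_def)
    qed
    note g = group_laws[OF B t(1,2,3) _ _ _ _ _ e]
    have 1: "T ((a \<oplus>\<^bsub>B\<^esub> b) \<oplus>\<^bsub>B\<^esub> c) \<cdot> k = T (a \<oplus>\<^bsub>B\<^esub> (b \<oplus>\<^bsub>B\<^esub> c)) \<cdot> k"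
      "T (a \<oplus>\<^bsub>B\<^esub> b) \<cdot> k = T (b \<oplus>\<^bsub>B\<^esub> a) \<cdot> k"
      "T (a \<oplus>\<^bsub>B\<^esub> (zer B \<cdot> (prj B \<cdot> a))) \<cdot> k = T a \<cdot> k"
      "T (a \<oplus>\<^bsub>B\<^esub> (nega B \<cdot> a)) \<cdot> k = T (zer B \<cdot> (prj B \<cdot> a)) \<cdot> k"
      using g t by simp_all
    have x: "T a \<cdot> k = x" "T b \<cdot> k = y" "T c \<cdot> k = z" using v by (simp_all add: abc)
    have 2: "x \<oplus>\<^bsub>T_bundle C B\<^esub> y = y \<oplus>\<^bsub>T_bundle C B\<^esub> x"
      using 1(2) pl[of a b] pl[of b a] t e x by simp
    have 3: "x \<oplus>\<^bsub>T_bundle C B\<^esub> (T (zer B) \<cdot> (T (prj B) \<cdot> x)) = x"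
      using 1(3) pl[of a "zer B \<cdot> (prj B \<cdot> a)"] t x(1) B kt by simp
    have 4: "x \<oplus>\<^bsub>T_bundle C B\<^esub> (T (nega B) \<cdot> x) = T (zer B) \<cdot> (T (prj B) \<cdot> x)"
      using 1(4) pl[of a "nega B \<cdot> a"] t x(1) B kt by simp
    have 5: "(x \<oplus>\<^bsub>T_bundle C B\<^esub> y) \<oplus>\<^bsub>T_bundle C B\<^esub> z = x \<oplus>\<^bsub>T_bundle C B\<^esub> (y \<oplus>\<^bsub>T_bundle C B\<^esub> z)"
      using 1(1) pl[of "a \<oplus>\<^bsub>B\<^esub> b" c] pl[of a "b \<oplus>\<^bsub>B\<^esub> c"] pl[of a b] pl[of b c] t e x B by simp
    from 2 3 4 5 show ?thesis by blast
  qed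
  have eqs: "T (prj B) \<cdot> T (zer B) = Id C (TO C (base B))" "T (prj B) \<cdot> T (addn B) = T (prj B) \<cdot> T (fst2 B)"
    "T (prj B) \<cdot> T (nega B) = T (prj B)"
    using B T_comp[of "zer B" "prj B"] T_comp[of "addn B" "prj B"] T_comp[of "nega B" "prj B"]
      T_comp[of "fst2 B" "prj B"]
    by (simp_all del: T_comp)
  show ?thesis
    unfolding additive_bundle_def T_bundle_simps
    using laws eqs stable_pbD(2)[OF s] B by (intro conjI allI impI) auto
qed

text \<open>\<open>T(+)\<close> and \<open>+\<^sub>p\<close> on \<open>T(E)\<close> satisfy the interchange law: \<open>+\<^sub>p\<close> is natural in the arrow \<open>+\<close>.\<close>

lemma interchange:
  assumes "stable_bundle B"
    and "x\<^sub>1 \<in> Ar C" "x\<^sub>2 \<in> Ar C" "y\<^sub>1 \<in> Ar C" "y\<^sub>2 \<in> Ar C"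
    and "Dom C x\<^sub>1 = Z" "Dom C x\<^sub>2 = Z" "Dom C y\<^sub>1 = Z" "Dom C y\<^sub>2 = Z"
    and "Cod C x\<^sub>1 = TO C (tot B)" "Cod C x\<^sub>2 = TO C (tot B)" "Cod C y\<^sub>1 = TO C (tot B)" "Cod C y\<^sub>2 = TO C (tot B)"
    and "T (prj B) \<cdot> x\<^sub>1 = T (prj B) \<cdot> x\<^sub>2" "T (prj B) \<cdot> y\<^sub>1 = T (prj B) \<cdot> y\<^sub>2"
    and "\<p> (tot B) \<cdot> x\<^sub>1 = \<p> (tot B) \<cdot> y\<^sub>1" "\<p> (tot B) \<cdot> x\<^sub>2 = \<p> (tot B) \<cdot> y\<^sub>2"
  shows "(x\<^sub>1 \<oplus>\<^bsub>tb C (tot B)\<^esub> y\<^sub>1) \<oplus>\<^bsub>T_bundle C B\<^esub> (x\<^sub>2 \<oplus>\<^bsub>tb C (tot B)\<^esub> y\<^sub>2) =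
    (x\<^sub>1 \<oplus>\<^bsub>T_bundle C B\<^esub> x\<^sub>2) \<oplus>\<^bsub>tb C (tot B)\<^esub> (y\<^sub>1 \<oplus>\<^bsub>T_bundle C B\<^esub> y\<^sub>2)"
proof -
  let ?E = "tb C (tot B)" and ?T = "T_bundle C B" and ?E2 = "tb C (tot2 B)"
  let ?pr = "\<lambda>x y. pair C (fst2 ?T) (snd2 ?T) x y"
  have B: "additive_bundle C B" "additive_bundle C ?T" using assms(1) by auto
  note t = B assms(2-)
  have s: "stable_pullback C (prj B) (prj B) (tot2 B) (fst2 B) (snd2 B)"
    using assms(1) by (auto simp: stable_bundle_def)
  note X = pair2[OF B(2), of x\<^sub>1 x\<^sub>2, simplified] and Y = pair2[OF B(2), of y\<^sub>1 y\<^sub>2, simplified]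
  have XY: "prj ?E2 \<cdot> ?pr x\<^sub>1 x\<^sub>2 = prj ?E2 \<cdot> ?pr y\<^sub>1 y\<^sub>2"
  proof (rule pb_eqI[OF stable_pbD(1)[OF s]])
    have "fst2 B \<cdot> (prj ?E2 \<cdot> ?pr x y) = prj ?E \<cdot> x \<and> snd2 B \<cdot> (prj ?E2 \<cdot> ?pr x y) = prj ?E \<cdot> y"
      if "x \<in> Ar C" "y \<in> Ar C" "Cod C x = TO C (tot B)" "Cod C y = TO C (tot B)"
        "Dom C x = Dom C y" "T (prj B) \<cdot> x = T (prj B) \<cdot> y" for x y
    proof -
      note p = pair2[OF B(2), of x y, simplified, OF that]
      have "fst2 B \<cdot> (prj ?E2 \<cdot> ?pr x y) = prj ?E \<cdot> (T (fst2 B) \<cdot> ?pr x y)"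
        "snd2 B \<cdot> (prj ?E2 \<cdot> ?pr x y) = prj ?E \<cdot> (T (snd2 B) \<cdot> ?pr x y)"
        using p(1-3) B by simp_all
      then show ?thesis using p by simp
    qed
    then show "fst2 B \<cdot> (prj ?E2 \<cdot> ?pr x\<^sub>1 x\<^sub>2) = fst2 B \<cdot> (prj ?E2 \<cdot> ?pr y\<^sub>1 y\<^sub>2)"
      "snd2 B \<cdot> (prj ?E2 \<cdot> ?pr x\<^sub>1 x\<^sub>2) = snd2 B \<cdot> (prj ?E2 \<cdot> ?pr y\<^sub>1 y\<^sub>2)"
      using t by simp_all
  qed (use t X Y in auto)
  have P: "?pr x\<^sub>1 x\<^sub>2 \<oplus>\<^bsub>?E2\<^esub> ?pr y\<^sub>1 y\<^sub>2 = ?pr (x\<^sub>1 \<oplus>\<^bsub>?E\<^esub> y\<^sub>1) (x\<^sub>2 \<oplus>\<^bsub>?E\<^esub> y\<^sub>2)"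
    by (rule pb_pair_eq[OF additive_pb[OF B(2)], symmetric])
      (use t X Y XY T_plus(1)[of _ "?pr x\<^sub>1 x\<^sub>2" "?pr y\<^sub>1 y\<^sub>2" "tot2 B"] in auto)
  have "T (addn B) \<cdot> (?pr x\<^sub>1 x\<^sub>2 \<oplus>\<^bsub>?E2\<^esub> ?pr y\<^sub>1 y\<^sub>2) =
      (T (addn B) \<cdot> ?pr x\<^sub>1 x\<^sub>2) \<oplus>\<^bsub>?E\<^esub> (T (addn B) \<cdot> ?pr y\<^sub>1 y\<^sub>2)"
    using t X Y XY T_plus(1)[of "addn B" "?pr x\<^sub>1 x\<^sub>2" "?pr y\<^sub>1 y\<^sub>2" "tot2 B"] by simp
  then show ?thesis unfolding P by (simp add: plus_in_def)
qed

lemma flip_simps [simp]: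
  assumes "M \<in> Ob C" "x \<in> Ar C"
  shows "Cod C x = TO C (TO C M) \<Longrightarrow> \<c> M \<cdot> (\<c> M \<cdot> x) = x"
    "Cod C x = TO C (TO C M) \<Longrightarrow> \<p> (TO C M) \<cdot> (\<c> M \<cdot> x) = T (\<p> M) \<cdot> x"
    "Cod C x = TO C (TO C M) \<Longrightarrow> T (\<p> M) \<cdot> (\<c> M \<cdot> x) = \<p> (TO C M) \<cdot> x"
    "Cod C x = TO C M \<Longrightarrow> \<c> M \<cdot> (T (\<o> M) \<cdot> x) = \<o> (TO C M) \<cdot> x"
    "Cod C x = TO C M \<Longrightarrow> \<c> M \<cdot> (\<o> (TO C M) \<cdot> x) = T (\<o> M) \<cdot> x"
    "Cod C x = TO C M \<Longrightarrow> \<c> M \<cdot> (\<l> M \<cdot> x) = \<l> M \<cdot> x"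
    "Cod C x = TO C M \<Longrightarrow> T (\<p> M) \<cdot> (\<l> M \<cdot> x) = \<o> M \<cdot> (\<p> M \<cdot> x)"
    "Cod C x = TO C M \<Longrightarrow> \<p> (TO C M) \<cdot> (\<l> M \<cdot> x) = \<o> M \<cdot> (\<p> M \<cdot> x)"
    "Cod C x = M \<Longrightarrow> \<l> M \<cdot> (\<o> M \<cdot> x) = \<o> (TO C M) \<cdot> (\<o> M \<cdot> x)"
proof -
  note l = tangent_laws[OF assms(1)]
  have TB: "additive_bundle C (T_bundle C (tb C M))" using assms(1) by simp
  have cc: "\<c> M \<cdot> (\<c> M \<cdot> x) = x" if "x \<in> Ar C" "Cod C x = TO C (TO C M)" for x
    using comp_eq_at[OF l(10), of x] assms(1) that by simp
  then show "Cod C x = TO C (TO C M) \<Longrightarrow> \<c> M \<cdot> (\<c> M \<cdot> x) = x" using assms(2) by simp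
  have pc: "\<p> (TO C M) \<cdot> (\<c> M \<cdot> x) = T (\<p> M) \<cdot> x"
    if "x \<in> Ar C" "Cod C x = TO C (TO C M)" for x
    using additive_mor_prj[OF l(9) TB _ that(1)] assms(1) that by simp
  then show "Cod C x = TO C (TO C M) \<Longrightarrow> \<p> (TO C M) \<cdot> (\<c> M \<cdot> x) = T (\<p> M) \<cdot> x"
    using assms(2) by simp
  show "Cod C x = TO C (TO C M) \<Longrightarrow> T (\<p> M) \<cdot> (\<c> M \<cdot> x) = \<p> (TO C M) \<cdot> x"
    using pc[of "\<c> M \<cdot> x"] cc[of x] assms by simp
  have c0: "\<c> M \<cdot> (T (\<o> M) \<cdot> x) = \<o> (TO C M) \<cdot> x" if "Cod C x = TO C M"
    using additive_mor_zer[OF l(9) TB _ assms(2)] assms that by simp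
  then show "Cod C x = TO C M \<Longrightarrow> \<c> M \<cdot> (T (\<o> M) \<cdot> x) = \<o> (TO C M) \<cdot> x" .
  show "\<c> M \<cdot> (\<o> (TO C M) \<cdot> x) = T (\<o> M) \<cdot> x" if "Cod C x = TO C M"
    unfolding c0[OF that, symmetric] using cc[of "T (\<o> M) \<cdot> x"] assms that by simp
  have cl: "\<c> M \<cdot> (\<l> M \<cdot> x) = \<l> M \<cdot> x" if "Cod C x = TO C M"
    using comp_eq_at[OF l(11), of x] assms that by simp
  then show "Cod C x = TO C M \<Longrightarrow> \<c> M \<cdot> (\<l> M \<cdot> x) = \<l> M \<cdot> x" .
  have Tpl: "T (\<p> M) \<cdot> (\<l> M \<cdot> x) = \<o> M \<cdot> (\<p> M \<cdot> x)"
    if "Cod C x = TO C M"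
    using additive_mor_prj[OF l(8) _ TB assms(2)] assms that by simp
  then show "Cod C x = TO C M \<Longrightarrow>
    T (\<p> M) \<cdot> (\<l> M \<cdot> x) = \<o> M \<cdot> (\<p> M \<cdot> x)" .
  show "\<p> (TO C M) \<cdot> (\<l> M \<cdot> x) = \<o> M \<cdot> (\<p> M \<cdot> x)"
    if "Cod C x = TO C M"
    using pc[of "\<l> M \<cdot> x"] cl Tpl assms that by simp
  show "\<l> M \<cdot> (\<o> M \<cdot> x) = \<o> (TO C M) \<cdot> (\<o> M \<cdot> x)"
    if "Cod C x = M"
    using additive_mor_zer[OF l(8) _ TB assms(2)] assms that by simp
qed

lemma flip_plus:
  assumes "M \<in> Ob C" "x \<in> Ar C" "y \<in> Ar C" "Cod C x = TO C (TO C M)" "Cod C y = TO C (TO C M)"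
    "Dom C x = Dom C y" "T (\<p> M) \<cdot> x = T (\<p> M) \<cdot> y"
  shows "\<c> M \<cdot> (x \<oplus>\<^bsub>T_bundle C (tb C M)\<^esub> y) = (\<c> M \<cdot> x) \<oplus>\<^bsub>tb C (TO C M)\<^esub> (\<c> M \<cdot> y)"
  using additive_mor_plus[OF tangent_laws(9)[OF assms(1)], of x y] assms by simp

text \<open>As \<open>c l = l\<close>, the lift \<open>l\<close> is additive for both additions on \<open>T\<^sup>2(M)\<close>.\<close>

lemma lift_plus:
  assumes "M \<in> Ob C" "x \<in> Ar C" "y \<in> Ar C" "Cod C x = TO C M" "Cod C y = TO C M"
    "Dom C x = Dom C y" "\<p> M \<cdot> x = \<p> M \<cdot> y"
  shows "\<l> M \<cdot> (x \<oplus>\<^bsub>tb C M\<^esub> y) = (\<l> M \<cdot> x) \<oplus>\<^bsub>T_bundle C (tb C M)\<^esub> (\<l> M \<cdot> y)"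
    "\<l> M \<cdot> (x \<ominus>\<^bsub>tb C M\<^esub> y) = (\<l> M \<cdot> x) \<ominus>\<^bsub>T_bundle C (tb C M)\<^esub> (\<l> M \<cdot> y)"
    "\<l> M \<cdot> (x \<oplus>\<^bsub>tb C M\<^esub> y) = (\<l> M \<cdot> x) \<oplus>\<^bsub>tb C (TO C M)\<^esub> (\<l> M \<cdot> y)"
proof -
  note l = tangent_laws[OF assms(1)]
  show 1: "\<l> M \<cdot> (x \<oplus>\<^bsub>tb C M\<^esub> y) = (\<l> M \<cdot> x) \<oplus>\<^bsub>T_bundle C (tb C M)\<^esub> (\<l> M \<cdot> y)"
    using additive_mor_plus[OF l(8), of x y] assms by simp
  show "\<l> M \<cdot> (x \<ominus>\<^bsub>tb C M\<^esub> y) = (\<l> M \<cdot> x) \<ominus>\<^bsub>T_bundle C (tb C M)\<^esub> (\<l> M \<cdot> y)"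
    using additive_mor_minus[OF l(8), of x y] assms by simp
  have "\<l> M \<cdot> (x \<oplus>\<^bsub>tb C M\<^esub> y) = \<c> M \<cdot> (\<l> M \<cdot> (x \<oplus>\<^bsub>tb C M\<^esub> y))"
    using assms by simp
  also have "\<dots> = (\<l> M \<cdot> x) \<oplus>\<^bsub>tb C (TO C M)\<^esub> (\<l> M \<cdot> y)"
    unfolding 1 by (subst flip_plus) (use assms in auto)
  finally show "\<l> M \<cdot> (x \<oplus>\<^bsub>tb C M\<^esub> y) =
    (\<l> M \<cdot> x) \<oplus>\<^bsub>tb C (TO C M)\<^esub> (\<l> M \<cdot> y)" .
qed

lemma equaliserD:
  assumes "is_equaliser C f g P e"
  shows "f \<in> Ar C" "g \<in> Ar C" "e \<in> Ar C" "Dom C e = P" "Cod C e = Dom C f" "f \<cdot> e = g \<cdot> e"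
    "Dom C g = Dom C f" "Cod C g = Cod C f"
    "x \<in> Ar C \<Longrightarrow> Cod C x = Dom C f \<Longrightarrow> f \<cdot> x = g \<cdot> x \<Longrightarrow>
       \<exists>h. h \<in> Ar C \<and> Dom C h = Dom C x \<and> Cod C h = P \<and> e \<cdot> h = x"
    "h \<in> Ar C \<Longrightarrow> h' \<in> Ar C \<Longrightarrow> Cod C h = P \<Longrightarrow> Cod C h' = P \<Longrightarrow> Dom C h = Dom C h' \<Longrightarrow>
       e \<cdot> h = e \<cdot> h' \<Longrightarrow> h = h'"
proof -
  show t: "f \<in> Ar C" "g \<in> Ar C" "e \<in> Ar C" "Dom C e = P" "Cod C e = Dom C f" "f \<cdot> e = g \<cdot> e"
    "Dom C g = Dom C f" "Cod C g = Cod C f"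
    using assms by (auto simp: is_equaliser_def)
  have u: "\<exists>!h. h \<in> hom C (Dom C x) P \<and> e \<cdot> h = x"
    if "x \<in> Ar C" "Cod C x = Dom C f" "f \<cdot> x = g \<cdot> x" for x
  proof -
    have "x \<in> hom C (Dom C x) (Dom C f)" using that by simp
    then show ?thesis using assms that(3) unfolding is_equaliser_def by blast
  qed
  show "x \<in> Ar C \<Longrightarrow> Cod C x = Dom C f \<Longrightarrow> f \<cdot> x = g \<cdot> x \<Longrightarrow>
       \<exists>h. h \<in> Ar C \<and> Dom C h = Dom C x \<and> Cod C h = P \<and> e \<cdot> h = x"
    using ex1_implies_ex[OF u[of x]] by auto
  show "h = h'" if "h \<in> Ar C" "h' \<in> Ar C" "Cod C h = P" "Cod C h' = P" "Dom C h = Dom C h'"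
       "e \<cdot> h = e \<cdot> h'"
  proof -
    have "f \<cdot> (e \<cdot> h) = g \<cdot> (e \<cdot> h)" using comp_eq_comp_at[OF t(6)] t(1-5,7,8) that(1,3) by simp
    then have "\<exists>!k. k \<in> hom C (Dom C h) P \<and> e \<cdot> k = e \<cdot> h" using u[of "e \<cdot> h"] t(1-5) that(1,3) by simp
    moreover have "h \<in> hom C (Dom C h) P" "h' \<in> hom C (Dom C h) P" using that by auto
    ultimately show ?thesis using that(6) by metis
  qed
qed

lemma stable_equaliserD:
  assumes "stable_equaliser C f g P e"
  shows "is_equaliser C f g P e" "is_equaliser C (T f) (T g) (TO C P) (T e)"
  using assms[unfolded stable_equaliser_def, rule_format, of 0]
    assms[unfolded stable_equaliser_def, rule_format, of 1] by simp_all

text \<open>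
  \<open>l v = \<mu>(v, 0 p v)\<close>; in the equaliser for the tangent bundle the lifted component is the first one.
\<close>

lemma tlift_monic:
  assumes "M \<in> Ob C" "x \<in> Ar C" "y \<in> Ar C" "Cod C x = TO C M" "Cod C y = TO C M"
    "Dom C x = Dom C y" "\<l> M \<cdot> x = \<l> M \<cdot> y"
  shows "x = y"
proof -
  let ?B = "tb C M" and ?z = "\<lambda>x. \<o> M \<cdot> (\<p> M \<cdot> x)"
  let ?mu = "(\<o> (TO C M) \<cdot> snd2 ?B) \<oplus>\<^bsub>T_bundle C ?B\<^esub> (lft ?B \<cdot> fst2 ?B)"
  have B: "additive_bundle C ?B" "additive_bundle C (T_bundle C ?B)" using assms(1) by simp_all
  note eq = equaliserD[OF stable_equaliserD(1)[OF tangent_laws(12)[OF assms(1)]]]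
  have e: "prj ?B \<cdot> fst2 ?B = prj ?B \<cdot> snd2 ?B" using pb_typing(10)[OF additive_pb[OF B(1)]] .
  have mu: "?mu \<cdot> pair C (fst2 ?B) (snd2 ?B) x (?z x) = lft ?B \<cdot> x"
    if "x \<in> Ar C" "Cod C x = TO C M" for x
    using that assms(1) e plus_zer(2)[OF B(2), of "lft ?B \<cdot> x" "zer ?B \<cdot> (prj ?B \<cdot> x)"]
    by (subst plus_comp) auto
  have "pair C (fst2 ?B) (snd2 ?B) x (?z x) = pair C (fst2 ?B) (snd2 ?B) y (?z y)"
    by (rule eq(10)) (use assms mu[of x] mu[of y] in simp_all)
  then have "fst2 ?B \<cdot> pair C (fst2 ?B) (snd2 ?B) x (?z x) = fst2 ?B \<cdot> pair C (fst2 ?B) (snd2 ?B) y (?z y)"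
    by simp
  then show ?thesis using assms by simp
qed

lemma T_additive_mor:
  assumes "additive_mor C B B' \<phi> \<psi>" "stable_bundle B" "stable_bundle B'"
    "x \<in> Ar C" "y \<in> Ar C" "Cod C x = TO C (tot B)" "Cod C y = TO C (tot B)"
    "Dom C x = Dom C y" "T (prj B) \<cdot> x = T (prj B) \<cdot> y"
  shows "T \<phi> \<cdot> (x \<oplus>\<^bsub>T_bundle C B\<^esub> y) = (T \<phi> \<cdot> x) \<oplus>\<^bsub>T_bundle C B'\<^esub> (T \<phi> \<cdot> y)"
proof -
  note t = additive_mor_typing(1-6)[OF assms(1) stable_bundle_additive stable_bundle_additive, OF assms(2,3)]
  note pr = additive_mor_prj[OF assms(1) stable_bundle_additive stable_bundle_additive, OF assms(2,3)]
  have e: "prj B \<cdot> fst2 B = prj B \<cdot> snd2 B"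
    using pb_typing(10)[OF additive_pb] assms(2) by simp
  have "T (prj B) \<cdot> T (fst2 B) = T (prj B) \<cdot> T (snd2 B)"
    using arg_cong[OF e, of T] assms(2) by simp
  moreover have "T (prj B' \<cdot> (\<phi> \<cdot> fst2 B)) = T (prj B' \<cdot> (\<phi> \<cdot> snd2 B))"
    using pr[of "fst2 B"] pr[of "snd2 B"] e assms(2) by simp
  ultimately have e2: "T (prj B') \<cdot> (T \<phi> \<cdot> T (fst2 B)) = T (prj B') \<cdot> (T \<phi> \<cdot> T (snd2 B))"
    using t assms(2,3) by simp
  let ?h = "pair C (T (fst2 B)) (T (snd2 B)) x y"
  have TB: "additive_bundle C (T_bundle C B)" "additive_bundle C (T_bundle C B')"
    using assms(2,3) by auto
  note h = pair2[OF TB(1), of x y, simplified, OF assms(4-9)]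
  have "\<phi> \<cdot> addn B = (\<phi> \<cdot> fst2 B) \<oplus>\<^bsub>B'\<^esub> (\<phi> \<cdot> snd2 B)"
    using assms(1) by (simp add: additive_mor_def)
  then have "T \<phi> \<cdot> T (addn B) = T ((\<phi> \<cdot> fst2 B) \<oplus>\<^bsub>B'\<^esub> (\<phi> \<cdot> snd2 B))"
    using t assms(2) T_comp[of "addn B" \<phi>] by simp
  also have "\<dots> = T (\<phi> \<cdot> fst2 B) \<oplus>\<^bsub>T_bundle C B'\<^esub> T (\<phi> \<cdot> snd2 B)"
    by (rule T_plus_in) (use t assms e pr in auto)
  finally have 1: "T \<phi> \<cdot> T (addn B) = (T \<phi> \<cdot> T (fst2 B)) \<oplus>\<^bsub>T_bundle C B'\<^esub> (T \<phi> \<cdot> T (snd2 B))"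
    using t assms(2) by simp
  have "T \<phi> \<cdot> (T (addn B) \<cdot> ?h) = ((T \<phi> \<cdot> T (fst2 B)) \<oplus>\<^bsub>T_bundle C B'\<^esub> (T \<phi> \<cdot> T (snd2 B))) \<cdot> ?h"
    using comp_eq_at[OF 1, of ?h] h t assms(2) by simp
  also have "\<dots> = (T \<phi> \<cdot> x) \<oplus>\<^bsub>T_bundle C B'\<^esub> (T \<phi> \<cdot> y)"
    by (subst plus_comp) (use h t assms(2,3) TB e2 in auto)
  finally show ?thesis by (simp add: plus_in_def)
qed

section \<open>Differential bundles\<close>

lemma differential_laws:
  assumes "differential_bundle C B"
  shows "additive_bundle C B" "has_stable_powers C (prj B)"
    "stable_pullback C (prj B) (prj B) (tot2 B) (fst2 B) (snd2 B)"
    "lft B \<in> hom C (tot B) (TO C (tot B))"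
    "additive_mor C B (T_bundle C B) (lft B) (\<o> (base B))"
    "additive_mor C B (tb C (tot B)) (lft B) (zer B)"
    "T (lft B) \<cdot> lft B = \<l> (tot B) \<cdot> lft B"
    "stable_equaliser C (T (prj B)) (\<o> (base B) \<cdot> prj B \<cdot> \<p> (tot B)) (tot2 B) (mu C B)"
  using assms unfolding differential_bundle_def by - (elim conjE, assumption)+

lemma differential_stable [simp]: "differential_bundle C B \<Longrightarrow> stable_bundle B"
  using differential_laws(1-3) by (simp add: stable_bundle_def)

lemma differential_additive [simp]: "differential_bundle C B \<Longrightarrow> additive_bundle C B"
  by simp

lemma lft_typing [simp]:
  assumes "differential_bundle C B"
  shows "lft B \<in> Ar C" "Dom C (lft B) = tot B" "Cod C (lft B) = TO C (tot B)"
  using differential_laws(4)[OF assms] by simp_all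

lemma lft_simps [simp]:
  assumes "differential_bundle C B" "x \<in> Ar C"
  shows "Cod C x = tot B \<Longrightarrow> E = tot B \<Longrightarrow> \<p> E \<cdot> (lft B \<cdot> x) = zer B \<cdot> (prj B \<cdot> x)"
    "Cod C x = tot B \<Longrightarrow> T (prj B) \<cdot> (lft B \<cdot> x) = \<o> (base B) \<cdot> (prj B \<cdot> x)"
    "Cod C x = base B \<Longrightarrow> lft B \<cdot> (zer B \<cdot> x) = \<o> (tot B) \<cdot> (zer B \<cdot> x)"
    "Cod C x = tot B \<Longrightarrow> T (lft B) \<cdot> (lft B \<cdot> x) = \<l> (tot B) \<cdot> (lft B \<cdot> x)"
proof -
  note d = differential_laws[OF assms(1)]
  show "Cod C x = tot B \<Longrightarrow> E = tot B \<Longrightarrow> \<p> E \<cdot> (lft B \<cdot> x) = zer B \<cdot> (prj B \<cdot> x)"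
    using additive_mor_prj[OF d(6), of x] assms by simp
  show "Cod C x = tot B \<Longrightarrow> T (prj B) \<cdot> (lft B \<cdot> x) = \<o> (base B) \<cdot> (prj B \<cdot> x)"
    using additive_mor_prj[OF d(5), of x] assms by simp
  show "Cod C x = base B \<Longrightarrow> lft B \<cdot> (zer B \<cdot> x) = \<o> (tot B) \<cdot> (zer B \<cdot> x)"
    using additive_mor_zer[OF d(6), of x] assms by simp
  show "Cod C x = tot B \<Longrightarrow> T (lft B) \<cdot> (lft B \<cdot> x) = \<l> (tot B) \<cdot> (lft B \<cdot> x)"
    using comp_eq_comp_at[OF d(7), of x] assms by simp
qed

lemma lft_plus:
  assumes "differential_bundle C B" "x \<in> Ar C" "y \<in> Ar C" "Cod C x = tot B" "Cod C y = tot B"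
    "Dom C x = Dom C y" "prj B \<cdot> x = prj B \<cdot> y"
  shows "lft B \<cdot> (x \<oplus>\<^bsub>B\<^esub> y) = (lft B \<cdot> x) \<oplus>\<^bsub>tb C (tot B)\<^esub> (lft B \<cdot> y)"
  using additive_mor_plus[OF differential_laws(6)[OF assms(1)], of x y] assms by simp

lemma mu_typing [simp]:
  assumes "differential_bundle C B"
  shows "mu C B \<in> Ar C" "Dom C (mu C B) = tot2 B" "Cod C (mu C B) = TO C (tot B)"
  using equaliserD(3-5)[OF stable_equaliserD(1)[OF differential_laws(8)[OF assms]]] assms by simp_all

lemma mu_comp:
  assumes "differential_bundle C B" "h \<in> Ar C" "Cod C h = tot2 B"
  shows "mu C B \<cdot> h = (\<o> (tot B) \<cdot> (fst2 B \<cdot> h)) \<oplus>\<^bsub>T_bundle C B\<^esub> (lft B \<cdot> (snd2 B \<cdot> h))"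
proof -
  have "prj B \<cdot> fst2 B = prj B \<cdot> snd2 B"
    using pb_typing(10)[OF additive_pb] assms(1) by simp
  then show ?thesis
    unfolding mu_def by (subst plus_comp) (use assms in auto)
qed

text \<open>The arrow \<open>s e = (\<xi> q e, e)\<close> exhibits \<open>\<lambda> = \<mu> s\<close>; it is a section of the second projection.\<close>

lemma mu_section:
  assumes "differential_bundle C B"
  shows "\<exists>s. s \<in> Ar C \<and> Dom C s = tot B \<and> Cod C s = tot2 B \<and> mu C B \<cdot> s = lft B \<and> snd2 B \<cdot> s = Id C (tot B)"
proof -
  have B: "additive_bundle C B" "additive_bundle C (T_bundle C B)" using assms by auto
  define s where "s = pair C (fst2 B) (snd2 B) (zer B \<cdot> prj B) (Id C (tot B))"
  have s: "s \<in> Ar C" "Dom C s = tot B" "Cod C s = tot2 B" "fst2 B \<cdot> s = zer B \<cdot> prj B"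
    "snd2 B \<cdot> s = Id C (tot B)"
    using pair2[OF B(1), of "zer B \<cdot> prj B" "Id C (tot B)"] B unfolding s_def by simp_all
  have "T (prj B) \<cdot> lft B = \<o> (base B) \<cdot> prj B"
    using lft_simps(2)[OF assms, of "Id C (tot B)"] assms by simp
  then have "mu C B \<cdot> s = lft B"
    using s assms B plus_zer(2)[OF B(2), of "lft B" "\<o> (base B) \<cdot> prj B"]
    by (simp add: mu_comp)
  with s show ?thesis by blast
qed

lemma lft_monic:
  assumes "differential_bundle C B" "x \<in> Ar C" "y \<in> Ar C" "Dom C x = Dom C y"
  shows "Cod C x = tot B \<Longrightarrow> Cod C y = tot B \<Longrightarrow> lft B \<cdot> x = lft B \<cdot> y \<Longrightarrow> x = y"
    and "Cod C x = TO C (tot B) \<Longrightarrow> Cod C y = TO C (tot B) \<Longrightarrow> T (lft B) \<cdot> x = T (lft B) \<cdot> y \<Longrightarrow> x = y"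
proof -
  obtain s where s: "s \<in> Ar C" "Dom C s = tot B" "Cod C s = tot2 B" "mu C B \<cdot> s = lft B"
    "snd2 B \<cdot> s = Id C (tot B)" using mu_section[OF assms(1)] by blast
  note eq = stable_equaliserD[OF differential_laws(8)[OF assms(1)]]
  show "x = y" if "Cod C x = tot B" "Cod C y = tot B" "lft B \<cdot> x = lft B \<cdot> y"
  proof -
    have "s \<cdot> x = s \<cdot> y"
      by (rule equaliserD(10)[OF eq(1)])
        (use s(1-3) assms that comp_eq_at[OF s(4), of x] comp_eq_at[OF s(4), of y] in auto)
    then have "snd2 B \<cdot> (s \<cdot> x) = snd2 B \<cdot> (s \<cdot> y)" by simp
    then show ?thesis
      using comp_eq_at[OF s(5), of x] comp_eq_at[OF s(5), of y] s(1-3) assms that(1,2) by simp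
  qed
  show "x = y" if "Cod C x = TO C (tot B)" "Cod C y = TO C (tot B)" "T (lft B) \<cdot> x = T (lft B) \<cdot> y"
  proof -
    have "T s \<cdot> x = T s \<cdot> y"
      by (rule equaliserD(10)[OF eq(2)])
        (use s(1-3) assms that T_eq[OF s(4), of x] T_eq[OF s(4), of y] in auto)
    then have "T (snd2 B) \<cdot> (T s \<cdot> x) = T (snd2 B) \<cdot> (T s \<cdot> y)" by simp
    then show ?thesis
      using T_eq[OF s(5), of x] T_eq[OF s(5), of y] s(1-3) assms that(1,2) by simp
  qed
qed

lemma T_lft_simps [simp]:
  assumes "differential_bundle C B" "x \<in> Ar C" "Cod C x = TO C (tot B)"
  shows "E = tot B \<Longrightarrow> T (\<p> E) \<cdot> (T (lft B) \<cdot> x) = T (zer B) \<cdot> (T (prj B) \<cdot> x)"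
    "T (T (prj B)) \<cdot> (T (lft B) \<cdot> x) = T (\<o> (base B)) \<cdot> (T (prj B) \<cdot> x)"
proof -
  have "\<p> (tot B) \<cdot> lft B = zer B \<cdot> prj B" "T (prj B) \<cdot> lft B = \<o> (base B) \<cdot> prj B"
    using lft_simps(1,2)[OF assms(1), of "Id C (tot B)"] assms(1) by simp_all
  from T_eq[OF this(1), of x] T_eq[OF this(2), of x]
  show "E = tot B \<Longrightarrow> T (\<p> E) \<cdot> (T (lft B) \<cdot> x) = T (zer B) \<cdot> (T (prj B) \<cdot> x)"
    "T (T (prj B)) \<cdot> (T (lft B) \<cdot> x) = T (\<o> (base B)) \<cdot> (T (prj B) \<cdot> x)"
    using assms by simp_all
qed

lemma prj_plus_T:
  assumes "stable_bundle B" "x \<in> Ar C" "y \<in> Ar C" "Cod C x = TO C (tot B)" "Cod C y = TO C (tot B)"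
    "Dom C x = Dom C y" "T (prj B) \<cdot> x = T (prj B) \<cdot> y"
  shows "\<p> (tot B) \<cdot> (x \<oplus>\<^bsub>T_bundle C B\<^esub> y) =
      (\<p> (tot B) \<cdot> x) \<oplus>\<^bsub>B\<^esub> (\<p> (tot B) \<cdot> y)"
    "\<p> (tot B) \<cdot> (x \<ominus>\<^bsub>T_bundle C B\<^esub> y) =
      (\<p> (tot B) \<cdot> x) \<ominus>\<^bsub>B\<^esub> (\<p> (tot B) \<cdot> y)"
proof -
  have B: "additive_bundle C B" "additive_bundle C (T_bundle C B)" using assms(1) by auto
  have plus: "\<p> (tot B) \<cdot> (x \<oplus>\<^bsub>T_bundle C B\<^esub> y) =
      (\<p> (tot B) \<cdot> x) \<oplus>\<^bsub>B\<^esub> (\<p> (tot B) \<cdot> y)"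
    if "x \<in> Ar C" "y \<in> Ar C" "Cod C x = TO C (tot B)" "Cod C y = TO C (tot B)"
    "Dom C x = Dom C y" "T (prj B) \<cdot> x = T (prj B) \<cdot> y" for x y
  proof -
    let ?h = "pair C (T (fst2 B)) (T (snd2 B)) x y"
    note k = pair2[OF B(2), of x y, simplified, OF that]
    have "\<p> (tot B) \<cdot> (x \<oplus>\<^bsub>T_bundle C B\<^esub> y) = addn B \<cdot> (\<p> (tot2 B) \<cdot> ?h)"
      unfolding plus_in_def using k(1-3) B by simp
    also have "\<dots> = (fst2 B \<cdot> (\<p> (tot2 B) \<cdot> ?h)) \<oplus>\<^bsub>B\<^esub> (snd2 B \<cdot> (\<p> (tot2 B) \<cdot> ?h))"
      by (rule addn_comp) (use k(1-3) B in simp_all)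
    also have "fst2 B \<cdot> (\<p> (tot2 B) \<cdot> ?h) = \<p> (tot B) \<cdot> (T (fst2 B) \<cdot> ?h)"
      using k(1-3) B by simp
    also have "snd2 B \<cdot> (\<p> (tot2 B) \<cdot> ?h) = \<p> (tot B) \<cdot> (T (snd2 B) \<cdot> ?h)"
      using k(1-3) B by simp
    finally show ?thesis using k(4,5) by simp
  qed
  from this[OF assms(2-7)] show "\<p> (tot B) \<cdot> (x \<oplus>\<^bsub>T_bundle C B\<^esub> y) =
      (\<p> (tot B) \<cdot> x) \<oplus>\<^bsub>B\<^esub> (\<p> (tot B) \<cdot> y)" .
  have "T (prj B) \<cdot> (T (nega B) \<cdot> y) = T (prj B) \<cdot> y"
    using T_eq[OF additive_prj(3)[OF B(1)], of y] assms B by simp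
  then show "\<p> (tot B) \<cdot> (x \<ominus>\<^bsub>T_bundle C B\<^esub> y) =
      (\<p> (tot B) \<cdot> x) \<ominus>\<^bsub>B\<^esub> (\<p> (tot B) \<cdot> y)"
    using plus[of x "T (nega B) \<cdot> y"] assms B by (simp add: minus_in_def)
qed

text \<open>The vertical tangent vectors over zero are the values of \<open>\<lambda>\<close>.\<close>

lemma lft_universal:
  assumes "differential_bundle C B" "w \<in> Ar C" "Cod C w = TO C (tot B)"
    "n \<in> Ar C" "Cod C n = base B" "Dom C n = Dom C w"
    "T (prj B) \<cdot> w = \<o> (base B) \<cdot> n" "\<p> (tot B) \<cdot> w = zer B \<cdot> n"
  shows "\<exists>e. e \<in> Ar C \<and> Dom C e = Dom C w \<and> Cod C e = tot B \<and> lft B \<cdot> e = w \<and> prj B \<cdot> e = n"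
proof -
  have B: "additive_bundle C B" "additive_bundle C (T_bundle C B)" using assms by auto
  note eq = equaliserD[OF stable_equaliserD(1)[OF differential_laws(8)[OF assms(1)]]]
  have "T (prj B) \<cdot> w = (\<o> (base B) \<cdot> prj B \<cdot> \<p> (tot B)) \<cdot> w"
    using assms(1-5,8) unfolding assms(7) by simp
  then have "\<exists>h. h \<in> Ar C \<and> Dom C h = Dom C w \<and> Cod C h = tot2 B \<and> mu C B \<cdot> h = w"
    by (intro eq(9)) (use assms(1-3) in simp_all)
  then obtain h where h: "h \<in> Ar C" "Dom C h = Dom C w" "Cod C h = tot2 B" "mu C B \<cdot> h = w"
    by blast
  define a b where ab: "a = fst2 B \<cdot> h" "b = snd2 B \<cdot> h"
  have t: "a \<in> Ar C" "b \<in> Ar C" "Dom C a = Dom C w" "Dom C b = Dom C w" "Cod C a = tot B" "Cod C b = tot B"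
    using h assms by (auto simp: ab)
  have e: "prj B \<cdot> a = prj B \<cdot> b"
    unfolding ab using comp_eq_comp_at[OF pb_typing(10)[OF additive_pb[OF B(1)]], of h] B h by simp
  have w: "w = (\<o> (tot B) \<cdot> a) \<oplus>\<^bsub>T_bundle C B\<^esub> (lft B \<cdot> b)"
    using mu_comp[OF assms(1) h(1,3)] h(4) by (simp add: ab)
  have "T (prj B) \<cdot> w = \<o> (base B) \<cdot> (prj B \<cdot> b)"
    unfolding w using plus_typing(4)[OF B(2), of "\<o> (tot B) \<cdot> a" "lft B \<cdot> b"] t assms(1) B e by simp
  then have "\<p> (base B) \<cdot> (\<o> (base B) \<cdot> n) =
      \<p> (base B) \<cdot> (\<o> (base B) \<cdot> (prj B \<cdot> b))"
    using assms(7) by simp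
  then have n: "prj B \<cdot> b = n" using assms(1,4,5) t by simp
  have "\<p> (tot B) \<cdot> w = (\<p> (tot B) \<cdot> (\<o> (tot B) \<cdot> a)) \<oplus>\<^bsub>B\<^esub>
      (\<p> (tot B) \<cdot> (lft B \<cdot> b))"
    unfolding w by (rule prj_plus_T(1)) (use t assms(1) e in simp_all)
  then have "zer B \<cdot> n = a"
    unfolding assms(8) using assms(1) t e plus_zer(1)[OF B(1), of a "prj B \<cdot> b"] by simp
  then have a: "a = zer B \<cdot> n" by simp
  have "w = lft B \<cdot> b"
    unfolding w a using assms(1,4,5) t(1,2,5,6) n plus_zer(2)[OF B(2), of "lft B \<cdot> b" "\<o> (base B) \<cdot> n"]
    by simp
  then show ?thesis using t n by blast
qed

section \<open>Linear maps are additive\<close>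

text \<open>
  The properties of a lift on which additivity of linear maps rests: it carries \<open>+\<^sub>q\<close> to \<open>+\<^sub>p\<close>, and it
  is monic.
\<close>

definition additive_lift :: "('o, 'm) bundle_data \<Rightarrow> 'm \<Rightarrow> bool" where
  "additive_lift B lam \<longleftrightarrow> additive_bundle C B \<and> lam \<in> hom C (tot B) (TO C (tot B)) \<and>
     (\<forall>Z x y. x \<in> hom C Z (tot B) \<longrightarrow> y \<in> hom C Z (tot B) \<longrightarrow> prj B \<cdot> x = prj B \<cdot> y \<longrightarrow>
        lam \<cdot> (x \<oplus>\<^bsub>B\<^esub> y) = (lam \<cdot> x) \<oplus>\<^bsub>tb C (tot B)\<^esub> (lam \<cdot> y)) \<and>
     (\<forall>Z x y. x \<in> hom C Z (tot B) \<longrightarrow> y \<in> hom C Z (tot B) \<longrightarrow> lam \<cdot> x = lam \<cdot> y \<longrightarrow> x = y)"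

lemma additive_lift_tb: "M \<in> Ob C \<Longrightarrow> additive_lift (tb C M) (\<l> M)"
  unfolding additive_lift_def using lift_plus(3)[of M] tlift_monic[of M] by (auto simp del: comp_assoc)

lemma additive_lift_T:
  assumes "differential_bundle C B"
  shows "additive_lift (T_bundle C B) (\<c> (tot B) \<cdot> T (lft B))"
  unfolding additive_lift_def
proof (intro conjI allI impI)
  note d = differential_laws(6)[OF assms]
  show "additive_bundle C (T_bundle C B)" using assms by simp
  show "\<c> (tot B) \<cdot> T (lft B) \<in> hom C (tot (T_bundle C B)) (TO C (tot (T_bundle C B)))"
    using assms by simp
  fix Z x y
  assume xy: "x \<in> hom C Z (tot (T_bundle C B))" "y \<in> hom C Z (tot (T_bundle C B))"
  then have t: "x \<in> Ar C" "y \<in> Ar C" "Cod C x = TO C (tot B)" "Cod C y = TO C (tot B)" "Dom C x = Dom C y"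
    by auto
  {
    assume "prj (T_bundle C B) \<cdot> x = prj (T_bundle C B) \<cdot> y"
    then have e: "T (prj B) \<cdot> x = T (prj B) \<cdot> y" by simp
    have 1: "T (lft B) \<cdot> (x \<oplus>\<^bsub>T_bundle C B\<^esub> y) =
        (T (lft B) \<cdot> x) \<oplus>\<^bsub>T_bundle C (tb C (tot B))\<^esub> (T (lft B) \<cdot> y)"
      using T_additive_mor[OF d, of x y] assms t e by simp
    have 2: "T (\<p> (tot B)) \<cdot> (T (lft B) \<cdot> x) = T (\<p> (tot B)) \<cdot> (T (lft B) \<cdot> y)"
      using t assms e by simp
    have "\<c> (tot B) \<cdot> (T (lft B) \<cdot> (x \<oplus>\<^bsub>T_bundle C B\<^esub> y)) =
      (\<c> (tot B) \<cdot> (T (lft B) \<cdot> x)) \<oplus>\<^bsub>tb C (TO C (tot B))\<^esub> (\<c> (tot B) \<cdot> (T (lft B) \<cdot> y))"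
      unfolding 1 by (rule flip_plus) (use t assms 2 in auto)
    then show "(\<c> (tot B) \<cdot> T (lft B)) \<cdot> (x \<oplus>\<^bsub>T_bundle C B\<^esub> y) =
        ((\<c> (tot B) \<cdot> T (lft B)) \<cdot> x) \<oplus>\<^bsub>tb C (tot (T_bundle C B))\<^esub> ((\<c> (tot B) \<cdot> T (lft B)) \<cdot> y)"
      using t assms e plus_typing[of "T_bundle C B" x y] by simp
  }
  {
    assume "(\<c> (tot B) \<cdot> T (lft B)) \<cdot> x = (\<c> (tot B) \<cdot> T (lft B)) \<cdot> y"
    then have "\<c> (tot B) \<cdot> (T (lft B) \<cdot> x) = \<c> (tot B) \<cdot> (T (lft B) \<cdot> y)"
      using t assms by simp
    then have "\<c> (tot B) \<cdot> (\<c> (tot B) \<cdot> (T (lft B) \<cdot> x)) =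
       \<c> (tot B) \<cdot> (\<c> (tot B) \<cdot> (T (lft B) \<cdot> y))" by simp
    then have "T (lft B) \<cdot> x = T (lft B) \<cdot> y" using t assms by simp
    then show "x = y" using lft_monic(2)[OF assms] t by simp
  }
qed

text \<open>
  \<open>L\<^sub>1\<close> and \<open>L\<^sub>2\<close> are the lifts of two elements of the domain of \<open>h\<close>, and \<open>L\<^sub>1 +\<^sub>p L\<^sub>2\<close> is the lift of their
  sum; \<open>a\<^sub>1\<close>, \<open>a\<^sub>2\<close> and \<open>a\<^sub>3\<close> are the values of \<open>h\<close>.  The domain needs no bundle structure of its own.
\<close>

lemma linear_additive:
  assumes "additive_lift B lam" "h \<in> Ar C" "Cod C h = tot B"
    and "L\<^sub>1 \<in> Ar C" "L\<^sub>2 \<in> Ar C" "Cod C L\<^sub>1 = TO C (Dom C h)" "Cod C L\<^sub>2 = TO C (Dom C h)"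
      "Dom C L\<^sub>1 = Z" "Dom C L\<^sub>2 = Z"
      "\<p> (Dom C h) \<cdot> L\<^sub>1 = \<p> (Dom C h) \<cdot> L\<^sub>2"
    and "a\<^sub>1 \<in> Ar C" "a\<^sub>2 \<in> Ar C" "a\<^sub>3 \<in> Ar C" "Cod C a\<^sub>1 = tot B" "Cod C a\<^sub>2 = tot B" "Cod C a\<^sub>3 = tot B"
      "Dom C a\<^sub>1 = Z" "Dom C a\<^sub>2 = Z" "Dom C a\<^sub>3 = Z" "prj B \<cdot> a\<^sub>1 = prj B \<cdot> a\<^sub>2"
    and "T h \<cdot> L\<^sub>1 = lam \<cdot> a\<^sub>1" "T h \<cdot> L\<^sub>2 = lam \<cdot> a\<^sub>2" "T h \<cdot> (L\<^sub>1 \<oplus>\<^bsub>tb C (Dom C h)\<^esub> L\<^sub>2) = lam \<cdot> a\<^sub>3"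
  shows "a\<^sub>3 = a\<^sub>1 \<oplus>\<^bsub>B\<^esub> a\<^sub>2"
proof -
  have B: "additive_bundle C B" using assms(1) by (simp add: additive_lift_def)
  have a: "a\<^sub>1 \<in> hom C Z (tot B)" "a\<^sub>2 \<in> hom C Z (tot B)" "a\<^sub>3 \<in> hom C Z (tot B)" using assms by auto
  have p: "a\<^sub>1 \<oplus>\<^bsub>B\<^esub> a\<^sub>2 \<in> hom C Z (tot B)" using assms B by simp
  have "lam \<cdot> a\<^sub>3 = (T h \<cdot> L\<^sub>1) \<oplus>\<^bsub>tb C (Cod C h)\<^esub> (T h \<cdot> L\<^sub>2)"
    unfolding assms(23)[symmetric] by (rule T_plus(1)) (use assms(1-10) in auto)
  also have "\<dots> = lam \<cdot> (a\<^sub>1 \<oplus>\<^bsub>B\<^esub> a\<^sub>2)"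
    unfolding assms(3,21,22) using assms(1) a(1,2) assms(20) unfolding additive_lift_def by metis
  finally show ?thesis using assms(1) a(3) p unfolding additive_lift_def by blast
qed

section \<open>Derivatives of differences\<close>

text \<open>
  Derivatives, along tangent vectors \<open>L\<close> to their common domain, of the differences of two arrows for
  \<open>+\<^sub>p\<close> and for \<open>T(+)\<close>.  In the second case only tangent fields \<open>L\<close> with \<open>T(a) L = l a\<close> and
  \<open>T(b) L = l b\<close> are considered; the difference inherits this property because \<open>l\<close> is natural.
\<close>

lemma T_minus_at:
  assumes "M \<in> Ob C" "a \<in> Ar C" "b \<in> Ar C" "Cod C a = TO C M" "Cod C b = TO C M" "Dom C a = Dom C b"
    "\<p> M \<cdot> a = \<p> M \<cdot> b" "L \<in> Ar C" "Cod C L = TO C (Dom C b)"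
  shows "T (a \<ominus>\<^bsub>tb C M\<^esub> b) \<cdot> L = (T a \<cdot> L) \<ominus>\<^bsub>T_bundle C (tb C M)\<^esub> (T b \<cdot> L)"
proof -
  have TB: "additive_bundle C (T_bundle C (tb C M))" using assms(1) by simp
  have "T (\<p> M \<cdot> a) = T (\<p> M \<cdot> b)" by (simp only: assms(7))
  then have e: "T (\<p> M) \<cdot> T a = T (\<p> M) \<cdot> T b" using assms(1-6) by simp
  have "T (a \<ominus>\<^bsub>tb C M\<^esub> b) = T a \<ominus>\<^bsub>T_bundle C (tb C M)\<^esub> T b"
    using T_plus_in[of "tb C M" a "nega (tb C M) \<cdot> b"] assms by (simp add: minus_in_def)
  then show ?thesis
    using minus_comp[OF TB, of "T a" "T b" L] assms e by simp
qed

lemma T_minus_T_at: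
  assumes B: "stable_bundle B"
    and "a \<in> Ar C" "b \<in> Ar C" "Cod C a = TO C (tot B)" "Cod C b = TO C (tot B)" "Dom C a = Dom C b"
    "T (prj B) \<cdot> a = T (prj B) \<cdot> b" and L: "L \<in> Ar C" "Cod C L = TO C (Dom C b)" "Dom C L = Dom C b"
    and al: "T a \<cdot> L = \<l> (tot B) \<cdot> a" and bl: "T b \<cdot> L = \<l> (tot B) \<cdot> b"
  shows "T (a \<ominus>\<^bsub>T_bundle C B\<^esub> b) \<cdot> L = \<l> (tot B) \<cdot> (a \<ominus>\<^bsub>T_bundle C B\<^esub> b)"
proof -
  have s: "stable_pullback C (prj B) (prj B) (tot2 B) (fst2 B) (snd2 B)" and A: "additive_bundle C B"
    and TA: "additive_bundle C (T_bundle C B)"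
    using B by (auto simp: stable_bundle_def)
  let ?n = "T (nega B) \<cdot> b" and ?l = "\<l> (tot B)"
  have n: "?n \<in> Ar C" "Dom C ?n = Dom C b" "Cod C ?n = TO C (tot B)" "T (prj B) \<cdot> a = T (prj B) \<cdot> ?n"
    using T_eq[OF additive_prj(3)[OF A], of b] assms(2-7) A by simp_all
  let ?h = "pair C (T (fst2 B)) (T (snd2 B)) a ?n"
  note h = pb_pair[OF stable_pbD(2)[OF s], of a ?n]
  have h: "?h \<in> Ar C" "Dom C ?h = Dom C b" "Cod C ?h = TO C (tot2 B)" "T (fst2 B) \<cdot> ?h = a" "T (snd2 B) \<cdot> ?h = ?n"
    using h assms(2-6) n A by simp_all
  have Th: "T ?h \<cdot> L = \<l> (tot2 B) \<cdot> ?h"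
  proof (rule pb_eqI[OF stable_pbD(3)[OF s]])
    have "T (T (fst2 B)) \<cdot> (\<l> (tot2 B) \<cdot> ?h) = ?l \<cdot> a"
      "T (T (snd2 B)) \<cdot> (\<l> (tot2 B) \<cdot> ?h) = ?l \<cdot> ?n"
      using h A by simp_all
    moreover have "T (T (fst2 B)) \<cdot> (T ?h \<cdot> L) = ?l \<cdot> a"
      using T_eq[OF h(4), of L] h(1-3) L A al by simp
    moreover have "T (T (snd2 B)) \<cdot> (T ?h \<cdot> L) = ?l \<cdot> ?n"
      using T_eq[OF h(5), of L] h(1-3) L A bl assms(3,5) by simp
    ultimately show "T (T (fst2 B)) \<cdot> (T ?h \<cdot> L) = T (T (fst2 B)) \<cdot> (\<l> (tot2 B) \<cdot> ?h)"
      "T (T (snd2 B)) \<cdot> (T ?h \<cdot> L) = T (T (snd2 B)) \<cdot> (\<l> (tot2 B) \<cdot> ?h)" by simp_all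
  qed (use h(1-3) L A in simp_all)
  have m: "a \<ominus>\<^bsub>T_bundle C B\<^esub> b = T (addn B) \<cdot> ?h"
    by (simp add: minus_in_def plus_in_def)
  show ?thesis unfolding m using h(1-3) L A Th by simp
qed

section \<open>The identity bundle\<close>

text \<open>
  The identity of \<open>M\<close> as a differential bundle, with one-point fibres.  As a factor of the
  parameter object \<open>V \<times>\<^sub>M W\<close> in the definition of a unit object it leaves only the other factor.
\<close>

definition id_bundle :: "'o \<Rightarrow> ('o, 'm) bundle_data" where
  "id_bundle M = \<lparr>tot = M, base = M, prj = Id C M, zer = Id C M, tot2 = M, fst2 = Id C M,
     snd2 = Id C M, addn = Id C M, nega = Id C M, lft = \<o> M\<rparr>"

lemma id_bundle_simps [simp]:
  "tot (id_bundle M) = M" "base (id_bundle M) = M" "prj (id_bundle M) = Id C M"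
  "zer (id_bundle M) = Id C M" "tot2 (id_bundle M) = M" "fst2 (id_bundle M) = Id C M"
  "snd2 (id_bundle M) = Id C M" "addn (id_bundle M) = Id C M" "nega (id_bundle M) = Id C M"
  "lft (id_bundle M) = \<o> M"
  by (simp_all add: id_bundle_def)

lemma Tpow_typing [simp]:
  assumes "f \<in> Ar C"
  shows "(T ^^ k) f \<in> Ar C" "Dom C ((T ^^ k) f) = (TO C ^^ k) (Dom C f)"
    "Cod C ((T ^^ k) f) = (TO C ^^ k) (Cod C f)"
  by (induction k) (use assms in simp_all)

lemma Tpow_comp:
  assumes "f \<in> Ar C" "g \<in> Ar C" "Cod C f = Dom C g"
  shows "(T ^^ k) (g \<cdot> f) = (T ^^ k) g \<cdot> (T ^^ k) f"
  by (induction k) (use assms in simp_all)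

lemma Tpow_Ob [simp]: "X \<in> Ob C \<Longrightarrow> (TO C ^^ k) X \<in> Ob C"
  by (induction k) simp_all

lemma Tpow_Id [simp]: "X \<in> Ob C \<Longrightarrow> (T ^^ k) (Id C X) = Id C ((TO C ^^ k) X)"
  by (induction k) simp_all

lemma pb_Id:
  assumes "f \<in> Ar C" "Cod C f = M" "Dom C f = E"
  shows "is_pullback C f (Id C M) E (Id C E) f"
  unfolding is_pullback_def
proof (intro conjI allI impI)
  have ob: "M \<in> Ob C" "E \<in> Ob C" using assms by auto
  fix Z x y
  assume "x \<in> hom C Z (Dom C f)" "y \<in> hom C Z (Dom C (Id C M))" and e: "f \<cdot> x = Id C M \<cdot> y"
  then have t: "x \<in> Ar C" "Dom C x = Z" "Cod C x = E" "y \<in> Ar C" "Dom C y = Z" "Cod C y = M"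
    using assms ob by simp_all
  show "\<exists>!h. h \<in> hom C Z E \<and> Id C E \<cdot> h = x \<and> f \<cdot> h = y"
  proof (rule ex1I[of _ x])
    show "x \<in> hom C Z E \<and> Id C E \<cdot> x = x \<and> f \<cdot> x = y" using e t ob by simp
    fix h assume "h \<in> hom C Z E \<and> Id C E \<cdot> h = x \<and> f \<cdot> h = y"
    then show "h = x" by (elim conjE) simp
  qed
qed (use assms in auto)

lemma stable_pb_Id:
  assumes "f \<in> Ar C" "Cod C f = M" "Dom C f = E"
  shows "stable_pullback C f (Id C M) E (Id C E) f"
  unfolding stable_pullback_def
proof
  fix k
  have "M \<in> Ob C" "E \<in> Ob C" using assms by auto
  then show "is_pullback C ((T ^^ k) f) ((T ^^ k) (Id C M)) ((TO C ^^ k) E) ((T ^^ k) (Id C E)) ((T ^^ k) f)"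
    using pb_Id[of "(T ^^ k) f"] assms by simp
qed

lemma pair_Id:
  assumes "x \<in> Ar C" "Cod C x = M"
  shows "pair C (Id C M) (Id C M) x x = x"
proof -
  have "M \<in> Ob C" using assms by auto
  then show ?thesis
    by (intro pb_pair_eq[OF pb_Id[of "Id C M" M M]]) (use assms in simp_all)
qed

lemma id_bundle_differential:
  assumes M: "M \<in> Ob C"
  shows "differential_bundle C (id_bundle M)"
proof -
  have pb: "stable_pullback C (Id C M) (Id C M) M (Id C M) (Id C M)"
    using stable_pb_Id[of "Id C M"] M by simp
  have ab: "additive_bundle C (id_bundle M)"
    unfolding additive_bundle_def id_bundle_simps
  proof (intro conjI allI impI)
    show "is_pullback C (Id C M) (Id C M) M (Id C M) (Id C M)" using stable_pbD(1)[OF pb] .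
    fix Z x y z
    assume a: "x \<in> hom C Z M" "y \<in> hom C Z M" "z \<in> hom C Z M" "Id C M \<cdot> x = Id C M \<cdot> y"
      "Id C M \<cdot> y = Id C M \<cdot> z"
    then have e: "x = z" "y = z" by auto
    have "plus_in C (id_bundle M) z z = z" using a(3) pair_Id[of z M] by (simp add: plus_in_def)
    then show "plus_in C (id_bundle M) (plus_in C (id_bundle M) x y) z =
        plus_in C (id_bundle M) x (plus_in C (id_bundle M) y z)"
      "plus_in C (id_bundle M) x y = plus_in C (id_bundle M) y x"
      "plus_in C (id_bundle M) x (Id C M \<cdot> Id C M \<cdot> x) = x"
      "plus_in C (id_bundle M) x (Id C M \<cdot> x) = Id C M \<cdot> Id C M \<cdot> x"
      using a(3) unfolding e by simp_all
  qed (use M in simp_all)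
  have z: "\<o> M \<in> Ar C" "Dom C (\<o> M) = M" "Cod C (\<o> M) = TO C M"
    "\<p> M \<cdot> \<o> M = Id C M"
    using M by simp_all
  have pl: "plus_in C (T_bundle C (id_bundle M)) (\<o> M) (\<o> M) = \<o> M"
    using z M pair_Id[of "\<o> M" "TO C M"] by (simp add: plus_in_def)
  have pl2: "plus_in C (tb C M) (\<o> M) (\<o> M) = \<o> M"
    using z M plus_zer(1)[of "tb C M" "\<o> M" "Id C M"] by simp
  have mu: "mu C (id_bundle M) = \<o> M"
    using pl M by (simp add: mu_def)
  have "is_power C n (Id C X) X (\<lambda>i. Id C X)" if "X \<in> Ob C" "n \<ge> 1" for X n
    unfolding is_power_def
  proof (intro conjI allI impI)
    fix Z x
    assume x: "\<forall>i<n. x i \<in> hom C Z (Dom C (Id C X))" "\<forall>i<n. \<forall>j<n. Id C X \<cdot> x i = Id C X \<cdot> x j"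
    have x0: "x i \<in> Ar C \<and> Dom C (x i) = Z \<and> Cod C (x i) = X" if "i < n" for i
      using x(1) that \<open>X \<in> Ob C\<close> by simp
    have e: "x i = x 0" if "i < n" for i
    proof -
      have "Id C X \<cdot> x i = Id C X \<cdot> x 0" using x(2) that \<open>n \<ge> 1\<close> by (meson le_0_eq less_le_trans not_less zero_less_one)
      then show ?thesis using x0[of i] x0[of 0] that by simp
    qed
    show "\<exists>!h. h \<in> hom C Z X \<and> (\<forall>i<n. Id C X \<cdot> h = x i)"
    proof (rule ex1I[of _ "x 0"])
      have "0 < n" using that(2) by simp
      note x00 = x0[OF this]
      show "x 0 \<in> hom C Z X \<and> (\<forall>i<n. Id C X \<cdot> x 0 = x i)"
        using x00 e by (metis Id_comp hom_iff)
      show "h = x 0" if "h \<in> hom C Z X \<and> (\<forall>i<n. Id C X \<cdot> h = x i)" for h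
        using that \<open>0 < n\<close> by (metis Id_comp hom_iff)
    qed
  qed (use that in simp_all)
  then have "has_stable_powers C (Id C M)"
    unfolding has_stable_powers_def using M
    by (intro allI impI exI[of _ M] exI[of _ "\<lambda>i. Id C M"]) simp
  moreover have "stable_equaliser C (Id C (TO C M)) (\<o> M \<cdot> \<p> M) M (\<o> M)"
    unfolding stable_equaliser_def
  proof
    fix k
    let ?z = "(T ^^ k) (\<o> M)" and ?p = "(T ^^ k) (\<p> M)"
    have 1: "(T ^^ k) (\<o> M \<cdot> \<p> M) = ?z \<cdot> ?p" using M by (simp add: Tpow_comp)
    have 2: "?p \<cdot> ?z = Id C ((TO C ^^ k) M)"
      using M z Tpow_comp[of "\<o> M" "\<p> M" k] by simp
    have t: "?z \<in> Ar C" "Dom C ?z = (TO C ^^ k) M" "Cod C ?z = (TO C ^^ k) (TO C M)"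
      "?p \<in> Ar C" "Cod C ?p = (TO C ^^ k) M" "Dom C ?p = (TO C ^^ k) (TO C M)"
      "(TO C ^^ k) (TO C M) \<in> Ob C" "(TO C ^^ k) M \<in> Ob C"
      using M by simp_all
    have 3: "(T ^^ k) (Id C (TO C M)) = Id C ((TO C ^^ k) (TO C M))" using M by simp
    show "is_equaliser C ((T ^^ k) (Id C (TO C M))) ((T ^^ k) (\<o> M \<cdot> \<p> M))
        ((TO C ^^ k) M) ?z"
      unfolding is_equaliser_def 1 3
    proof (intro conjI allI impI)
      fix Z x
      assume "x \<in> hom C Z (Dom C (Id C ((TO C ^^ k) (TO C M))))"
        and e: "Id C ((TO C ^^ k) (TO C M)) \<cdot> x = (?z \<cdot> ?p) \<cdot> x"
      then have x: "x \<in> Ar C" "Dom C x = Z" "Cod C x = (TO C ^^ k) (TO C M)" using t by auto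
      show "\<exists>!h. h \<in> hom C Z ((TO C ^^ k) M) \<and> ?z \<cdot> h = x"
      proof (rule ex1I[of _ "?p \<cdot> x"])
        show "?p \<cdot> x \<in> hom C Z ((TO C ^^ k) M) \<and> ?z \<cdot> (?p \<cdot> x) = x" using x e t by simp
        fix h assume h: "h \<in> hom C Z ((TO C ^^ k) M) \<and> ?z \<cdot> h = x"
        then have "?p \<cdot> x = ?p \<cdot> (?z \<cdot> h)" by simp
        also have "\<dots> = h" using comp_eq_at[OF 2, of h] h t by simp
        finally show "h = ?p \<cdot> x" by simp
      qed
    qed (use t comp_eq_at[OF 2, of "Id C ((TO C ^^ k) M)"] in simp_all)
  qed
  moreover have "\<l> M \<cdot> \<o> M = T (\<o> M) \<cdot> \<o> M"
    using tangent_laws(8)[OF M] by (simp add: additive_mor_def)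
  moreover have "additive_mor C (id_bundle M) (T_bundle C (id_bundle M)) (\<o> M) (\<o> M)"
    using z pl M by (simp add: additive_mor_def bundle_mor_def)
  moreover have "additive_mor C (id_bundle M) (tb C M) (\<o> M) (Id C M)"
    using z pl2 M by (simp add: additive_mor_def bundle_mor_def)
  ultimately show ?thesis
    unfolding differential_bundle_def using ab pb mu M z by simp
qed

end

section \<open>Scalar multiplication\<close>

locale unit_setting = tangent_setting C for C :: "('o, 'm, 'z) tangent_scheme" (structure) +
  fixes R :: "('o, 'm) bundle_data" and u :: 'm
  assumes limits: "limits_exist C" and unit: "unit_object C R u"
begin

text \<open>Scalar multiplication as an arrow and on elements, and its image under \<open>T\<close> on elements.\<close>

abbreviation sc where "sc B \<equiv> scal C R u B"
abbreviation mul where "mul B r a \<equiv> smul C R u B r a"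
abbreviation T_mul where "T_mul B s v \<equiv> smul_T C R u B s v"

text \<open>The product \<open>R \<times> X\<close> and its projections to \<open>R\<close> and to \<open>X\<close>.\<close>

abbreviation RX where "RX X \<equiv> tot (trivial C R X)"
abbreviation pr\<^sub>R where "pr\<^sub>R X \<equiv> to_R C R X"
abbreviation pr\<^sub>X where "pr\<^sub>X X \<equiv> prj (trivial C R X)"

lemma unit_laws:
  shows R_differential [simp]: "differential_bundle C R"
    and R_terminal: "is_terminal C (base R)"
    and u_hom: "u \<in> hom C (base R) (tot R)"
    and R_slice: "M \<in> Ob C \<Longrightarrow> slice_unit C M (trivial C R M) (point_over C R u M)"
  using unit unfolding unit_object_def differential_object_def by blast+

lemma u_typing [simp]: "u \<in> Ar C" "Dom C u = base R" "Cod C u = tot R"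
  using u_hom by simp_all

text \<open>All iterates \<open>T\<^sup>k(1)\<close> are terminal.\<close>

lemma terminal_eq:
  assumes "x \<in> Ar C" "y \<in> Ar C" "Dom C x = Dom C y" "Cod C x = (TO C ^^ k) (base R)"
    "Cod C y = (TO C ^^ k) (base R)"
  shows "x = y"
proof -
  have "is_terminal C ((TO C ^^ k) (base R))"
    by (induction k) (use limits R_terminal in \<open>auto simp: limits_exist_def\<close>)
  moreover have "x \<in> hom C (Dom C x) ((TO C ^^ k) (base R))" "y \<in> hom C (Dom C x) ((TO C ^^ k) (base R))"
    using assms by auto
  ultimately show ?thesis using Dom_Ob[OF assms(1)] unfolding is_terminal_def by blast
qed

lemma bang_typing [simp]:
  assumes "X \<in> Ob C"
  shows "bang C R X \<in> Ar C" "Dom C (bang C R X) = X" "Cod C (bang C R X) = base R"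
proof -
  have "\<exists>!f. f \<in> hom C X (base R)" using R_terminal assms by (simp add: is_terminal_def)
  from theI'[OF this] show "bang C R X \<in> Ar C" "Dom C (bang C R X) = X" "Cod C (bang C R X) = base R"
    unfolding bang_def by simp_all
qed

lemma prod_stable:
  assumes "X \<in> Ob C"
  shows "stable_pullback C (bang C R X) (prj R) (RX X) (pr\<^sub>X X) (pr\<^sub>R X)"
    and "base (trivial C R X) = X"
    and "lft (trivial C R X) = pair C (T (pr\<^sub>X X)) (T (pr\<^sub>R X)) (\<o> X \<cdot> pr\<^sub>X X) (lft R \<cdot> pr\<^sub>R X)"
proof -
  have "\<exists>P a b. stable_pullback C (bang C R X) (prj R) P a b"
    using limits assms R_differential bang_typing[OF assms] unfolding limits_exist_def by blast
  then have "\<exists>x. (case x of (P, a, b) \<Rightarrow> stable_pullback C (bang C R X) (prj R) P a b)" by auto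
  from someI_ex[OF this]
  have c: "case chosen_pullback C (bang C R X) (prj R) of (P, a, b) \<Rightarrow>
      stable_pullback C (bang C R X) (prj R) P a b"
    unfolding chosen_pullback_def .
  obtain P a b where e: "chosen_pullback C (bang C R X) (prj R) = (P, a, b)" by (cases "chosen_pullback C (bang C R X) (prj R)") auto
  obtain P2 s t where e2: "chosen_pullback C a a = (P2, s, t)" by (cases "chosen_pullback C a a") auto
  have "RX X = P" "pr\<^sub>X X = a" "pr\<^sub>R X = b"
    by (simp_all add: trivial_def to_R_def pull_bundle_def pull_map_def e e2)
  then show "stable_pullback C (bang C R X) (prj R) (RX X) (pr\<^sub>X X) (pr\<^sub>R X)"
    using c e by simp
  show "base (trivial C R X) = X"
    "lft (trivial C R X) = pair C (T (pr\<^sub>X X)) (T (pr\<^sub>R X)) (\<o> X \<cdot> pr\<^sub>X X) (lft R \<cdot> pr\<^sub>R X)"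
    using assms by (simp_all add: trivial_def to_R_def pull_bundle_def pull_map_def e e2)
qed

lemmas prod_pb = stable_pbD[OF stable_pb_sym[OF prod_stable(1)]]

lemma prod_typing [simp]:
  assumes "X \<in> Ob C"
  shows "pr\<^sub>X X \<in> Ar C" "pr\<^sub>R X \<in> Ar C" "Dom C (pr\<^sub>X X) = RX X" "Dom C (pr\<^sub>R X) = RX X"
    "Cod C (pr\<^sub>X X) = X" "Cod C (pr\<^sub>R X) = tot R" "RX X \<in> Ob C"
proof -
  note t = pb_typing[OF prod_pb(1)[OF assms]]
  show "pr\<^sub>X X \<in> Ar C" "pr\<^sub>R X \<in> Ar C" "Dom C (pr\<^sub>X X) = RX X" "Dom C (pr\<^sub>R X) = RX X"
    "Cod C (pr\<^sub>X X) = X" "Cod C (pr\<^sub>R X) = tot R" using t assms by simp_all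
  then show "RX X \<in> Ob C" using Dom_Ob[of "pr\<^sub>X X"] by simp
qed

text \<open>The elements \<open>(s, y)\<close> of \<open>T(R \<times> X)\<close> and of \<open>T\<^sup>2(R \<times> X)\<close>, given by their two components.\<close>

definition telt :: "'o \<Rightarrow> 'm \<Rightarrow> 'm \<Rightarrow> 'm" where
  "telt X s y = pair C (T (pr\<^sub>R X)) (T (pr\<^sub>X X)) s y"

definition ttelt :: "'o \<Rightarrow> 'm \<Rightarrow> 'm \<Rightarrow> 'm" where
  "ttelt X s y = pair C (T (T (pr\<^sub>R X))) (T (T (pr\<^sub>X X))) s y"

lemma elt_typing [simp]:
  assumes "X \<in> Ob C" "r \<in> Ar C" "x \<in> Ar C" "Cod C r = tot R" "Cod C x = X" "Dom C r = Dom C x"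
  shows "elt C R X r x \<in> Ar C" "Dom C (elt C R X r x) = Dom C x" "Cod C (elt C R X r x) = RX X"
    "pr\<^sub>R X \<cdot> elt C R X r x = r" "pr\<^sub>X X \<cdot> elt C R X r x = x"
proof -
  have "prj R \<cdot> r = bang C R X \<cdot> x"
    by (rule terminal_eq[where k = 0]) (use assms in simp_all)
  note p = pb_pair[OF prod_pb(1)[OF assms(1)] assms(2,3) _ _ assms(6) this]
  show "elt C R X r x \<in> Ar C" "Dom C (elt C R X r x) = Dom C x" "Cod C (elt C R X r x) = RX X"
    "pr\<^sub>R X \<cdot> elt C R X r x = r" "pr\<^sub>X X \<cdot> elt C R X r x = x"
    using p assms by (simp_all add: elt_def)
qed

lemma telt_typing [simp]:
  assumes "X \<in> Ob C" "r \<in> Ar C" "x \<in> Ar C" "Cod C r = TO C (tot R)" "Cod C x = TO C X" "Dom C r = Dom C x"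
  shows "telt X r x \<in> Ar C" "Dom C (telt X r x) = Dom C x" "Cod C (telt X r x) = TO C (RX X)"
    "T (pr\<^sub>R X) \<cdot> telt X r x = r" "T (pr\<^sub>X X) \<cdot> telt X r x = x"
proof -
  have "T (prj R) \<cdot> r = T (bang C R X) \<cdot> x"
    by (rule terminal_eq[where k = 1]) (use assms in simp_all)
  note p = pb_pair[OF prod_pb(2)[OF assms(1)] assms(2,3) _ _ assms(6) this]
  show "telt X r x \<in> Ar C" "Dom C (telt X r x) = Dom C x" "Cod C (telt X r x) = TO C (RX X)"
    "T (pr\<^sub>R X) \<cdot> telt X r x = r" "T (pr\<^sub>X X) \<cdot> telt X r x = x"
    using p assms by (simp_all add: telt_def)
qed

lemma ttelt_typing [simp]:
  assumes "X \<in> Ob C" "r \<in> Ar C" "x \<in> Ar C" "Cod C r = TO C (TO C (tot R))" "Cod C x = TO C (TO C X)"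
    "Dom C r = Dom C x"
  shows "ttelt X r x \<in> Ar C" "Dom C (ttelt X r x) = Dom C x" "Cod C (ttelt X r x) = TO C (TO C (RX X))"
    "T (T (pr\<^sub>R X)) \<cdot> ttelt X r x = r" "T (T (pr\<^sub>X X)) \<cdot> ttelt X r x = x"
proof -
  have "T (T (prj R)) \<cdot> r = T (T (bang C R X)) \<cdot> x"
    by (rule terminal_eq[where k = 2]) (use assms in \<open>simp_all add: numeral_2_eq_2\<close>)
  note p = pb_pair[OF prod_pb(3)[OF assms(1)] assms(2,3) _ _ assms(6) this]
  show "ttelt X r x \<in> Ar C" "Dom C (ttelt X r x) = Dom C x" "Cod C (ttelt X r x) = TO C (TO C (RX X))"
    "T (T (pr\<^sub>R X)) \<cdot> ttelt X r x = r" "T (T (pr\<^sub>X X)) \<cdot> ttelt X r x = x"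
    using p assms by (simp_all add: ttelt_def)
qed

lemma elt_eqI:
  assumes "X \<in> Ob C" "h \<in> Ar C"
  shows "Cod C h = RX X \<Longrightarrow> pr\<^sub>R X \<cdot> h = r \<Longrightarrow> pr\<^sub>X X \<cdot> h = x \<Longrightarrow> elt C R X r x = h"
    and "Cod C h = TO C (RX X) \<Longrightarrow> T (pr\<^sub>R X) \<cdot> h = r \<Longrightarrow> T (pr\<^sub>X X) \<cdot> h = x \<Longrightarrow> telt X r x = h"
    and "Cod C h = TO C (TO C (RX X)) \<Longrightarrow> T (T (pr\<^sub>R X)) \<cdot> h = r \<Longrightarrow> T (T (pr\<^sub>X X)) \<cdot> h = x \<Longrightarrow>
      ttelt X r x = h"
  using pb_pair_eq[OF prod_pb(1)[OF assms(1)] assms(2)]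
    pb_pair_eq[OF prod_pb(2)[OF assms(1)] assms(2)]
    pb_pair_eq[OF prod_pb(3)[OF assms(1)] assms(2)]
  unfolding elt_def telt_def ttelt_def by blast+

lemma elt_comp:
  assumes "X \<in> Ob C" "r \<in> Ar C" "x \<in> Ar C" "Dom C r = Dom C x" "z \<in> Ar C" "Cod C z = Dom C x"
  shows "Cod C r = tot R \<Longrightarrow> Cod C x = X \<Longrightarrow> elt C R X r x \<cdot> z = elt C R X (r \<cdot> z) (x \<cdot> z)"
    and "Cod C r = TO C (tot R) \<Longrightarrow> Cod C x = TO C X \<Longrightarrow> telt X r x \<cdot> z = telt X (r \<cdot> z) (x \<cdot> z)"
    and "Cod C r = TO C (TO C (tot R)) \<Longrightarrow> Cod C x = TO C (TO C X) \<Longrightarrow>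
      ttelt X r x \<cdot> z = ttelt X (r \<cdot> z) (x \<cdot> z)"
    and "Cod C r = tot R \<Longrightarrow> Cod C x = X \<Longrightarrow> T (elt C R X r x) = telt X (T r) (T x)"
    and "Cod C r = TO C (tot R) \<Longrightarrow> Cod C x = TO C X \<Longrightarrow> T (telt X r x) = ttelt X (T r) (T x)"
proof -
  show "elt C R X r x \<cdot> z = elt C R X (r \<cdot> z) (x \<cdot> z)" if "Cod C r = tot R" "Cod C x = X"
  proof -
    note e = elt_typing[OF assms(1-3) that assms(4)]
    show ?thesis
      by (rule elt_eqI(1)[symmetric])
        (use assms that e(1-3) comp_eq_at[OF e(4), of z] comp_eq_at[OF e(5), of z] in simp_all)
  qed
  show "telt X r x \<cdot> z = telt X (r \<cdot> z) (x \<cdot> z)" if "Cod C r = TO C (tot R)" "Cod C x = TO C X"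
  proof -
    note e = telt_typing[OF assms(1-3) that assms(4)]
    show ?thesis
      by (rule elt_eqI(2)[symmetric])
        (use assms that e(1-3) comp_eq_at[OF e(4), of z] comp_eq_at[OF e(5), of z] in simp_all)
  qed
  show "ttelt X r x \<cdot> z = ttelt X (r \<cdot> z) (x \<cdot> z)"
    if "Cod C r = TO C (TO C (tot R))" "Cod C x = TO C (TO C X)"
  proof -
    note e = ttelt_typing[OF assms(1-3) that assms(4)]
    show ?thesis
      by (rule elt_eqI(3)[symmetric])
        (use assms that e(1-3) comp_eq_at[OF e(4), of z] comp_eq_at[OF e(5), of z] in simp_all)
  qed
  show "T (elt C R X r x) = telt X (T r) (T x)" if "Cod C r = tot R" "Cod C x = X"
    by (rule elt_eqI(2)[symmetric])
      (use assms that T_comp[of "elt C R X r x" "pr\<^sub>R X"] T_comp[of "elt C R X r x" "pr\<^sub>X X"] in simp_all)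
  show "T (telt X r x) = ttelt X (T r) (T x)" if "Cod C r = TO C (tot R)" "Cod C x = TO C X"
    by (rule elt_eqI(3)[symmetric])
      (use assms that T_comp[of "telt X r x" "T (pr\<^sub>R X)"] T_comp[of "telt X r x" "T (pr\<^sub>X X)"] in simp_all)
qed

text \<open>The lift of the trivial bundle \<open>R \<times> X \<rightarrow> X\<close> is \<open>\<lambda> \<times> 0\<close>.\<close>

lemma trivial_lft:
  assumes "X \<in> Ob C"
  shows "lft (trivial C R X) = telt X (lft R \<cdot> pr\<^sub>R X) (\<o> X \<cdot> pr\<^sub>X X)"
  unfolding prod_stable(3)[OF assms]
  by (rule pb_pair_eq[OF stable_pbD(2)[OF prod_stable(1)[OF assms]]]) (use assms in simp_all)

text \<open>
  Cancellation for pullback squares: with \<open>PM = bM\<^sup>* r\<close> and \<open>PE = (bM f)\<^sup>* r\<close>, the object \<open>PE\<close> is the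
  pullback of \<open>PM\<close> along \<open>f\<close>.  It is needed for \<open>R \<times> E = (R \<times> M) \<times>\<^sub>M E\<close>.
\<close>

lemma pb_base_change:
  assumes "is_pullback C bE r PE prE toE" "is_pullback C bM r PM prM toM"
    and "f \<in> Ar C" "Dom C f = Dom C bE" "Cod C f = Dom C bM" "bM \<cdot> f = bE"
    and "y \<in> Ar C" "Dom C y = PE" "Cod C y = PM" "prM \<cdot> y = f \<cdot> prE" "toM \<cdot> y = toE"
  shows "is_pullback C prM f PE y prE"
  unfolding is_pullback_def
proof (intro conjI allI impI)
  note E = pb_typing[OF assms(1)] and M = pb_typing[OF assms(2)]
  fix Z a b
  assume "a \<in> hom C Z (Dom C prM)" "b \<in> hom C Z (Dom C f)" and e: "prM \<cdot> a = f \<cdot> b"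
  then have t: "a \<in> Ar C" "Dom C a = Z" "Cod C a = PM" "b \<in> Ar C" "Dom C b = Z" "Cod C b = Dom C bE"
    using assms(4) M by simp_all
  have "bE \<cdot> b = bM \<cdot> (f \<cdot> b)" using comp_eq_at[OF assms(6), of b] t assms(3-5) M by simp
  also have "\<dots> = r \<cdot> (toM \<cdot> a)" using comp_eq_comp_at[OF M(10), of a] t M unfolding e[symmetric] by simp
  finally have be: "bE \<cdot> b = r \<cdot> (toM \<cdot> a)" .
  note k = pb_pair[OF assms(1) t(4) _ t(6) _ _ be]
  define h where "h = pair C prE toE b (toM \<cdot> a)"
  have h: "h \<in> Ar C" "Dom C h = Z" "Cod C h = PE" "prE \<cdot> h = b" "toE \<cdot> h = toM \<cdot> a"
    using k t M unfolding h_def by simp_all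
  have yh: "y \<cdot> h = a"
  proof (rule pb_eqI[OF assms(2)])
    show "prM \<cdot> (y \<cdot> h) = prM \<cdot> a"
      using comp_eq_comp_at[OF assms(10), of h] assms(3-9) h(1-4) E M unfolding e by simp
    show "toM \<cdot> (y \<cdot> h) = toM \<cdot> a"
      using comp_eq_at[OF assms(11), of h] assms(7-9) h E M by simp
  qed (use assms(7-9) h t in simp_all)
  show "\<exists>!h. h \<in> hom C Z PE \<and> y \<cdot> h = a \<and> prE \<cdot> h = b"
  proof (rule ex1I[of _ h])
    show "h \<in> hom C Z PE \<and> y \<cdot> h = a \<and> prE \<cdot> h = b" using h yh by simp
    fix h' assume h': "h' \<in> hom C Z PE \<and> y \<cdot> h' = a \<and> prE \<cdot> h' = b"
    show "h' = h"
    proof (rule pb_eqI[OF assms(1)])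
      show "prE \<cdot> h' = prE \<cdot> h" using h h' by simp
      have "toE \<cdot> h' = toM \<cdot> (y \<cdot> h')"
        using comp_eq_at[OF assms(11), of h'] assms(7-9) h' E M by simp
      then show "toE \<cdot> h' = toE \<cdot> h" using h' h(5) by simp
    qed (use h h' in simp_all)
  qed
qed (use pb_typing[OF assms(1)] pb_typing[OF assms(2)] assms(3-10) in simp_all)

lemma bang_comp:
  assumes "f \<in> Ar C" "M = Cod C f"
  shows "bang C R M \<cdot> f = bang C R (Dom C f)"
  unfolding assms(2) by (rule terminal_eq[where k = 0]) (use assms(1) in simp_all)

lemma stable_pb_base_change:
  assumes "f \<in> Ar C" "Dom C f = E" "Cod C f = M"
  shows "stable_pullback C (pr\<^sub>X M) f (RX E) (elt C R M (pr\<^sub>R E) (f \<cdot> pr\<^sub>X E)) (pr\<^sub>X E)"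
  unfolding stable_pullback_def
proof
  fix k
  have ob: "E \<in> Ob C" "M \<in> Ob C" using assms by auto
  let ?y = "elt C R M (pr\<^sub>R E) (f \<cdot> pr\<^sub>X E)"
  have y: "?y \<in> Ar C" "Dom C ?y = RX E" "Cod C ?y = RX M" "pr\<^sub>R M \<cdot> ?y = pr\<^sub>R E" "pr\<^sub>X M \<cdot> ?y = f \<cdot> pr\<^sub>X E"
    using elt_typing[of M "pr\<^sub>R E" "f \<cdot> pr\<^sub>X E"] ob assms by simp_all
  have b: "bang C R M \<cdot> f = bang C R E" using bang_comp[of f M] assms by simp
  note S = prod_stable(1)[OF ob(1), unfolded stable_pullback_def, rule_format, of k]
    and S' = prod_stable(1)[OF ob(2), unfolded stable_pullback_def, rule_format, of k]
  show "is_pullback C ((T ^^ k) (pr\<^sub>X M)) ((T ^^ k) f) ((TO C ^^ k) (RX E)) ((T ^^ k) ?y) ((T ^^ k) (pr\<^sub>X E))"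
  proof (rule pb_base_change[OF S S'])
    show "(T ^^ k) (bang C R M) \<cdot> (T ^^ k) f = (T ^^ k) (bang C R E)"
      using Tpow_comp[of f "bang C R M" k] assms ob by (simp add: b)
    show "(T ^^ k) (pr\<^sub>X M) \<cdot> (T ^^ k) ?y = (T ^^ k) f \<cdot> (T ^^ k) (pr\<^sub>X E)"
      using Tpow_comp[of ?y "pr\<^sub>X M" k] Tpow_comp[of "pr\<^sub>X E" f k] y assms ob by simp
    show "(T ^^ k) (pr\<^sub>R M) \<cdot> (T ^^ k) ?y = (T ^^ k) (pr\<^sub>R E)"
      using Tpow_comp[of ?y "pr\<^sub>R M" k] y assms ob by simp
  qed (use y assms ob in simp_all)
qed

lemma slice_hat:
  assumes "differential_bundle C V" "differential_bundle C W" "differential_bundle C E"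
    "base V = M" "base W = M" "base E = M"
    "stable_pullback C (prj V) (prj W) X v w" "stable_pullback C (pr\<^sub>X M) (prj V \<cdot> v) Y y\<^sub>0 y\<^sub>1"
    "f \<in> hom C X (tot E)" "prj E \<cdot> f = prj V \<cdot> v"
  shows "\<exists>!g. is_hat C (trivial C R M) (point_over C R u M) (prj V \<cdot> v) E f Y y\<^sub>0 y\<^sub>1 g"
proof -
  have "M \<in> Ob C" using assms(1,4) by auto
  from R_slice[OF this] show ?thesis
    unfolding slice_unit_def using assms by blast
qed

text \<open>The hat of \<open>id\<^sub>A\<close> exists: take \<open>V = A\<close> and \<open>W = id\<^sub>M\<close>.\<close>

lemma scal_hat:
  assumes "differential_bundle C A"
  shows "is_hat C (trivial C R (base A)) (point_over C R u (base A)) (prj A) A (Id C (tot A)) (RX (tot A))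
    (elt C R (base A) (pr\<^sub>R (tot A)) (prj A \<cdot> pr\<^sub>X (tot A))) (pr\<^sub>X (tot A)) (sc A)"
proof -
  have ob: "base A \<in> Ob C" "tot A \<in> Ob C" using assms by simp_all
  have "\<exists>!g. is_hat C (trivial C R (base A)) (point_over C R u (base A)) (prj A \<cdot> Id C (tot A)) A (Id C (tot A))
    (RX (tot A)) (elt C R (base A) (pr\<^sub>R (tot A)) (prj A \<cdot> pr\<^sub>X (tot A))) (pr\<^sub>X (tot A)) g"
  proof (rule slice_hat)
    show "stable_pullback C (prj A) (prj (id_bundle (base A))) (tot A) (Id C (tot A)) (prj A)"
      using stable_pb_Id[of "prj A" "base A" "tot A"] assms by simp
    show "stable_pullback C (pr\<^sub>X (base A)) (prj A \<cdot> Id C (tot A)) (RX (tot A))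
       (elt C R (base A) (pr\<^sub>R (tot A)) (prj A \<cdot> pr\<^sub>X (tot A))) (pr\<^sub>X (tot A))"
      using stable_pb_base_change[of "prj A" "tot A" "base A"] assms by simp
  qed (use assms ob id_bundle_differential in simp_all)
  then have "\<exists>!g. is_hat C (trivial C R (base A)) (point_over C R u (base A)) (prj A) A (Id C (tot A))
    (RX (tot A)) (elt C R (base A) (pr\<^sub>R (tot A)) (prj A \<cdot> pr\<^sub>X (tot A))) (pr\<^sub>X (tot A)) g"
    using assms by simp
  from theI'[OF this] show ?thesis unfolding scal_def .
qed

lemma scal_typing [simp]:
  assumes "differential_bundle C A"
  shows "sc A \<in> Ar C" "Dom C (sc A) = RX (tot A)" "Cod C (sc A) = tot A"
  using scal_hat[OF assms] unfolding is_hat_def hom_iff by blast+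

lemma scal_prj:
  assumes "differential_bundle C A"
  shows "prj A \<cdot> sc A = prj A \<cdot> pr\<^sub>X (tot A)"
  using scal_hat[OF assms] unfolding is_hat_def by blast

lemma smul_typing [simp]:
  assumes "differential_bundle C A" "r \<in> Ar C" "a \<in> Ar C" "Cod C r = tot R" "Cod C a = tot A" "Dom C r = Dom C a"
  shows "mul A r a \<in> Ar C" "Dom C (mul A r a) = Dom C a" "Cod C (mul A r a) = tot A"
    "prj A \<cdot> mul A r a = prj A \<cdot> a"
  using assms comp_eq_comp_at[OF scal_prj[OF assms(1)], of "elt C R (tot A) r a"]
  by (simp_all add: smul_def)

lemma smul_comp:
  assumes "differential_bundle C A" "r \<in> Ar C" "a \<in> Ar C" "Cod C r = tot R" "Cod C a = tot A" "Dom C r = Dom C a"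
    "z \<in> Ar C" "Cod C z = Dom C a"
  shows "mul A r a \<cdot> z = mul A (r \<cdot> z) (a \<cdot> z)"
  using assms by (simp add: smul_def elt_comp(1))

lemma smul_T_eq: "T_mul A s v = T (sc A) \<cdot> telt (tot A) s v"
  by (simp add: smul_T_def telt_def)

lemma T_smul:
  assumes "differential_bundle C A" "r \<in> Ar C" "a \<in> Ar C" "Cod C r = tot R" "Cod C a = tot A" "Dom C r = Dom C a"
  shows "T (mul A r a) = T_mul A (T r) (T a)"
  using assms elt_comp(4)[of "tot A" r a "Id C (Dom C a)"] by (simp add: smul_def smul_T_eq)

lemma prj_telt:
  assumes "X \<in> Ob C" "s \<in> Ar C" "v \<in> Ar C" "Dom C s = Dom C v"
  shows "Cod C s = TO C (tot R) \<Longrightarrow> Cod C v = TO C X \<Longrightarrow>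
      \<p> (RX X) \<cdot> telt X s v = elt C R X (\<p> (tot R) \<cdot> s) (\<p> X \<cdot> v)"
    and "Cod C s = TO C (TO C (tot R)) \<Longrightarrow> Cod C v = TO C (TO C X) \<Longrightarrow>
      \<p> (TO C (RX X)) \<cdot> ttelt X s v = telt X (\<p> (TO C (tot R)) \<cdot> s) (\<p> (TO C X) \<cdot> v)"
proof -
  show "\<p> (RX X) \<cdot> telt X s v = elt C R X (\<p> (tot R) \<cdot> s) (\<p> X \<cdot> v)"
    if "Cod C s = TO C (tot R)" "Cod C v = TO C X"
  proof (rule elt_eqI(1)[symmetric])
    note t = telt_typing[OF assms(1-3) that assms(4)]
    have "\<p> (tot R) \<cdot> (T (pr\<^sub>R X) \<cdot> telt X s v) = pr\<^sub>R X \<cdot> (\<p> (RX X) \<cdot> telt X s v)"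
      "\<p> X \<cdot> (T (pr\<^sub>X X) \<cdot> telt X s v) = pr\<^sub>X X \<cdot> (\<p> (RX X) \<cdot> telt X s v)"
      using assms(1) t(1-3) by simp_all
    then show "pr\<^sub>R X \<cdot> (\<p> (RX X) \<cdot> telt X s v) = \<p> (tot R) \<cdot> s"
      "pr\<^sub>X X \<cdot> (\<p> (RX X) \<cdot> telt X s v) = \<p> X \<cdot> v"
      using t(4,5) by simp_all
  qed (use assms that in simp_all)
  show "\<p> (TO C (RX X)) \<cdot> ttelt X s v = telt X (\<p> (TO C (tot R)) \<cdot> s) (\<p> (TO C X) \<cdot> v)"
    if "Cod C s = TO C (TO C (tot R))" "Cod C v = TO C (TO C X)"
  proof (rule elt_eqI(2)[symmetric])
    note t = ttelt_typing[OF assms(1-3) that assms(4)]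
    have "\<p> (TO C (tot R)) \<cdot> (T (T (pr\<^sub>R X)) \<cdot> ttelt X s v) = T (pr\<^sub>R X) \<cdot> (\<p> (TO C (RX X)) \<cdot> ttelt X s v)"
      "\<p> (TO C X) \<cdot> (T (T (pr\<^sub>X X)) \<cdot> ttelt X s v) = T (pr\<^sub>X X) \<cdot> (\<p> (TO C (RX X)) \<cdot> ttelt X s v)"
      using assms(1) t(1-3) by simp_all
    then show "T (pr\<^sub>R X) \<cdot> (\<p> (TO C (RX X)) \<cdot> ttelt X s v) = \<p> (TO C (tot R)) \<cdot> s"
      "T (pr\<^sub>X X) \<cdot> (\<p> (TO C (RX X)) \<cdot> ttelt X s v) = \<p> (TO C X) \<cdot> v"
      using t(4,5) by simp_all
  qed (use assms that in simp_all)
qed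

lemma smul_T_typing [simp]:
  assumes "differential_bundle C A" "s \<in> Ar C" "v \<in> Ar C" "Cod C s = TO C (tot R)" "Cod C v = TO C (tot A)"
    "Dom C s = Dom C v"
  shows "T_mul A s v \<in> Ar C" "Dom C (T_mul A s v) = Dom C v"
    "Cod C (T_mul A s v) = TO C (tot A)"
    "T (prj A) \<cdot> T_mul A s v = T (prj A) \<cdot> v"
    "\<p> (tot A) \<cdot> T_mul A s v =
      mul A (\<p> (tot R) \<cdot> s) (\<p> (tot A) \<cdot> v)"
proof -
  have ob: "tot A \<in> Ob C" using assms(1) by simp
  note t = telt_typing[OF ob assms(2-6)]
  show "T_mul A s v \<in> Ar C" "Dom C (T_mul A s v) = Dom C v"
    "Cod C (T_mul A s v) = TO C (tot A)"
    using assms t(1-3) by (simp_all add: smul_T_eq)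
  show "T (prj A) \<cdot> T_mul A s v = T (prj A) \<cdot> v"
    using T_eq[OF scal_prj[OF assms(1)], of "telt (tot A) s v"] assms ob t by (simp add: smul_T_eq)
  note e = prj_telt(1)[OF ob assms(2,3,6,4,5), symmetric]
  show "\<p> (tot A) \<cdot> T_mul A s v =
      mul A (\<p> (tot R) \<cdot> s) (\<p> (tot A) \<cdot> v)"
    unfolding smul_def e using assms(1) ob t(1-3) by (simp add: smul_T_eq)
qed

lemma smul_T_comp:
  assumes "differential_bundle C A" "s \<in> Ar C" "v \<in> Ar C" "Cod C s = TO C (tot R)" "Cod C v = TO C (tot A)"
    "Dom C s = Dom C v" "z \<in> Ar C" "Cod C z = Dom C v"
  shows "T_mul A s v \<cdot> z = T_mul A (s \<cdot> z) (v \<cdot> z)"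
  using assms by (simp add: smul_T_eq elt_comp(2))

text \<open>Linearity in the scalar: \<open>T(\<bullet>)(\<lambda> r, 0 a) = \<lambda>(r \<bullet> a)\<close>.\<close>

lemma scal_linear:
  assumes "differential_bundle C A" "r \<in> Ar C" "a \<in> Ar C" "Cod C r = tot R" "Cod C a = tot A" "Dom C r = Dom C a"
  shows "T_mul A (lft R \<cdot> r) (\<o> (tot A) \<cdot> a) = lft A \<cdot> mul A r a"
proof -
  let ?M = "base A" and ?E = "tot A"
  have ob: "?M \<in> Ob C" "?E \<in> Ob C" using assms(1) by simp_all
  let ?y = "elt C R ?M (pr\<^sub>R ?E) (prj A \<cdot> pr\<^sub>X ?E)"
  have y: "?y \<in> Ar C" "Dom C ?y = RX ?E" "Cod C ?y = RX ?M" "pr\<^sub>R ?M \<cdot> ?y = pr\<^sub>R ?E" "pr\<^sub>X ?M \<cdot> ?y = prj A \<cdot> pr\<^sub>X ?E"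
    using elt_typing[of ?M "pr\<^sub>R ?E" "prj A \<cdot> pr\<^sub>X ?E"] ob assms(1) by simp_all
  have 1: "T (sc A) \<cdot> pair C (T ?y) (T (pr\<^sub>X ?E)) (lft (trivial C R ?M) \<cdot> ?y) (\<o> ?E \<cdot> pr\<^sub>X ?E) =
      lft A \<cdot> sc A"
    using scal_hat[OF assms(1)] assms(1) unfolding is_hat_def by simp
  let ?h = "telt ?E (lft R \<cdot> pr\<^sub>R ?E) (\<o> ?E \<cdot> pr\<^sub>X ?E)"
  have h: "?h \<in> Ar C" "Dom C ?h = RX ?E" "Cod C ?h = TO C (RX ?E)"
    "T (pr\<^sub>R ?E) \<cdot> ?h = lft R \<cdot> pr\<^sub>R ?E" "T (pr\<^sub>X ?E) \<cdot> ?h = \<o> ?E \<cdot> pr\<^sub>X ?E"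
    using telt_typing[of ?E "lft R \<cdot> pr\<^sub>R ?E" "\<o> ?E \<cdot> pr\<^sub>X ?E"] ob by simp_all
  have "pair C (T ?y) (T (pr\<^sub>X ?E)) (lft (trivial C R ?M) \<cdot> ?y) (\<o> ?E \<cdot> pr\<^sub>X ?E) = ?h"
  proof (rule pb_pair_eq[OF stable_pbD(2)[OF stable_pb_base_change]])
    have "lft (trivial C R ?M) \<cdot> ?y = telt ?M (lft R \<cdot> pr\<^sub>R ?E) (\<o> ?M \<cdot> (prj A \<cdot> pr\<^sub>X ?E))"
      unfolding trivial_lft[OF ob(1)] by (subst elt_comp(2)) (use ob y assms(1) in simp_all)
    also have "\<dots> = T ?y \<cdot> ?h"
    proof (rule elt_eqI(2))
      show "T (pr\<^sub>R ?M) \<cdot> (T ?y \<cdot> ?h) = lft R \<cdot> pr\<^sub>R ?E"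
        using T_eq[OF y(4), of ?h] y(1-3) h ob by simp
      have "T (pr\<^sub>X ?M) \<cdot> (T ?y \<cdot> ?h) = T (prj A) \<cdot> (T (pr\<^sub>X ?E) \<cdot> ?h)"
        using T_eq[OF y(5), of ?h] y(1-3) h(1-3) ob assms(1) by simp
      then show "T (pr\<^sub>X ?M) \<cdot> (T ?y \<cdot> ?h) = \<o> ?M \<cdot> (prj A \<cdot> pr\<^sub>X ?E)"
        using h(5) ob assms(1) by simp
    qed (use y(1-3) h(1-3) ob in simp_all)
    finally show "T ?y \<cdot> ?h = lft (trivial C R ?M) \<cdot> ?y" by simp
  qed (use h ob assms(1) in simp_all)
  with 1 have 2: "T (sc A) \<cdot> ?h = lft A \<cdot> sc A" by simp
  have "?h \<cdot> elt C R ?E r a = telt ?E (lft R \<cdot> r) (\<o> ?E \<cdot> a)"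
    by (subst elt_comp(2)) (use assms ob in simp_all)
  then show ?thesis
    using comp_eq_comp_at[OF 2, of "elt C R ?E r a"] assms ob h(1-3) by (simp add: smul_def smul_T_eq)
qed

lemma smul_unit:
  assumes "differential_bundle C A" "a \<in> Ar C" "Cod C a = tot A" "Z = Dom C a"
  shows "mul A (u \<cdot> bang C R Z) a = a"
proof -
  let ?M = "base A" and ?E = "tot A"
  have ob: "?M \<in> Ob C" "?E \<in> Ob C" "Z \<in> Ob C" using assms by simp_all
  let ?y = "elt C R ?M (pr\<^sub>R ?E) (prj A \<cdot> pr\<^sub>X ?E)"
  have y: "?y \<in> Ar C" "Dom C ?y = RX ?E" "Cod C ?y = RX ?M" "pr\<^sub>R ?M \<cdot> ?y = pr\<^sub>R ?E" "pr\<^sub>X ?M \<cdot> ?y = prj A \<cdot> pr\<^sub>X ?E"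
    using elt_typing[of ?M "pr\<^sub>R ?E" "prj A \<cdot> pr\<^sub>X ?E"] ob assms(1) by simp_all
  have 1: "sc A \<cdot> pair C ?y (pr\<^sub>X ?E) (point_over C R u ?M \<cdot> prj A) (Id C ?E) = Id C ?E"
    using scal_hat[OF assms(1)] assms(1) unfolding is_hat_def by simp
  let ?h = "elt C R ?E (u \<cdot> bang C R ?E) (Id C ?E)"
  have h: "?h \<in> Ar C" "Dom C ?h = ?E" "Cod C ?h = RX ?E"
    "pr\<^sub>R ?E \<cdot> ?h = u \<cdot> bang C R ?E" "pr\<^sub>X ?E \<cdot> ?h = Id C ?E"
    using elt_typing[of ?E "u \<cdot> bang C R ?E" "Id C ?E"] ob by simp_all
  have "pair C ?y (pr\<^sub>X ?E) (point_over C R u ?M \<cdot> prj A) (Id C ?E) = ?h"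
  proof (rule pb_pair_eq[OF stable_pbD(1)[OF stable_pb_base_change]])
    have "point_over C R u ?M \<cdot> prj A = elt C R ?M (u \<cdot> bang C R ?E) (prj A)"
      unfolding point_over_def
      by (subst elt_comp(1)) (use ob assms(1) bang_comp[of "prj A" ?M] in simp_all)
    also have "\<dots> = ?y \<cdot> ?h"
    proof (rule elt_eqI(1))
      show "pr\<^sub>R ?M \<cdot> (?y \<cdot> ?h) = u \<cdot> bang C R ?E"
        using comp_eq_at[OF y(4), of ?h] y(1-3) h ob by simp
      have "pr\<^sub>X ?M \<cdot> (?y \<cdot> ?h) = prj A \<cdot> (pr\<^sub>X ?E \<cdot> ?h)"
        using comp_eq_at[OF y(5), of ?h] y(1-3) h(1-3) ob assms(1) by simp
      then show "pr\<^sub>X ?M \<cdot> (?y \<cdot> ?h) = prj A"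
        using h(5) ob assms(1) by simp
    qed (use y(1-3) h(1-3) ob in simp_all)
    finally show "?y \<cdot> ?h = point_over C R u ?M \<cdot> prj A" by simp
  qed (use h ob assms(1) in simp_all)
  with 1 have 2: "sc A \<cdot> ?h = Id C ?E" by simp
  have "?h \<cdot> a = elt C R ?E (u \<cdot> bang C R Z) a"
    by (subst elt_comp(1)) (use assms ob bang_comp[of a ?E] in simp_all)
  then show ?thesis
    using comp_eq_at[OF 2, of a] assms(1-3) ob h(1-3) by (simp add: smul_def)
qed

text \<open>The same for the map \<open>(r, m) \<mapsto> r \<bullet> y(m)\<close> on \<open>R \<times> M\<close>.\<close>

lemma smul_linear:
  assumes "differential_bundle C A" "M \<in> Ob C" "y \<in> Ar C" "Dom C y = M" "Cod C y = tot A"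
  shows "T (mul A (pr\<^sub>R M) (y \<cdot> pr\<^sub>X M)) \<cdot> telt M (lft R \<cdot> pr\<^sub>R M) (\<o> M \<cdot> pr\<^sub>X M) =
    lft A \<cdot> mul A (pr\<^sub>R M) (y \<cdot> pr\<^sub>X M)"
proof -
  let ?l = "telt M (lft R \<cdot> pr\<^sub>R M) (\<o> M \<cdot> pr\<^sub>X M)" and ?s = "mul A (pr\<^sub>R M) (y \<cdot> pr\<^sub>X M)"
  have l: "?l \<in> Ar C" "Dom C ?l = RX M" "Cod C ?l = TO C (RX M)" "T (pr\<^sub>R M) \<cdot> ?l = lft R \<cdot> pr\<^sub>R M" "T (pr\<^sub>X M) \<cdot> ?l = \<o> M \<cdot> pr\<^sub>X M"
    using telt_typing[of M "lft R \<cdot> pr\<^sub>R M" "\<o> M \<cdot> pr\<^sub>X M"] assms(2) by simp_all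
  have "T ?s \<cdot> ?l = T_mul A (T (pr\<^sub>R M) \<cdot> ?l) (T (y \<cdot> pr\<^sub>X M) \<cdot> ?l)"
    using assms l(1-3) by (simp add: T_smul smul_T_comp)
  also have "\<dots> = T_mul A (lft R \<cdot> pr\<^sub>R M) (\<o> (tot A) \<cdot> (y \<cdot> pr\<^sub>X M))"
    using assms(2-) l by simp
  also have "\<dots> = lft A \<cdot> ?s"
    by (rule scal_linear) (use assms in simp_all)
  finally show ?thesis .
qed

text \<open>
  Uniqueness of the linear extension of a section \<open>y\<close>: take \<open>V = W = id\<^sub>M\<close>, so that the parameter
  object is \<open>M\<close> and \<open>Y = R \<times> M\<close>.
\<close>

lemma smul_unique:
  assumes "differential_bundle C A" and M: "M = base A"
    and y: "y \<in> Ar C" "Dom C y = M" "Cod C y = tot A" "prj A \<cdot> y = Id C M"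
    and g: "g \<in> Ar C" "Dom C g = RX M" "Cod C g = tot A" "prj A \<cdot> g = pr\<^sub>X M"
    and gl: "T g \<cdot> telt M (lft R \<cdot> pr\<^sub>R M) (\<o> M \<cdot> pr\<^sub>X M) = lft A \<cdot> g"
    and gy: "g \<cdot> elt C R M (u \<cdot> bang C R M) (Id C M) = y"
  shows "g = mul A (pr\<^sub>R M) (y \<cdot> pr\<^sub>X M)"
proof -
  have ob: "M \<in> Ob C" using assms(1) M by simp
  have pb: "stable_pullback C (pr\<^sub>X M) (Id C M) (RX M) (Id C (RX M)) (pr\<^sub>X M)"
    using stable_pb_Id[of "pr\<^sub>X M" M "RX M"] ob by simp
  have "\<exists>!g. is_hat C (trivial C R M) (point_over C R u M) (prj (id_bundle M) \<cdot> Id C M) A y (RX M)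
    (Id C (RX M)) (pr\<^sub>X M) g"
  proof (rule slice_hat)
    show "stable_pullback C (prj (id_bundle M)) (prj (id_bundle M)) M (Id C M) (Id C M)"
      using stable_pb_Id[of "Id C M"] ob by simp
  qed (use assms(1-6) ob pb id_bundle_differential in simp_all)
  then have u: "\<exists>!g. is_hat C (trivial C R M) (point_over C R u M) (Id C M) A y (RX M) (Id C (RX M)) (pr\<^sub>X M) g"
    using ob by simp
  have hat: "is_hat C (trivial C R M) (point_over C R u M) (Id C M) A y (RX M) (Id C (RX M)) (pr\<^sub>X M) k"
    if k: "k \<in> Ar C" "Dom C k = RX M" "Cod C k = tot A" "prj A \<cdot> k = pr\<^sub>X M"
      "T k \<cdot> telt M (lft R \<cdot> pr\<^sub>R M) (\<o> M \<cdot> pr\<^sub>X M) = lft A \<cdot> k"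
      "k \<cdot> elt C R M (u \<cdot> bang C R M) (Id C M) = y" for k
  proof -
    let ?l = "telt M (lft R \<cdot> pr\<^sub>R M) (\<o> M \<cdot> pr\<^sub>X M)" and ?p = "elt C R M (u \<cdot> bang C R M) (Id C M)"
    have l: "?l \<in> Ar C" "Dom C ?l = RX M" "Cod C ?l = TO C (RX M)" "T (pr\<^sub>X M) \<cdot> ?l = \<o> M \<cdot> pr\<^sub>X M"
      using telt_typing[of M "lft R \<cdot> pr\<^sub>R M" "\<o> M \<cdot> pr\<^sub>X M"] ob by simp_all
    have p: "?p \<in> Ar C" "Dom C ?p = M" "Cod C ?p = RX M" "pr\<^sub>X M \<cdot> ?p = Id C M"
      using elt_typing[of M "u \<cdot> bang C R M" "Id C M"] ob by simp_all
    have 1: "pair C (T (Id C (RX M))) (T (pr\<^sub>X M)) (lft (trivial C R M) \<cdot> Id C (RX M)) (\<o> M \<cdot> pr\<^sub>X M) = ?l"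
      unfolding trivial_lft[OF ob] by (rule pb_pair_eq[OF stable_pbD(2)[OF pb]]) (use l ob in simp_all)
    have 2: "pair C (Id C (RX M)) (pr\<^sub>X M) (point_over C R u M \<cdot> Id C M) (Id C M) = ?p"
      unfolding point_over_def by (rule pb_pair_eq[OF stable_pbD(1)[OF pb]]) (use p ob in simp_all)
    show ?thesis
      unfolding is_hat_def using k ob 1 2 by simp
  qed
  let ?s = "mul A (pr\<^sub>R M) (y \<cdot> pr\<^sub>X M)"
  let ?l = "telt M (lft R \<cdot> pr\<^sub>R M) (\<o> M \<cdot> pr\<^sub>X M)" and ?p = "elt C R M (u \<cdot> bang C R M) (Id C M)"
  have p: "?p \<in> Ar C" "Dom C ?p = M" "Cod C ?p = RX M" "pr\<^sub>R M \<cdot> ?p = u \<cdot> bang C R M" "pr\<^sub>X M \<cdot> ?p = Id C M"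
    using elt_typing[of M "u \<cdot> bang C R M" "Id C M"] ob by simp_all
  have s: "?s \<in> Ar C" "Dom C ?s = RX M" "Cod C ?s = tot A" "prj A \<cdot> ?s = pr\<^sub>X M"
    using assms(1) y ob comp_eq_at[OF y(4), of "pr\<^sub>X M"] by (simp_all add: M[symmetric])
  have sl: "T ?s \<cdot> ?l = lft A \<cdot> ?s"
    by (rule smul_linear) (use assms(1) ob y(1-3) in simp_all)
  have "?s \<cdot> ?p = mul A (u \<cdot> bang C R M) y"
    using assms(1) y(1-3) ob p by (simp add: smul_comp)
  then have sp: "?s \<cdot> ?p = y" using smul_unit[OF assms(1) y(1,3)] y(2) by simp
  show ?thesis
    using u hat[OF g gl gy] hat[OF s sl sp] by blast
qed

section \<open>Tangent scalar multiplication is bilinear\<close>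

lemma telt_plus:
  assumes "X \<in> Ob C" "s \<in> Ar C" "v \<in> Ar C" "Dom C s = Dom C v" "s' \<in> Ar C" "v' \<in> Ar C" "Dom C s' = Dom C v'"
    "Dom C v' = Dom C v"
  shows "Cod C s = TO C (tot R) \<Longrightarrow> Cod C v = TO C X \<Longrightarrow> Cod C s' = TO C (tot R) \<Longrightarrow> Cod C v' = TO C X \<Longrightarrow>
      \<p> (tot R) \<cdot> s = \<p> (tot R) \<cdot> s' \<Longrightarrow> \<p> X \<cdot> v = \<p> X \<cdot> v' \<Longrightarrow>
      telt X (s \<oplus>\<^bsub>tb C (tot R)\<^esub> s') (v \<oplus>\<^bsub>tb C X\<^esub> v') = telt X s v \<oplus>\<^bsub>tb C (RX X)\<^esub> telt X s' v'"
    and "Cod C s = TO C (TO C (tot R)) \<Longrightarrow> Cod C v = TO C (TO C X) \<Longrightarrow> Cod C s' = TO C (TO C (tot R)) \<Longrightarrow> Cod C v' = TO C (TO C X) \<Longrightarrow>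
      \<p> (TO C (tot R)) \<cdot> s = \<p> (TO C (tot R)) \<cdot> s' \<Longrightarrow> \<p> (TO C X) \<cdot> v = \<p> (TO C X) \<cdot> v' \<Longrightarrow>
      ttelt X (s \<oplus>\<^bsub>tb C (TO C (tot R))\<^esub> s') (v \<oplus>\<^bsub>tb C (TO C X)\<^esub> v') = ttelt X s v \<oplus>\<^bsub>tb C (TO C (RX X))\<^esub> ttelt X s' v'"
proof -
  show "telt X (s \<oplus>\<^bsub>tb C (tot R)\<^esub> s') (v \<oplus>\<^bsub>tb C X\<^esub> v') = telt X s v \<oplus>\<^bsub>tb C (RX X)\<^esub> telt X s' v'"
    if "Cod C s = TO C (tot R)" "Cod C v = TO C X" "Cod C s' = TO C (tot R)" "Cod C v' = TO C X"
      "\<p> (tot R) \<cdot> s = \<p> (tot R) \<cdot> s'" "\<p> X \<cdot> v = \<p> X \<cdot> v'"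
    by (rule elt_eqI(2))
      (use assms that in \<open>simp_all add: prj_telt(1) T_plus(1)\<close>)
  show "ttelt X (s \<oplus>\<^bsub>tb C (TO C (tot R))\<^esub> s') (v \<oplus>\<^bsub>tb C (TO C X)\<^esub> v') = ttelt X s v \<oplus>\<^bsub>tb C (TO C (RX X))\<^esub> ttelt X s' v'"
    if "Cod C s = TO C (TO C (tot R))" "Cod C v = TO C (TO C X)" "Cod C s' = TO C (TO C (tot R))" "Cod C v' = TO C (TO C X)"
      "\<p> (TO C (tot R)) \<cdot> s = \<p> (TO C (tot R)) \<cdot> s'" "\<p> (TO C X) \<cdot> v = \<p> (TO C X) \<cdot> v'"
    by (rule elt_eqI(3))
      (use assms that in \<open>simp_all add: prj_telt(2) T_plus(1)\<close>)
qed

lemma smul_T_plus_p: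
  assumes "differential_bundle C A"
    and "s \<in> Ar C" "v \<in> Ar C" "Dom C s = Dom C v" "s' \<in> Ar C" "v' \<in> Ar C" "Dom C s' = Dom C v'"
    "Dom C v' = Dom C v" "Cod C s = TO C (tot R)" "Cod C v = TO C (tot A)" "Cod C s' = TO C (tot R)" "Cod C v' = TO C (tot A)"
    "\<p> (tot R) \<cdot> s = \<p> (tot R) \<cdot> s'" "\<p> (tot A) \<cdot> v = \<p> (tot A) \<cdot> v'"
  shows "T_mul A (s \<oplus>\<^bsub>tb C (tot R)\<^esub> s') (v \<oplus>\<^bsub>tb C (tot A)\<^esub> v') =
    T_mul A s v \<oplus>\<^bsub>tb C (tot A)\<^esub> T_mul A s' v'"
proof -
  have ob: "tot A \<in> Ob C" using assms(1) by simp
  show ?thesis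
    unfolding smul_T_eq telt_plus(1)[OF ob assms(2-14)]
    using T_plus(1)[of "sc A" "telt (tot A) s v" "telt (tot A) s' v'" "RX (tot A)"] assms ob
    by (simp add: prj_telt(1))
qed

text \<open>
  \<open>T(\<bullet>)\<close> is linear in \<open>T(R)\<close> for the bundles \<open>T(R)\<close> and \<open>T(q)\<close>, whose lifts are \<open>c T(\<lambda>)\<close>: this is the
  image under \<open>T\<close> of the linearity of \<open>\<bullet>\<close>, composed with \<open>c\<close>.
\<close>

lemma scal_T_linear:
  assumes "differential_bundle C A" "s \<in> Ar C" "v \<in> Ar C" "Cod C s = TO C (tot R)" "Cod C v = TO C (tot A)"
    "Dom C s = Dom C v"
  shows "T (T (sc A)) \<cdot> ttelt (tot A) (\<c> (tot R) \<cdot> (T (lft R) \<cdot> s)) (\<o> (TO C (tot A)) \<cdot> v) =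
    \<c> (tot A) \<cdot> (T (lft A) \<cdot> T_mul A s v)"
proof -
  let ?E = "tot A"
  have ob: "?E \<in> Ob C" using assms(1) by simp
  let ?l = "telt ?E (lft R \<cdot> pr\<^sub>R ?E) (\<o> ?E \<cdot> pr\<^sub>X ?E)" and ?x = "telt ?E s v"
  have l: "?l \<in> Ar C" "Dom C ?l = RX ?E" "Cod C ?l = TO C (RX ?E)"
    using telt_typing[of ?E "lft R \<cdot> pr\<^sub>R ?E" "\<o> ?E \<cdot> pr\<^sub>X ?E"] ob by simp_all
  note x = telt_typing[OF ob assms(2-6)]
  have "elt C R ?E (pr\<^sub>R ?E) (pr\<^sub>X ?E) = Id C (RX ?E)" by (rule elt_eqI(1)) (use ob in simp_all)
  then have "mul A (pr\<^sub>R ?E) (pr\<^sub>X ?E) = sc A" using assms(1) by (simp add: smul_def)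
  then have 1: "T (sc A) \<cdot> ?l = lft A \<cdot> sc A"
    using scal_linear[OF assms(1), of "pr\<^sub>R ?E" "pr\<^sub>X ?E"] ob by (simp add: smul_T_eq)
  let ?h = "ttelt ?E (T (lft R) \<cdot> s) (T (\<o> ?E) \<cdot> v)"
  have h: "?h \<in> Ar C" "Dom C ?h = Dom C v" "Cod C ?h = TO C (TO C (RX ?E))"
    "T (T (pr\<^sub>R ?E)) \<cdot> ?h = T (lft R) \<cdot> s" "T (T (pr\<^sub>X ?E)) \<cdot> ?h = T (\<o> ?E) \<cdot> v"
    using ttelt_typing[of ?E "T (lft R) \<cdot> s" "T (\<o> ?E) \<cdot> v"] ob assms by simp_all
  have "T ?l \<cdot> ?x = ttelt ?E (T (lft R) \<cdot> T (pr\<^sub>R ?E)) (T (\<o> ?E) \<cdot> T (pr\<^sub>X ?E)) \<cdot> ?x"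
    using elt_comp(5)[of ?E "lft R \<cdot> pr\<^sub>R ?E" "\<o> ?E \<cdot> pr\<^sub>X ?E" "Id C (RX ?E)"] ob by simp
  also have "\<dots> = ?h"
    by (subst elt_comp(3)) (use ob x in simp_all)
  finally have 2: "T ?l \<cdot> ?x = ?h" .
  have 3: "T (T (sc A)) \<cdot> ?h = T (lft A) \<cdot> T_mul A s v"
    using T_eq[OF 1, of ?x] l x(1-3) ob assms(1) unfolding 2 smul_T_eq by simp
  have "ttelt ?E (\<c> (tot R) \<cdot> (T (lft R) \<cdot> s)) (\<o> (TO C ?E) \<cdot> v) = \<c> (RX ?E) \<cdot> ?h"
    by (rule elt_eqI(3)) (use h ob assms in simp_all)
  then show ?thesis using h(1-3) ob assms(1) 3 by simp
qed

lemma smul_T_plus_T: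
  assumes "differential_bundle C A"
    and "s\<^sub>1 \<in> Ar C" "s\<^sub>2 \<in> Ar C" "v \<in> Ar C" "Dom C s\<^sub>1 = Dom C v" "Dom C s\<^sub>2 = Dom C v"
    "Cod C s\<^sub>1 = TO C (tot R)" "Cod C s\<^sub>2 = TO C (tot R)" "Cod C v = TO C (tot A)"
  shows "T_mul A (s\<^sub>1 \<oplus>\<^bsub>T_bundle C R\<^esub> s\<^sub>2) v =
    T_mul A s\<^sub>1 v \<oplus>\<^bsub>T_bundle C A\<^esub> T_mul A s\<^sub>2 v"
proof -
  let ?E = "tot A" and ?k = "\<lambda>s. \<c> (tot R) \<cdot> (T (lft R) \<cdot> s)" and ?z = "\<o> (TO C (tot A)) \<cdot> v"
  have ob: "?E \<in> Ob C" using assms(1) by simp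
  have e: "T (prj R) \<cdot> s\<^sub>1 = T (prj R) \<cdot> s\<^sub>2"
    by (rule terminal_eq[where k = 1]) (use assms in simp_all)
  have TR: "additive_bundle C (T_bundle C R)" by simp
  have s: "s\<^sub>1 \<oplus>\<^bsub>T_bundle C R\<^esub> s\<^sub>2 \<in> Ar C" "Dom C (s\<^sub>1 \<oplus>\<^bsub>T_bundle C R\<^esub> s\<^sub>2) = Dom C v" "Cod C (s\<^sub>1 \<oplus>\<^bsub>T_bundle C R\<^esub> s\<^sub>2) = TO C (tot R)"
    using plus_typing[OF TR, of s\<^sub>1 s\<^sub>2] assms e by simp_all
  have "s\<^sub>1 \<in> hom C (Dom C v) (tot (T_bundle C R))" "s\<^sub>2 \<in> hom C (Dom C v) (tot (T_bundle C R))"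
    using assms by auto
  moreover have "prj (T_bundle C R) \<cdot> s\<^sub>1 = prj (T_bundle C R) \<cdot> s\<^sub>2" using e by simp
  ultimately have "(\<c> (tot R) \<cdot> T (lft R)) \<cdot> (s\<^sub>1 \<oplus>\<^bsub>T_bundle C R\<^esub> s\<^sub>2) =
     ((\<c> (tot R) \<cdot> T (lft R)) \<cdot> s\<^sub>1) \<oplus>\<^bsub>tb C (tot (T_bundle C R))\<^esub> ((\<c> (tot R) \<cdot> T (lft R)) \<cdot> s\<^sub>2)"
    using additive_lift_T[OF R_differential] unfolding additive_lift_def by blast
  then have k: "?k (s\<^sub>1 \<oplus>\<^bsub>T_bundle C R\<^esub> s\<^sub>2) = ?k s\<^sub>1 \<oplus>\<^bsub>tb C (TO C (tot R))\<^esub> ?k s\<^sub>2"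
    using assms s by simp
  have z: "?z = ?z \<oplus>\<^bsub>tb C (TO C ?E)\<^esub> ?z"
    using plus_zer(1)[of "tb C (TO C ?E)" ?z v] ob assms by simp
  have L: "ttelt ?E (?k (s\<^sub>1 \<oplus>\<^bsub>T_bundle C R\<^esub> s\<^sub>2)) ?z =
      ttelt ?E (?k s\<^sub>1) ?z \<oplus>\<^bsub>tb C (TO C (RX ?E))\<^esub> ttelt ?E (?k s\<^sub>2) ?z"
    unfolding k by (subst z, rule telt_plus(2)) (use ob assms e in simp_all)
  note lin = scal_T_linear[OF assms(1) _ assms(4) _ assms(9)]
  show ?thesis
  proof (rule linear_additive[OF additive_lift_T[OF assms(1)], where h = "T (sc A)"
      and L\<^sub>1 = "ttelt ?E (?k s\<^sub>1) ?z" and L\<^sub>2 = "ttelt ?E (?k s\<^sub>2) ?z" and Z = "Dom C v"])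
    show "T (T (sc A)) \<cdot> ttelt ?E (?k s\<^sub>1) ?z = (\<c> ?E \<cdot> T (lft A)) \<cdot> T_mul A s\<^sub>1 v"
      using lin[of s\<^sub>1] assms by simp
    show "T (T (sc A)) \<cdot> ttelt ?E (?k s\<^sub>2) ?z = (\<c> ?E \<cdot> T (lft A)) \<cdot> T_mul A s\<^sub>2 v"
      using lin[of s\<^sub>2] assms by simp
    show "T (T (sc A)) \<cdot> (ttelt ?E (?k s\<^sub>1) ?z \<oplus>\<^bsub>tb C (Dom C (T (sc A)))\<^esub> ttelt ?E (?k s\<^sub>2) ?z) =
      (\<c> ?E \<cdot> T (lft A)) \<cdot> T_mul A (s\<^sub>1 \<oplus>\<^bsub>T_bundle C R\<^esub> s\<^sub>2) v"
      using lin[of "s\<^sub>1 \<oplus>\<^bsub>T_bundle C R\<^esub> s\<^sub>2"] L s assms ob by simp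
  qed (use assms ob s e in \<open>simp_all add: prj_telt(2)\<close>)
qed

text \<open>An additive map carries the zero of \<open>T(R)\<close>, an idempotent, to the zero \<open>T(\<xi> q) v\<close>.\<close>

lemma smul_T_zer:
  assumes "differential_bundle C A" "n \<in> Ar C" "v \<in> Ar C" "Cod C n = TO C (base R)" "Cod C v = TO C (tot A)"
    "Dom C n = Dom C v"
  shows "T_mul A (T (zer R) \<cdot> n) v = T (zer A) \<cdot> (T (prj A) \<cdot> v)"
proof -
  have TR: "additive_bundle C (T_bundle C R)" and TA: "additive_bundle C (T_bundle C A)" using assms(1) by simp_all
  let ?s = "T (zer R) \<cdot> n"
  have n: "T (prj R) \<cdot> ?s = n" by (rule terminal_eq[where k = 1]) (use assms in simp_all)
  have "?s \<oplus>\<^bsub>T_bundle C R\<^esub> (zer (T_bundle C R) \<cdot> n) = ?s"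
    by (rule plus_zer(1)[OF TR]) (use assms n in simp_all)
  then have "?s \<oplus>\<^bsub>T_bundle C R\<^esub> ?s = ?s" by simp
  then have "T_mul A ?s v \<oplus>\<^bsub>T_bundle C A\<^esub> T_mul A ?s v = T_mul A ?s v"
    using smul_T_plus_T[OF assms(1), of ?s ?s v] assms by simp
  from idempotent_zer[OF TA _ _ this] show ?thesis using assms by simp
qed

text \<open>
  By naturality of \<open>+\<^sub>p\<close>, the arrow \<open>T(\<bullet>)\<close> preserves \<open>+\<^sub>p\<close>; it is applied to the two summands of
  \<open>(\<lambda> b, v) = (\<lambda> b, 0 p v) +\<^sub>p (0 0, v)\<close>.
\<close>

lemma smul_T_lft:
  assumes "differential_bundle C A" "b \<in> Ar C" "v \<in> Ar C" "Cod C b = tot R" "Cod C v = TO C (tot A)"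
    "Dom C b = Dom C v"
  shows "T_mul A (lft R \<cdot> b) v =
    (lft A \<cdot> mul A b (\<p> (tot A) \<cdot> v)) \<oplus>\<^bsub>tb C (tot A)\<^esub> (T (zer A) \<cdot> (T (prj A) \<cdot> v))"
proof -
  let ?E = "tot A" and ?s = "T (zer R) \<cdot> (\<o> (base R) \<cdot> (prj R \<cdot> b))"
  have ob: "?E \<in> Ob C" "tot R \<in> Ob C" "base R \<in> Ob C" using assms(1) by simp_all
  have s: "lft R \<cdot> b = (lft R \<cdot> b) \<oplus>\<^bsub>tb C (tot R)\<^esub> ?s"
    using plus_zer(1)[of "tb C (tot R)" "lft R \<cdot> b" "zer R \<cdot> (prj R \<cdot> b)"] assms ob by simp
  have v: "v = (\<o> ?E \<cdot> (\<p> ?E \<cdot> v)) \<oplus>\<^bsub>tb C ?E\<^esub> v"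
    using plus_zer(2)[of "tb C ?E" v "\<p> ?E \<cdot> v"] assms ob by simp
  have "T_mul A (lft R \<cdot> b) v =
      T_mul A ((lft R \<cdot> b) \<oplus>\<^bsub>tb C (tot R)\<^esub> ?s) ((\<o> ?E \<cdot> (\<p> ?E \<cdot> v)) \<oplus>\<^bsub>tb C ?E\<^esub> v)"
    unfolding s[symmetric] v[symmetric] ..
  also have "\<dots> = T_mul A (lft R \<cdot> b) (\<o> ?E \<cdot> (\<p> ?E \<cdot> v)) \<oplus>\<^bsub>tb C ?E\<^esub> T_mul A ?s v"
    by (rule smul_T_plus_p) (use assms ob in simp_all)
  also have "T_mul A (lft R \<cdot> b) (\<o> ?E \<cdot> (\<p> ?E \<cdot> v)) =
      lft A \<cdot> mul A b (\<p> ?E \<cdot> v)"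
    by (rule scal_linear) (use assms ob in simp_all)
  also have "T_mul A ?s v = T (zer A) \<cdot> (T (prj A) \<cdot> v)"
    by (rule smul_T_zer) (use assms ob in simp_all)
  finally show ?thesis .
qed

text \<open>
  Over a terminal object the two arrows whose equaliser is \<open>\<mu>\<close> coincide, so \<open>\<mu>\<close> is invertible.  The
  first component of \<open>\<mu>\<^sup>-\<^sup>1 s\<close> is \<open>p s\<close>, and the second one is \<open>phat s\<close>.
\<close>

lemma phat_decomposition:
  assumes "s \<in> Ar C" "Cod C s = TO C (tot R)"
  shows "phat C R \<in> Ar C" "Dom C (phat C R) = TO C (tot R)" "Cod C (phat C R) = tot R"
    "s = (\<o> (tot R) \<cdot> (\<p> (tot R) \<cdot> s)) \<oplus>\<^bsub>T_bundle C R\<^esub> (lft R \<cdot> (phat C R \<cdot> s))"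
proof -
  note d = R_differential
  let ?I = "Id C (TO C (tot R))" and ?p = "\<p> (tot R)" and ?z = "\<o> (tot R)"
  note eq = equaliserD[OF stable_equaliserD(1)[OF differential_laws(8)[OF d]]]
  have "T (prj R) \<cdot> ?I = (\<o> (base R) \<cdot> prj R \<cdot> ?p) \<cdot> ?I"
    by (rule terminal_eq[where k = 1]) simp_all
  then obtain i where i: "i \<in> Ar C" "Dom C i = TO C (tot R)" "Cod C i = tot2 R" "mu C R \<cdot> i = ?I"
    using eq(9)[of ?I] by auto
  have im: "i \<cdot> mu C R = Id C (tot2 R)"
  proof (rule eq(10))
    show "mu C R \<cdot> (i \<cdot> mu C R) = mu C R \<cdot> Id C (tot2 R)"
      using comp_eq_at[OF i(4), of "mu C R"] i(1-3) by simp
  qed (use i in simp_all)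
  have "(THE j. j \<in> hom C (TO C (tot R)) (tot2 R) \<and> j \<cdot> mu C R = Id C (tot2 R) \<and> mu C R \<cdot> j = ?I) = i"
  proof (rule the_equality)
    show "i \<in> hom C (TO C (tot R)) (tot2 R) \<and> i \<cdot> mu C R = Id C (tot2 R) \<and> mu C R \<cdot> i = ?I"
      using i im by simp
    fix j assume j: "j \<in> hom C (TO C (tot R)) (tot2 R) \<and> j \<cdot> mu C R = Id C (tot2 R) \<and> mu C R \<cdot> j = ?I"
    show "j = i" by (rule eq(10)) (use j i in simp_all)
  qed
  then have ph: "phat C R = snd2 R \<cdot> i" by (simp add: phat_def)
  then show "phat C R \<in> Ar C" "Dom C (phat C R) = TO C (tot R)" "Cod C (phat C R) = tot R"
    using i by simp_all
  let ?a = "fst2 R \<cdot> (i \<cdot> s)" and ?b = "snd2 R \<cdot> (i \<cdot> s)"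
  have e: "prj R \<cdot> ?a = prj R \<cdot> ?b"
    by (rule terminal_eq[where k = 0]) (use i assms in simp_all)
  have "mu C R \<cdot> (i \<cdot> s) = s" using comp_eq_at[OF i(4), of s] i(1-3) assms by simp
  then have s: "s = (?z \<cdot> ?a) \<oplus>\<^bsub>T_bundle C R\<^esub> (lft R \<cdot> ?b)"
    using mu_comp[OF d, of "i \<cdot> s"] i assms by simp
  have "?p \<cdot> s = (?p \<cdot> (?z \<cdot> ?a)) \<oplus>\<^bsub>R\<^esub> (?p \<cdot> (lft R \<cdot> ?b))"
    by (subst s, rule prj_plus_T(1)) (use i assms e in simp_all)
  also have "\<dots> = ?a"
    using plus_zer(1)[of R ?a "prj R \<cdot> ?b"] e i assms by simp
  finally have "?p \<cdot> s = ?a" .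
  then show "s = (?z \<cdot> (?p \<cdot> s)) \<oplus>\<^bsub>T_bundle C R\<^esub> (lft R \<cdot> (phat C R \<cdot> s))"
    using s i assms by (simp add: ph)
qed

end

section \<open>Involution algebroids\<close>

locale algebroid_setting = unit_setting C R u
  for C :: "('o, 'm, 'z) tangent_scheme" (structure) and R :: "('o, 'm) bundle_data" and u :: 'm +
  fixes A :: "('o, 'm) bundle_data" and \<rho> \<pi>\<^sub>0 \<pi>\<^sub>1 \<alpha> :: 'm and P :: 'o
  assumes algebroid: "involution_algebroid C A \<rho> P \<pi>\<^sub>0 \<pi>\<^sub>1 \<alpha>"
begin

abbreviation M where "M \<equiv> base A"
abbreviation E where "E \<equiv> tot A"
abbreviation \<pi> where "\<pi> \<equiv> prj A"
abbreviation T\<^sub>A where "T\<^sub>A \<equiv> T_bundle C A"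

lemma algebroid_laws:
  shows "anchored_bundle C A \<rho>"
    "stable_pullback C \<rho> (T (prj A)) P \<pi>\<^sub>0 \<pi>\<^sub>1"
    "\<alpha> \<in> hom C P (TO C (tot A))"
    "linear_mor C \<pi>\<^sub>0 (pair C (T \<pi>\<^sub>0) (T \<pi>\<^sub>1) (\<o> (tot A) \<cdot> \<pi>\<^sub>0) ((\<c> (tot A) \<cdot> T (lft A)) \<cdot> \<pi>\<^sub>1))
       (\<p> (tot A)) (\<l> (tot A)) \<alpha> (Id C (tot A))"
    "linear_mor C
       (\<p> (tot A) \<cdot> \<pi>\<^sub>1) (pair C (T \<pi>\<^sub>0) (T \<pi>\<^sub>1) (lft A \<cdot> \<pi>\<^sub>0) (\<l> (tot A) \<cdot> \<pi>\<^sub>1))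
       (T (prj A)) (\<c> (tot A) \<cdot> T (lft A)) \<alpha> \<rho>"
    "\<alpha> \<cdot> pair C \<pi>\<^sub>0 \<pi>\<^sub>1 (zer A \<cdot> prj A) (lft A) = lft A"
  using algebroid unfolding involution_algebroid_def by - (elim conjE, assumption)+

lemma anchor_laws:
  shows A_differential [simp]: "differential_bundle C A"
    and "linear_mor C (prj A) (lft A) (\<p> M) (\<l> M) \<rho> (Id C M)"
  using algebroid_laws(1) unfolding anchored_bundle_def by blast+

lemma ob [simp]: "M \<in> Ob C" "E \<in> Ob C"
  by simp_all

lemma anchor_typing [simp]: "\<rho> \<in> Ar C" "Dom C \<rho> = E" "Cod C \<rho> = TO C M"
  using anchor_laws(2) unfolding linear_mor_def bundle_mor_def by simp_all

lemma anchor_simps [simp]: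
  assumes "x \<in> Ar C" "Cod C x = E"
  shows "\<p> M \<cdot> (\<rho> \<cdot> x) = \<pi> \<cdot> x" "T \<rho> \<cdot> (lft A \<cdot> x) = \<l> M \<cdot> (\<rho> \<cdot> x)"
proof -
  have "\<p> M \<cdot> \<rho> = \<pi>" "T \<rho> \<cdot> lft A = \<l> M \<cdot> \<rho>"
    using anchor_laws(2) unfolding linear_mor_def bundle_mor_def by simp_all
  from comp_eq_at[OF this(1), of x] comp_eq_comp_at[OF this(2), of x]
  show "\<p> M \<cdot> (\<rho> \<cdot> x) = \<pi> \<cdot> x" "T \<rho> \<cdot> (lft A \<cdot> x) = \<l> M \<cdot> (\<rho> \<cdot> x)"
    using assms by simp_all
qed

lemma anchor_plus:
  assumes "x \<in> Ar C" "y \<in> Ar C" "Cod C x = E" "Cod C y = E" "Dom C x = Dom C y" "\<pi> \<cdot> x = \<pi> \<cdot> y"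
  shows "\<rho> \<cdot> (x \<oplus>\<^bsub>A\<^esub> y) = (\<rho> \<cdot> x) \<oplus>\<^bsub>tb C M\<^esub> (\<rho> \<cdot> y)"
proof (rule linear_additive[OF additive_lift_tb[OF ob(1)], where h = \<rho> and L\<^sub>1 = "lft A \<cdot> x"
    and L\<^sub>2 = "lft A \<cdot> y" and Z = "Dom C y"])
  show "T \<rho> \<cdot> ((lft A \<cdot> x) \<oplus>\<^bsub>tb C (Dom C \<rho>)\<^esub> (lft A \<cdot> y)) = \<l> M \<cdot> (\<rho> \<cdot> (x \<oplus>\<^bsub>A\<^esub> y))"
    using lft_plus[of A x y] assms by (simp flip: lft_plus)
qed (use assms in simp_all)

lemma anchor_zer:
  assumes x: "x \<in> Ar C" "Cod C x = M"
  shows "\<rho> \<cdot> (zer A \<cdot> x) = \<o> M \<cdot> x"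
proof -
  have "zer A \<cdot> x \<oplus>\<^bsub>A\<^esub> zer A \<cdot> x = zer A \<cdot> x"
    using plus_zer(1)[of A "zer A \<cdot> x" x] x by simp
  then have "\<rho> \<cdot> (zer A \<cdot> x) \<oplus>\<^bsub>tb C M\<^esub> \<rho> \<cdot> (zer A \<cdot> x) = \<rho> \<cdot> (zer A \<cdot> x)"
    using anchor_plus[of "zer A \<cdot> x" "zer A \<cdot> x"] x by simp
  from idempotent_zer[OF _ _ _ this] show ?thesis using x by simp
qed

text \<open>The elements \<open>(v, w)\<close> of the prolongation \<open>P\<close> and of \<open>T(P)\<close>, given by their two components.\<close>

definition pr :: "'m \<Rightarrow> 'm \<Rightarrow> 'm" where "pr v w = pair C \<pi>\<^sub>0 \<pi>\<^sub>1 v w"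
definition tpr :: "'m \<Rightarrow> 'm \<Rightarrow> 'm" where "tpr v w = pair C (T \<pi>\<^sub>0) (T \<pi>\<^sub>1) v w"

lemmas P_pb = stable_pbD(1,2)[OF algebroid_laws(2)]

lemma P_typing [simp]:
  "\<pi>\<^sub>0 \<in> Ar C" "\<pi>\<^sub>1 \<in> Ar C" "Dom C \<pi>\<^sub>0 = P" "Dom C \<pi>\<^sub>1 = P" "Cod C \<pi>\<^sub>0 = E" "Cod C \<pi>\<^sub>1 = TO C E"
  "\<alpha> \<in> Ar C" "Dom C \<alpha> = P" "Cod C \<alpha> = TO C E"
  using pb_typing[OF P_pb(1)] algebroid_laws(3) by simp_all

lemma P_Ob [simp]: "P \<in> Ob C"
  using Dom_Ob[of \<pi>\<^sub>0] by simp

lemma pr_typing [simp]: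
  assumes "v \<in> Ar C" "w \<in> Ar C" "Cod C v = E" "Cod C w = TO C E" "Dom C v = Dom C w" "\<rho> \<cdot> v = T \<pi> \<cdot> w"
  shows "pr v w \<in> Ar C" "Dom C (pr v w) = Dom C w" "Cod C (pr v w) = P" "\<pi>\<^sub>0 \<cdot> pr v w = v" "\<pi>\<^sub>1 \<cdot> pr v w = w"
  using pb_pair[OF P_pb(1), of v w] assms by (simp_all add: pr_def)

lemma tpr_typing [simp]:
  assumes "v \<in> Ar C" "w \<in> Ar C" "Cod C v = TO C E" "Cod C w = TO C (TO C E)" "Dom C v = Dom C w"
    "T \<rho> \<cdot> v = T (T \<pi>) \<cdot> w"
  shows "tpr v w \<in> Ar C" "Dom C (tpr v w) = Dom C w" "Cod C (tpr v w) = TO C P"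
    "T \<pi>\<^sub>0 \<cdot> tpr v w = v" "T \<pi>\<^sub>1 \<cdot> tpr v w = w"
  using pb_pair[OF P_pb(2), of v w] assms by (simp_all add: tpr_def)

lemma pr_eqI:
  assumes "h \<in> Ar C"
  shows "Cod C h = P \<Longrightarrow> \<pi>\<^sub>0 \<cdot> h = v \<Longrightarrow> \<pi>\<^sub>1 \<cdot> h = w \<Longrightarrow> pr v w = h"
    and "Cod C h = TO C P \<Longrightarrow> T \<pi>\<^sub>0 \<cdot> h = v' \<Longrightarrow> T \<pi>\<^sub>1 \<cdot> h = w' \<Longrightarrow> tpr v' w' = h"
  using pb_pair_eq[OF P_pb(1) assms] pb_pair_eq[OF P_pb(2) assms] unfolding pr_def tpr_def by blast+

lemma pr_comp:
  assumes "v \<in> Ar C" "w \<in> Ar C" "Cod C v = E" "Cod C w = TO C E" "Dom C v = Dom C w" "\<rho> \<cdot> v = T \<pi> \<cdot> w"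
    "z \<in> Ar C" "Cod C z = Dom C w"
  shows "pr v w \<cdot> z = pr (v \<cdot> z) (w \<cdot> z)"
  unfolding pr_def by (rule pair_comp[OF P_pb(1)]) (use assms in simp_all)

lemma T_pr:
  assumes "v \<in> Ar C" "w \<in> Ar C" "Cod C v = E" "Cod C w = TO C E" "Dom C v = Dom C w" "\<rho> \<cdot> v = T \<pi> \<cdot> w"
    "L \<in> Ar C" "Cod C L = TO C (Dom C w)"
  shows "T (pr v w) \<cdot> L = tpr (T v \<cdot> L) (T w \<cdot> L)"
proof -
  note t = pr_typing[OF assms(1-6)]
  show ?thesis
    by (rule pr_eqI(2)[symmetric])
      (use t(1-3) assms(1-5,7-) T_eq[OF t(4), of L] T_eq[OF t(5), of L] in simp_all)
qed

lemma prj_tpr: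
  assumes "v \<in> Ar C" "w \<in> Ar C" "Cod C v = TO C E" "Cod C w = TO C (TO C E)" "Dom C v = Dom C w"
    "T \<rho> \<cdot> v = T (T \<pi>) \<cdot> w"
  shows "\<p> P \<cdot> tpr v w = pr (\<p> E \<cdot> v) (\<p> (TO C E) \<cdot> w)"
proof (rule pr_eqI(1)[symmetric])
  note t = tpr_typing[OF assms]
  have "\<p> E \<cdot> (T \<pi>\<^sub>0 \<cdot> tpr v w) = \<pi>\<^sub>0 \<cdot> (\<p> P \<cdot> tpr v w)"
    "\<p> (TO C E) \<cdot> (T \<pi>\<^sub>1 \<cdot> tpr v w) = \<pi>\<^sub>1 \<cdot> (\<p> P \<cdot> tpr v w)"
    using t(1-3) by simp_all
  then show "\<pi>\<^sub>0 \<cdot> (\<p> P \<cdot> tpr v w) = \<p> E \<cdot> v"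
    "\<pi>\<^sub>1 \<cdot> (\<p> P \<cdot> tpr v w) = \<p> (TO C E) \<cdot> w" using t(4,5) by simp_all
qed (use tpr_typing[OF assms] in simp_all)

lemma tpr_plus:
  assumes "v \<in> Ar C" "w \<in> Ar C" "Cod C v = TO C E" "Cod C w = TO C (TO C E)" "Dom C v = Dom C w"
    "T \<rho> \<cdot> v = T (T \<pi>) \<cdot> w"
    and "v' \<in> Ar C" "w' \<in> Ar C" "Cod C v' = TO C E" "Cod C w' = TO C (TO C E)" "Dom C v' = Dom C w'"
    "T \<rho> \<cdot> v' = T (T \<pi>) \<cdot> w'" "Dom C w' = Dom C w"
    and "\<p> E \<cdot> v = \<p> E \<cdot> v'" "\<p> (TO C E) \<cdot> w = \<p> (TO C E) \<cdot> w'"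
  shows "tpr (v \<oplus>\<^bsub>tb C E\<^esub> v') (w \<oplus>\<^bsub>tb C (TO C E)\<^esub> w') = tpr v w \<oplus>\<^bsub>tb C P\<^esub> tpr v' w'"
proof -
  note t = tpr_typing[OF assms(1-6)] tpr_typing[OF assms(7-12)]
  have e: "\<p> P \<cdot> tpr v w = \<p> P \<cdot> tpr v' w'"
    unfolding prj_tpr[OF assms(1-6)] prj_tpr[OF assms(7-12)] assms(14,15) ..
  show ?thesis
    by (rule pr_eqI(2)) (use t e assms(13) in \<open>simp_all add: T_plus(1)\<close>)
qed

text \<open>The element \<open>\<alpha>(v, w)\<close> of \<open>T(A)\<close>.\<close>

definition al :: "'m \<Rightarrow> 'm \<Rightarrow> 'm" where "al v w = \<alpha> \<cdot> pr v w"

lemma al_simps [simp]: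
  assumes "v \<in> Ar C" "w \<in> Ar C" "Cod C v = E" "Cod C w = TO C E" "Dom C v = Dom C w" "\<rho> \<cdot> v = T \<pi> \<cdot> w"
  shows "al v w \<in> Ar C" "Dom C (al v w) = Dom C w" "Cod C (al v w) = TO C E"
    "\<p> E \<cdot> al v w = v" "T \<pi> \<cdot> al v w = \<rho> \<cdot> (\<p> E \<cdot> w)"
proof -
  note t = pr_typing[OF assms]
  show "al v w \<in> Ar C" "Dom C (al v w) = Dom C w" "Cod C (al v w) = TO C E"
    using t by (simp_all add: al_def)
  have 1: "\<p> E \<cdot> \<alpha> = Id C E \<cdot> \<pi>\<^sub>0" and 2: "T \<pi> \<cdot> \<alpha> = \<rho> \<cdot> (\<p> E \<cdot> \<pi>\<^sub>1)"
    using algebroid_laws(4,5) unfolding linear_mor_def bundle_mor_def by blast+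
  show "\<p> E \<cdot> al v w = v"
    using comp_eq_comp_at[OF 1, of "pr v w"] t assms by (simp add: al_def)
  show "T \<pi> \<cdot> al v w = \<rho> \<cdot> (\<p> E \<cdot> w)"
    using comp_eq_comp_at[OF 2, of "pr v w"] t assms by (simp add: al_def)
qed

lemma al_comp:
  assumes "v \<in> Ar C" "w \<in> Ar C" "Cod C v = E" "Cod C w = TO C E" "Dom C v = Dom C w" "\<rho> \<cdot> v = T \<pi> \<cdot> w"
    "z \<in> Ar C" "Cod C z = Dom C w"
  shows "al v w \<cdot> z = al (v \<cdot> z) (w \<cdot> z)"
  using assms by (simp add: al_def pr_comp)

text \<open>The two lifts of an element \<open>(v, w)\<close> of \<open>P\<close> are elements of \<open>T(P)\<close>.\<close>

lemma T_lift_condition: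
  assumes "v \<in> Ar C" "w \<in> Ar C" "Cod C v = E" "Cod C w = TO C E" "Dom C v = Dom C w" "\<rho> \<cdot> v = T \<pi> \<cdot> w"
  shows "T \<rho> \<cdot> (\<o> E \<cdot> v) = T (T \<pi>) \<cdot> (\<c> E \<cdot> (T (lft A) \<cdot> w))"
    "T \<rho> \<cdot> (lft A \<cdot> v) = T (T \<pi>) \<cdot> (\<l> E \<cdot> w)"
  using assms by simp_all

text \<open>The two linearity properties of \<open>\<alpha>\<close>, for the lifts \<open>0 \<times> c T(\<lambda>)\<close> and \<open>\<lambda> \<times> l\<close> of \<open>P\<close>.\<close>

lemma al_linear:
  assumes "v \<in> Ar C" "w \<in> Ar C" "Cod C v = E" "Cod C w = TO C E" "Dom C v = Dom C w" "\<rho> \<cdot> v = T \<pi> \<cdot> w"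
  shows "T \<alpha> \<cdot> tpr (\<o> E \<cdot> v) (\<c> E \<cdot> (T (lft A) \<cdot> w)) = \<l> E \<cdot> al v w"
    "T \<alpha> \<cdot> tpr (lft A \<cdot> v) (\<l> E \<cdot> w) = \<c> E \<cdot> (T (lft A) \<cdot> al v w)"
proof -
  note t = pr_typing[OF assms]
  have c: "\<rho> \<cdot> \<pi>\<^sub>0 = T \<pi> \<cdot> \<pi>\<^sub>1" using pb_typing(10)[OF P_pb(1)] .
  let ?k = "tpr (\<o> E \<cdot> \<pi>\<^sub>0) (\<c> E \<cdot> (T (lft A) \<cdot> \<pi>\<^sub>1))" and ?k' = "tpr (lft A \<cdot> \<pi>\<^sub>0) (\<l> E \<cdot> \<pi>\<^sub>1)"
  have 1: "T \<alpha> \<cdot> ?k = \<l> E \<cdot> \<alpha>" and 2: "T \<alpha> \<cdot> ?k' = (\<c> E \<cdot> T (lft A)) \<cdot> \<alpha>"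
    using algebroid_laws(4,5) unfolding linear_mor_def tpr_def by simp_all
  have k: "?k \<in> Ar C" "Dom C ?k = P" "Cod C ?k = TO C P" "T \<pi>\<^sub>0 \<cdot> ?k = \<o> E \<cdot> \<pi>\<^sub>0" "T \<pi>\<^sub>1 \<cdot> ?k = \<c> E \<cdot> (T (lft A) \<cdot> \<pi>\<^sub>1)"
    using tpr_typing[of "\<o> E \<cdot> \<pi>\<^sub>0" "\<c> E \<cdot> (T (lft A) \<cdot> \<pi>\<^sub>1)"] c by simp_all
  have k': "?k' \<in> Ar C" "Dom C ?k' = P" "Cod C ?k' = TO C P" "T \<pi>\<^sub>0 \<cdot> ?k' = lft A \<cdot> \<pi>\<^sub>0" "T \<pi>\<^sub>1 \<cdot> ?k' = \<l> E \<cdot> \<pi>\<^sub>1"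
    using tpr_typing[of "lft A \<cdot> \<pi>\<^sub>0" "\<l> E \<cdot> \<pi>\<^sub>1"] c by simp_all
  have "tpr (\<o> E \<cdot> v) (\<c> E \<cdot> (T (lft A) \<cdot> w)) = ?k \<cdot> pr v w"
    by (rule pr_eqI(2))
      (use t assms(1-5) k(1-3) comp_eq_comp_at[OF k(4), of "pr v w"] comp_eq_at[OF k(5), of "pr v w"] in simp_all)
  then show "T \<alpha> \<cdot> tpr (\<o> E \<cdot> v) (\<c> E \<cdot> (T (lft A) \<cdot> w)) = \<l> E \<cdot> al v w"
    using comp_eq_comp_at[OF 1, of "pr v w"] k(1-3) t(1-3) assms(5) by (simp add: al_def)
  have "tpr (lft A \<cdot> v) (\<l> E \<cdot> w) = ?k' \<cdot> pr v w"
    by (rule pr_eqI(2))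
      (use t assms(1-5) k'(1-3) comp_eq_comp_at[OF k'(4), of "pr v w"] comp_eq_comp_at[OF k'(5), of "pr v w"] in simp_all)
  then show "T \<alpha> \<cdot> tpr (lft A \<cdot> v) (\<l> E \<cdot> w) = \<c> E \<cdot> (T (lft A) \<cdot> al v w)"
    using comp_eq_comp_at[OF 2, of "pr v w"] k'(1-3) t(1-3) assms(5) by (simp add: al_def)
qed

lemma al_plus_T:
  assumes "v \<in> Ar C" "w \<in> Ar C" "w' \<in> Ar C" "Cod C v = E" "Cod C w = TO C E" "Cod C w' = TO C E"
    "Dom C v = Dom C w" "Dom C w' = Dom C w" "\<rho> \<cdot> v = T \<pi> \<cdot> w" "\<rho> \<cdot> v = T \<pi> \<cdot> w'"
  shows "al v (w \<oplus>\<^bsub>T\<^sub>A\<^esub> w') = al v w \<oplus>\<^bsub>tb C E\<^esub> al v w'"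
proof -
  let ?k = "\<lambda>w. \<c> E \<cdot> (T (lft A) \<cdot> w)" and ?z = "\<o> E \<cdot> v"
  have TB: "additive_bundle C T\<^sub>A" by simp
  have e: "T \<pi> \<cdot> w = T \<pi> \<cdot> w'" using assms(9,10) by simp
  have s: "w \<oplus>\<^bsub>T\<^sub>A\<^esub> w' \<in> Ar C" "Dom C (w \<oplus>\<^bsub>T\<^sub>A\<^esub> w') = Dom C w" "Cod C (w \<oplus>\<^bsub>T\<^sub>A\<^esub> w') = TO C E"
    "\<rho> \<cdot> v = T \<pi> \<cdot> (w \<oplus>\<^bsub>T\<^sub>A\<^esub> w')"
    using plus_typing[OF TB, of w w'] assms(2-8,10) e by simp_all
  have "w \<in> hom C (Dom C v) (tot T\<^sub>A)" "w' \<in> hom C (Dom C v) (tot T\<^sub>A)" "prj T\<^sub>A \<cdot> w = prj T\<^sub>A \<cdot> w'"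
    using assms(1-8) e by simp_all
  then have "(\<c> E \<cdot> T (lft A)) \<cdot> (w \<oplus>\<^bsub>T\<^sub>A\<^esub> w') =
     ((\<c> E \<cdot> T (lft A)) \<cdot> w) \<oplus>\<^bsub>tb C (tot T\<^sub>A)\<^esub> ((\<c> E \<cdot> T (lft A)) \<cdot> w')"
    using additive_lift_T[OF A_differential] unfolding additive_lift_def by blast
  then have k: "?k (w \<oplus>\<^bsub>T\<^sub>A\<^esub> w') = ?k w \<oplus>\<^bsub>tb C (TO C E)\<^esub> ?k w'"
    using assms(1-8) s(1-3) by simp
  have z: "?z = ?z \<oplus>\<^bsub>tb C E\<^esub> ?z"
    using plus_zer(1)[of "tb C E" ?z v] assms by simp
  note c = T_lift_condition(1)[OF assms(1,2,4,5,7,9)] T_lift_condition(1)[OF assms(1,3,4,6) _ assms(10)]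
  have L: "tpr ?z (?k (w \<oplus>\<^bsub>T\<^sub>A\<^esub> w')) = tpr ?z (?k w) \<oplus>\<^bsub>tb C P\<^esub> tpr ?z (?k w')"
    unfolding k by (subst z, rule tpr_plus) (use c e assms(1-8) in \<open>simp_all del: tangent_naturality(2,4)\<close>)
  have pe: "\<p> P \<cdot> tpr ?z (?k w) = \<p> P \<cdot> tpr ?z (?k w')"
    using prj_tpr[of ?z "?k w"] prj_tpr[of ?z "?k w'"] c e assms(1-8) by simp
  show ?thesis
  proof (rule linear_additive[OF additive_lift_tb[OF ob(2)], where h = \<alpha> and L\<^sub>1 = "tpr ?z (?k w)"
      and L\<^sub>2 = "tpr ?z (?k w')" and Z = "Dom C w"])
    show "T \<alpha> \<cdot> (tpr ?z (?k w) \<oplus>\<^bsub>tb C (Dom C \<alpha>)\<^esub> tpr ?z (?k w')) = \<l> E \<cdot> al v (w \<oplus>\<^bsub>T\<^sub>A\<^esub> w')"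
      using al_linear(1)[of v "w \<oplus>\<^bsub>T\<^sub>A\<^esub> w'"] s assms(1-7) L by simp
    show "T \<alpha> \<cdot> tpr ?z (?k w) = \<l> E \<cdot> al v w" "T \<alpha> \<cdot> tpr ?z (?k w') = \<l> E \<cdot> al v w'"
      using al_linear(1)[of v w] al_linear(1)[of v w'] assms by simp_all
  qed (use s assms(1-10) c pe in simp_all)
qed

lemma al_plus_p:
  assumes "v \<in> Ar C" "w \<in> Ar C" "Cod C v = E" "Cod C w = TO C E" "Dom C v = Dom C w" "\<rho> \<cdot> v = T \<pi> \<cdot> w"
    and "v' \<in> Ar C" "w' \<in> Ar C" "Cod C v' = E" "Cod C w' = TO C E" "Dom C v' = Dom C w'" "\<rho> \<cdot> v' = T \<pi> \<cdot> w'"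
    and "Dom C w' = Dom C w" "\<pi> \<cdot> v = \<pi> \<cdot> v'" "\<p> E \<cdot> w = \<p> E \<cdot> w'"
  shows "al (v \<oplus>\<^bsub>A\<^esub> v') (w \<oplus>\<^bsub>tb C E\<^esub> w') = al v w \<oplus>\<^bsub>T\<^sub>A\<^esub> al v' w'"
proof -
  let ?L = "\<lambda>v w. tpr (lft A \<cdot> v) (\<l> E \<cdot> w)"
  have c: "\<rho> \<cdot> (v \<oplus>\<^bsub>A\<^esub> v') = T \<pi> \<cdot> (w \<oplus>\<^bsub>tb C E\<^esub> w')"
    using anchor_plus[of v v'] T_plus(1)[of \<pi> w w' E] assms by simp
  have L: "?L (v \<oplus>\<^bsub>A\<^esub> v') (w \<oplus>\<^bsub>tb C E\<^esub> w') = ?L v w \<oplus>\<^bsub>tb C P\<^esub> ?L v' w'"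
    using lft_plus[of A v v'] lift_plus(3)[of E w w'] tpr_plus[of "lft A \<cdot> v" "\<l> E \<cdot> w" "lft A \<cdot> v'" "\<l> E \<cdot> w'"]
      assms by simp
  have pe: "\<p> P \<cdot> ?L v w = \<p> P \<cdot> ?L v' w'"
    using prj_tpr[of "lft A \<cdot> v" "\<l> E \<cdot> w"] prj_tpr[of "lft A \<cdot> v'" "\<l> E \<cdot> w'"] assms by simp
  show ?thesis
  proof (rule linear_additive[OF additive_lift_T[OF A_differential], where h = \<alpha> and L\<^sub>1 = "?L v w"
      and L\<^sub>2 = "?L v' w'" and Z = "Dom C w"])
    show "T \<alpha> \<cdot> (?L v w \<oplus>\<^bsub>tb C (Dom C \<alpha>)\<^esub> ?L v' w') = (\<c> E \<cdot> T (lft A)) \<cdot> al (v \<oplus>\<^bsub>A\<^esub> v') (w \<oplus>\<^bsub>tb C E\<^esub> w')"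
      using al_linear(2)[of "v \<oplus>\<^bsub>A\<^esub> v'" "w \<oplus>\<^bsub>tb C E\<^esub> w'"] c assms L by simp
    show "T \<alpha> \<cdot> ?L v w = (\<c> E \<cdot> T (lft A)) \<cdot> al v w" "T \<alpha> \<cdot> ?L v' w' = (\<c> E \<cdot> T (lft A)) \<cdot> al v' w'"
      using al_linear(2)[of v w] al_linear(2)[of v' w'] assms by simp_all
  qed (use assms c pe in simp_all)
qed

lemma al_zer:
  assumes "x \<in> Ar C" "Cod C x = E"
  shows "al x (T (zer A) \<cdot> (\<rho> \<cdot> x)) = \<o> E \<cdot> x"
proof -
  let ?w = "T (zer A) \<cdot> (\<rho> \<cdot> x)"
  have c: "\<rho> \<cdot> x = T \<pi> \<cdot> ?w"
    using T_eq[OF additive_prj(1)[of A], of "\<rho> \<cdot> x"] assms by simp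
  have "?w \<oplus>\<^bsub>T\<^sub>A\<^esub> (zer T\<^sub>A \<cdot> (\<rho> \<cdot> x)) = ?w"
    by (rule plus_zer(1)) (use assms c in simp_all)
  then have "al x ?w \<oplus>\<^bsub>tb C E\<^esub> al x ?w = al x ?w"
    using al_plus_T[of x ?w ?w] assms c by simp
  from idempotent_zer[OF _ _ _ this] show ?thesis using assms c by simp
qed

lemma al_lft:
  assumes "e \<in> Ar C" "Cod C e = E"
  shows "al (zer A \<cdot> (\<pi> \<cdot> e)) (lft A \<cdot> e) = lft A \<cdot> e"
proof -
  have z1: "\<rho> \<cdot> (zer A \<cdot> \<pi>) = \<o> M \<cdot> \<pi>" using anchor_zer[of \<pi>] by simp
  have l1: "T \<pi> \<cdot> lft A = \<o> M \<cdot> \<pi>" using lft_simps(2)[of A "Id C E"] by simp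
  have "al (zer A \<cdot> \<pi>) (lft A) = lft A"
    using algebroid_laws(6) by (simp add: al_def pr_def)
  moreover have "al (zer A \<cdot> \<pi>) (lft A) \<cdot> e = al ((zer A \<cdot> \<pi>) \<cdot> e) (lft A \<cdot> e)"
    by (rule al_comp) (use assms z1 l1 in simp_all)
  ultimately show ?thesis using assms by simp
qed

section \<open>The bracket\<close>

text \<open>
  The expression \<open>(\<alpha>(x, w) -\<^sub>p z) -\<^bsub>T(\<pi>)\<^esub> 0 x\<close>; the bracket is the case \<open>x = X\<close>, \<open>w = T(Y) \<rho> X\<close>,
  \<open>z = T(X) \<rho> Y\<close>.
\<close>

definition bracket_term :: "'m \<Rightarrow> 'm \<Rightarrow> 'm \<Rightarrow> 'm" where
  "bracket_term x w z = (al x w \<ominus>\<^bsub>tb C E\<^esub> z) \<ominus>\<^bsub>T\<^sub>A\<^esub> (\<o> E \<cdot> x)"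

text \<open>
  The conditions on elements at a common stage under which \<open>bracket_term x w z\<close> is defined and is the
  lift of an element of \<open>A\<close>.
\<close>

definition admissible :: "'m \<Rightarrow> 'm \<Rightarrow> 'm \<Rightarrow> bool" where
  "admissible x w z \<longleftrightarrow> x \<in> Ar C \<and> w \<in> Ar C \<and> z \<in> Ar C \<and> Cod C x = E \<and> Cod C w = TO C E \<and> Cod C z = TO C E \<and>
     Dom C x = Dom C w \<and> Dom C z = Dom C w \<and> \<rho> \<cdot> x = T \<pi> \<cdot> w \<and> \<p> E \<cdot> z = x \<and>
     T \<pi> \<cdot> z = \<rho> \<cdot> (\<p> E \<cdot> w)"

lemma admissible_difference:
  assumes "admissible x w z"
  shows "al x w \<ominus>\<^bsub>tb C E\<^esub> z \<in> Ar C" "Dom C (al x w \<ominus>\<^bsub>tb C E\<^esub> z) = Dom C w"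
    "Cod C (al x w \<ominus>\<^bsub>tb C E\<^esub> z) = TO C E" "\<p> E \<cdot> (al x w \<ominus>\<^bsub>tb C E\<^esub> z) = x"
    "T \<pi> \<cdot> (al x w \<ominus>\<^bsub>tb C E\<^esub> z) = \<o> M \<cdot> (\<pi> \<cdot> x)"
proof -
  note a = assms[unfolded admissible_def]
  show "al x w \<ominus>\<^bsub>tb C E\<^esub> z \<in> Ar C" "Dom C (al x w \<ominus>\<^bsub>tb C E\<^esub> z) = Dom C w"
    "Cod C (al x w \<ominus>\<^bsub>tb C E\<^esub> z) = TO C E" "\<p> E \<cdot> (al x w \<ominus>\<^bsub>tb C E\<^esub> z) = x"
    using a by simp_all
  have "\<pi> \<cdot> (\<p> E \<cdot> w) = \<p> M \<cdot> (T \<pi> \<cdot> w)" using a by simp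
  also have "T \<pi> \<cdot> w = \<rho> \<cdot> x" using a by simp
  also have "\<p> M \<cdot> (\<rho> \<cdot> x) = \<pi> \<cdot> x" by (rule anchor_simps) (use a in simp_all)
  finally have pw: "\<pi> \<cdot> (\<p> E \<cdot> w) = \<pi> \<cdot> x" .
  have "T \<pi> \<cdot> (al x w \<ominus>\<^bsub>tb C E\<^esub> z) = (T \<pi> \<cdot> al x w) \<ominus>\<^bsub>tb C M\<^esub> (T \<pi> \<cdot> z)"
    using T_plus(2)[of \<pi> "al x w" z E] a by simp
  also have "\<dots> = \<o> M \<cdot> (\<pi> \<cdot> x)"
    using minus_self[of "tb C M" "\<rho> \<cdot> (\<p> E \<cdot> w)"] a pw by simp
  finally show "T \<pi> \<cdot> (al x w \<ominus>\<^bsub>tb C E\<^esub> z) = \<o> M \<cdot> (\<pi> \<cdot> x)" .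
qed

lemma bracket_term_lift:
  assumes "admissible x w z"
  shows "\<exists>e. e \<in> Ar C \<and> Dom C e = Dom C w \<and> Cod C e = E \<and> lft A \<cdot> e = bracket_term x w z \<and> \<pi> \<cdot> e = \<pi> \<cdot> x"
proof -
  note a = assms[unfolded admissible_def] and d = admissible_difference[OF assms]
  have TB: "additive_bundle C T\<^sub>A" by simp
  note m = minus_typing[OF TB, of "al x w \<ominus>\<^bsub>tb C E\<^esub> z" "\<o> E \<cdot> x"]
  have t: "bracket_term x w z \<in> Ar C" "Dom C (bracket_term x w z) = Dom C w"
    "Cod C (bracket_term x w z) = TO C E" "T \<pi> \<cdot> bracket_term x w z = \<o> M \<cdot> (\<pi> \<cdot> x)"
    using m d a by (simp_all add: bracket_term_def)
  have "\<p> E \<cdot> bracket_term x w z = x \<ominus>\<^bsub>A\<^esub> x"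
    using prj_plus_T(2)[of A "al x w \<ominus>\<^bsub>tb C E\<^esub> z" "\<o> E \<cdot> x"] d a by (simp add: bracket_term_def)
  also have "\<dots> = zer A \<cdot> (\<pi> \<cdot> x)" using minus_self[of A x] a by simp
  finally have p: "\<p> E \<cdot> bracket_term x w z = zer A \<cdot> (\<pi> \<cdot> x)" .
  show ?thesis
    using lft_universal[OF A_differential t(1,3) _ _ _ t(4) p] a t(2) by simp
qed

lemma bracket_term_comp:
  assumes "admissible x w z" "h \<in> Ar C" "Cod C h = Dom C w"
  shows "bracket_term x w z \<cdot> h = bracket_term (x \<cdot> h) (w \<cdot> h) (z \<cdot> h)"
proof -
  note a = assms(1)[unfolded admissible_def] and d = admissible_difference[OF assms(1)]
  have TB: "additive_bundle C T\<^sub>A" by simp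
  have 1: "(al x w \<ominus>\<^bsub>tb C E\<^esub> z) \<cdot> h = al (x \<cdot> h) (w \<cdot> h) \<ominus>\<^bsub>tb C E\<^esub> (z \<cdot> h)"
    using minus_comp[of "tb C E" "al x w" z h] al_comp[of x w h] a assms(2,3) by simp
  show ?thesis
    unfolding bracket_term_def 1[symmetric]
    using minus_comp[OF TB, of "al x w \<ominus>\<^bsub>tb C E\<^esub> z" "\<o> E \<cdot> x" h] a d assms(2,3) by simp
qed

lemma section_typing:
  assumes "X \<in> sections C A"
  shows "X \<in> Ar C" "Dom C X = M" "Cod C X = E" "\<pi> \<cdot> X = Id C M"
    "x \<in> Ar C \<Longrightarrow> Cod C x = M \<Longrightarrow> \<pi> \<cdot> (X \<cdot> x) = x"
    "x \<in> Ar C \<Longrightarrow> Cod C x = TO C M \<Longrightarrow> T \<pi> \<cdot> (T X \<cdot> x) = x"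
proof -
  show t: "X \<in> Ar C" "Dom C X = M" "Cod C X = E" "\<pi> \<cdot> X = Id C M"
    using assms by (auto simp: sections_def)
  show "x \<in> Ar C \<Longrightarrow> Cod C x = M \<Longrightarrow> \<pi> \<cdot> (X \<cdot> x) = x"
    using comp_eq_at[OF t(4), of x] t(1-3) by simp
  show "x \<in> Ar C \<Longrightarrow> Cod C x = TO C M \<Longrightarrow> T \<pi> \<cdot> (T X \<cdot> x) = x"
    using T_eq[OF t(4), of x] t(1-3) by simp
qed

lemma bracketI:
  assumes "Z \<in> sections C A" "lft A \<cdot> Z = bracket_term X (T Y \<cdot> (\<rho> \<cdot> X)) (T X \<cdot> (\<rho> \<cdot> Y))"
  shows "bracket C A \<rho> \<pi>\<^sub>0 \<pi>\<^sub>1 \<alpha> X Y = Z"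
  unfolding bracket_def
proof (rule the_equality)
  show "Z \<in> sections C A \<and> lft A \<cdot> Z =
      ((\<alpha> \<cdot> pair C \<pi>\<^sub>0 \<pi>\<^sub>1 X (T Y \<cdot> \<rho> \<cdot> X)) \<ominus>\<^bsub>tb C E\<^esub> (T X \<cdot> \<rho> \<cdot> Y)) \<ominus>\<^bsub>T\<^sub>A\<^esub> (\<o> E \<cdot> X)"
    using assms by (simp add: bracket_term_def al_def pr_def)
  fix Z' assume Z': "Z' \<in> sections C A \<and> lft A \<cdot> Z' =
      ((\<alpha> \<cdot> pair C \<pi>\<^sub>0 \<pi>\<^sub>1 X (T Y \<cdot> \<rho> \<cdot> X)) \<ominus>\<^bsub>tb C E\<^esub> (T X \<cdot> \<rho> \<cdot> Y)) \<ominus>\<^bsub>T\<^sub>A\<^esub> (\<o> E \<cdot> X)"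
  then have "lft A \<cdot> Z' = lft A \<cdot> Z" using assms(2) by (simp add: bracket_term_def al_def pr_def)
  then show "Z' = Z"
    using lft_monic(1)[OF A_differential, of Z' Z] section_typing(1-3)[OF assms(1)]
      section_typing(1-3)[of Z'] Z' by simp
qed

lemma bracket_admissible:
  assumes "X \<in> sections C A" "Y \<in> sections C A"
  shows "admissible X (T Y \<cdot> (\<rho> \<cdot> X)) (T X \<cdot> (\<rho> \<cdot> Y))"
  using section_typing[OF assms(1)] section_typing[OF assms(2)] by (simp add: admissible_def)

lemma bracketD:
  assumes "X \<in> sections C A" "Y \<in> sections C A"
  shows "bracket C A \<rho> \<pi>\<^sub>0 \<pi>\<^sub>1 \<alpha> X Y \<in> sections C A"
    "lft A \<cdot> bracket C A \<rho> \<pi>\<^sub>0 \<pi>\<^sub>1 \<alpha> X Y = bracket_term X (T Y \<cdot> (\<rho> \<cdot> X)) (T X \<cdot> (\<rho> \<cdot> Y))"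
proof -
  note X = section_typing[OF assms(1)] and Y = section_typing[OF assms(2)]
  obtain e where e: "e \<in> Ar C" "Dom C e = M" "Cod C e = E"
    "lft A \<cdot> e = bracket_term X (T Y \<cdot> (\<rho> \<cdot> X)) (T X \<cdot> (\<rho> \<cdot> Y))" "\<pi> \<cdot> e = Id C M"
    using bracket_term_lift[OF bracket_admissible[OF assms]] X(1-4) Y(1-4) by auto
  have s: "e \<in> sections C A" using e by (simp add: sections_def)
  show "bracket C A \<rho> \<pi>\<^sub>0 \<pi>\<^sub>1 \<alpha> X Y \<in> sections C A"
    "lft A \<cdot> bracket C A \<rho> \<pi>\<^sub>0 \<pi>\<^sub>1 \<alpha> X Y = bracket_term X (T Y \<cdot> (\<rho> \<cdot> X)) (T X \<cdot> (\<rho> \<cdot> Y))"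
    using bracketI[OF s e(4)] s e(4) by simp_all
qed

text \<open>
  The part without the derivative of \<open>f\<close>: replacing \<open>T(f \<bullet> Y) \<rho> X\<close> by \<open>T(\<bullet>)(0 f, T(Y) \<rho> X)\<close> in the
  expression for \<open>\<lambda> [X, f \<bullet> Y]\<close> yields \<open>\<lambda> (f \<bullet> [X, Y])\<close>.  The proof replaces \<open>f\<close> by the universal scalar, the
  projection \<open>R \<times> M \<rightarrow> R\<close>, and shows that the resulting map \<open>g : R \<times> M \<rightarrow> A\<close> is linear in \<open>R\<close>.
\<close>

lemma smul_bracket:
  assumes "X \<in> sections C A" "Y \<in> sections C A" "f \<in> Ar C" "Dom C f = M" "Cod C f = tot R"
  shows "lft A \<cdot> mul A f (bracket C A \<rho> \<pi>\<^sub>0 \<pi>\<^sub>1 \<alpha> X Y) =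
    bracket_term X (T_mul A (\<o> (tot R) \<cdot> f) (T Y \<cdot> (\<rho> \<cdot> X))) (T X \<cdot> (\<rho> \<cdot> mul A f Y))"
proof -
  note X = section_typing[OF assms(1)] and Y = section_typing[OF assms(2)] and Br = bracketD[OF assms(1,2)]
  let ?B = "bracket C A \<rho> \<pi>\<^sub>0 \<pi>\<^sub>1 \<alpha> X Y"
  note B = section_typing[OF Br(1)]
  let ?r = "pr\<^sub>R M" and ?m = "pr\<^sub>X M" and ?v = "T Y \<cdot> (\<rho> \<cdot> X)"
  let ?L = "telt M (lft R \<cdot> ?r) (\<o> M \<cdot> ?m)"
  have L: "?L \<in> Ar C" "Dom C ?L = RX M" "Cod C ?L = TO C (RX M)" "T ?r \<cdot> ?L = lft R \<cdot> ?r" "T ?m \<cdot> ?L = \<o> M \<cdot> ?m"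
    using telt_typing[of M "lft R \<cdot> ?r" "\<o> M \<cdot> ?m"] by simp_all
  define x where "x = X \<cdot> ?m"
  define w where "w = T_mul A (\<o> (tot R) \<cdot> ?r) (?v \<cdot> ?m)"
  define s where "s = mul A ?r (Y \<cdot> ?m)"
  define z where "z = T X \<cdot> (\<rho> \<cdot> s)"
  have v: "?v \<in> Ar C" "Dom C ?v = M" "Cod C ?v = TO C E" "\<p> E \<cdot> ?v = Y" "T \<pi> \<cdot> ?v = \<rho> \<cdot> X"
    using X Y by simp_all
  have vm: "\<p> E \<cdot> (?v \<cdot> ?m) = Y \<cdot> ?m" "T \<pi> \<cdot> (?v \<cdot> ?m) = \<rho> \<cdot> (X \<cdot> ?m)"
    using X Y by simp_all
  have x: "x \<in> Ar C" "Dom C x = RX M" "Cod C x = E" using X(1-3) by (simp_all add: x_def)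
  have s: "s \<in> Ar C" "Dom C s = RX M" "Cod C s = E" "\<pi> \<cdot> s = ?m"
    using Y by (simp_all add: s_def)
  have w: "w \<in> Ar C" "Dom C w = RX M" "Cod C w = TO C E" "T \<pi> \<cdot> w = \<rho> \<cdot> x" "\<p> E \<cdot> w = s"
    using smul_T_typing[OF A_differential, of "\<o> (tot R) \<cdot> ?r" "?v \<cdot> ?m"] v(1-3) vm
    by (simp_all add: w_def x_def s_def del: comp_assoc)
  have z: "z \<in> Ar C" "Dom C z = RX M" "Cod C z = TO C E" "\<p> E \<cdot> z = x" "T \<pi> \<cdot> z = \<rho> \<cdot> s"
    using X s by (simp_all add: z_def x_def)
  have adm: "admissible x w z" using x w z by (simp add: admissible_def)
  note d = admissible_difference[OF adm]
  obtain g where g: "g \<in> Ar C" "Dom C g = RX M" "Cod C g = E" "lft A \<cdot> g = bracket_term x w z" "\<pi> \<cdot> g = \<pi> \<cdot> x"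
    using bracket_term_lift[OF adm] w(2) by auto
  have gm: "\<pi> \<cdot> g = ?m" using g(5) X by (simp add: x_def)
  \<comment> \<open>\<open>?L\<close> is the lift \<open>(\<lambda> r, 0 m)\<close> of \<open>R \<times> M\<close>.  The derivatives along \<open>?L\<close> of the constituents of
    \<open>bracket_term x w z\<close> are computed one by one; together they give \<open>T(\<lambda> g) ?L = l \<lambda> g = T(\<lambda>) \<lambda> g\<close>.\<close>
  have TxL: "T x \<cdot> ?L = \<o> E \<cdot> x"
    using X(1-3) L by (simp add: x_def)
  have TwL: "T w \<cdot> ?L = \<c> E \<cdot> (T (lft A) \<cdot> w)"
  proof -
    have "T w \<cdot> ?L = T (T (sc A)) \<cdot> (T (telt E (\<o> (tot R) \<cdot> ?r) (?v \<cdot> ?m)) \<cdot> ?L)"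
      using v(1-3) L(1-3) by (simp add: w_def smul_T_eq)
    also have "T (telt E (\<o> (tot R) \<cdot> ?r) (?v \<cdot> ?m)) =
        ttelt E (T (\<o> (tot R) \<cdot> ?r)) (T (?v \<cdot> ?m))"
      by (rule elt_comp(5)[where z = "Id C (RX M)"]) (use v(1-3) in simp_all)
    also have "ttelt E (T (\<o> (tot R) \<cdot> ?r)) (T (?v \<cdot> ?m)) \<cdot> ?L =
        ttelt E (T (\<o> (tot R) \<cdot> ?r) \<cdot> ?L) (T (?v \<cdot> ?m) \<cdot> ?L)"
      by (rule elt_comp(3)) (use v(1-3) L(1-3) in simp_all)
    also have "T (\<o> (tot R) \<cdot> ?r) \<cdot> ?L = \<c> (tot R) \<cdot> (T (lft R) \<cdot> (\<o> (tot R) \<cdot> ?r))"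
      using L by simp
    also have "T (?v \<cdot> ?m) \<cdot> ?L = \<o> (TO C E) \<cdot> (?v \<cdot> ?m)"
    proof -
      have "T (?v \<cdot> ?m) \<cdot> ?L = T ?v \<cdot> (T ?m \<cdot> ?L)"
        using T_comp[of ?m ?v] v(1-3) L(1-3) by (simp del: T_comp)
      also have "\<dots> = \<o> (TO C E) \<cdot> (?v \<cdot> ?m)"
        unfolding L(5) using tangent_naturality(2)[OF v(1), of ?m] v(2,3) by (simp del: T_comp)
      finally show ?thesis .
    qed
    finally show ?thesis
      using scal_T_linear[OF A_differential, of "\<o> (tot R) \<cdot> ?r" "?v \<cdot> ?m"] v(1-3) by (simp add: w_def)
  qed
  have TsL: "T s \<cdot> ?L = lft A \<cdot> s"
    unfolding s_def by (rule smul_linear) (use Y in simp_all)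
  have TzL: "T z \<cdot> ?L = \<l> E \<cdot> z"
    using X(1-3) s(1-3) L(1-3) TsL by (simp add: z_def)
  have TaL: "T (al x w) \<cdot> ?L = \<l> E \<cdot> al x w"
    using T_pr[of x w ?L] al_linear(1)[of x w] pr_typing[of x w] x w(1-4) L(1-3) TxL TwL
    by (simp add: al_def)
  have TdL: "T (al x w \<ominus>\<^bsub>tb C E\<^esub> z) \<cdot> ?L = \<l> E \<cdot> (al x w \<ominus>\<^bsub>tb C E\<^esub> z)"
    using T_minus_at[of E "al x w" z ?L] lift_plus(2)[of E "al x w" z] x w z L(1-3) TaL TzL by simp
  have "T (bracket_term x w z) \<cdot> ?L = \<l> E \<cdot> bracket_term x w z"
    unfolding bracket_term_def
    by (rule T_minus_T_at) (use d x w(2) L(1-3) TdL TxL in simp_all)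
  then have "T (lft A) \<cdot> (T g \<cdot> ?L) = \<l> E \<cdot> (lft A \<cdot> g)"
    using T_eq[of "lft A" g "bracket_term x w z" ?L] g(1-4) L(1-3) by simp
  also have "\<dots> = T (lft A) \<cdot> (lft A \<cdot> g)"
    using lft_simps(4)[OF A_differential g(1,3)] by simp
  finally have "T (lft A) \<cdot> (T g \<cdot> ?L) = T (lft A) \<cdot> (lft A \<cdot> g)" .
  then have gL: "T g \<cdot> ?L = lft A \<cdot> g"
    using lft_monic(2)[OF A_differential, of "T g \<cdot> ?L" "lft A \<cdot> g"] g(1-3) L(1-3) by simp
  \<comment> \<open>The value of \<open>g\<close> at a scalar \<open>r : M \<rightarrow> R\<close>, used below for \<open>r = u\<close> and for \<open>r = f\<close>.\<close>
  have at: "lft A \<cdot> (g \<cdot> elt C R M r (Id C M)) =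
      bracket_term X (T_mul A (\<o> (tot R) \<cdot> r) ?v) (T X \<cdot> (\<rho> \<cdot> mul A r Y))"
    if r: "r \<in> Ar C" "Dom C r = M" "Cod C r = tot R" for r
  proof -
    let ?h = "elt C R M r (Id C M)"
    have h: "?h \<in> Ar C" "Dom C ?h = M" "Cod C ?h = RX M" "?r \<cdot> ?h = r" "?m \<cdot> ?h = Id C M"
      using elt_typing[of M r "Id C M"] r by simp_all
    have "lft A \<cdot> (g \<cdot> ?h) = bracket_term x w z \<cdot> ?h"
      using comp_eq_at[OF g(4), of ?h] g(1-3) h(1-3) by simp
    also have "\<dots> = bracket_term (x \<cdot> ?h) (w \<cdot> ?h) (z \<cdot> ?h)"
      by (rule bracket_term_comp[OF adm]) (use h w(2) in simp_all)
    also have "x \<cdot> ?h = X" using X(1-3) h by (simp add: x_def)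
    also have "w \<cdot> ?h = T_mul A (\<o> (tot R) \<cdot> r) ?v"
    proof -
      have "(?v \<cdot> ?m) \<cdot> ?h = ?v" using comp_assoc[of ?h ?m ?v] v(1-3) h by (simp del: comp_assoc)
      then show ?thesis
        unfolding w_def using smul_T_comp[OF A_differential, of "\<o> (tot R) \<cdot> ?r" "?v \<cdot> ?m" ?h] v(1-3) h
        by (simp del: comp_assoc add: comp_assoc[of ?h ?r])
    qed
    also have "z \<cdot> ?h = T X \<cdot> (\<rho> \<cdot> mul A r Y)"
      using smul_comp[OF A_differential, of ?r "Y \<cdot> ?m" ?h] X(1-3) Y(1-3) s(1-3) h by (simp add: z_def s_def)
    finally show ?thesis .
  qed
  have "g \<cdot> elt C R M (u \<cdot> bang C R M) (Id C M) = ?B"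
  proof -
    \<comment> \<open>This is the image under \<open>T\<close> of \<open>u \<bullet> a = a\<close>.\<close>
    have "T_mul A (\<o> (tot R) \<cdot> (u \<cdot> bang C R M)) ?v = ?v"
    proof -
      have "T (mul A (u \<cdot> bang C R E) (Id C E)) \<cdot> ?v = ?v"
        using smul_unit[OF A_differential, of "Id C E" E] v(1-3) by simp
      moreover have "T (mul A (u \<cdot> bang C R E) (Id C E)) \<cdot> ?v =
          T_mul A (T (u \<cdot> bang C R E) \<cdot> ?v) (T (Id C E) \<cdot> ?v)"
        using T_smul[OF A_differential, of "u \<cdot> bang C R E" "Id C E"]
          smul_T_comp[OF A_differential, of "T (u \<cdot> bang C R E)" "T (Id C E)" ?v] v(1-3) by simp
      moreover have "T (bang C R E) \<cdot> ?v = \<o> (base R) \<cdot> bang C R M"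
        by (rule terminal_eq[where k = 1]) (use v(1-3) in simp_all)
      moreover from this have "T (u \<cdot> bang C R E) \<cdot> ?v = \<o> (tot R) \<cdot> (u \<cdot> bang C R M)"
        using comp_assoc[of ?v "T (bang C R E)" "T u"] v(1-3) by simp
      ultimately show ?thesis using v(1-3) by simp
    qed
    moreover have "mul A (u \<cdot> bang C R M) Y = Y"
      using smul_unit[OF A_differential, of Y M] Y(1-3) by simp
    ultimately have "lft A \<cdot> (g \<cdot> elt C R M (u \<cdot> bang C R M) (Id C M)) = lft A \<cdot> ?B"
      using at[of "u \<cdot> bang C R M"] Br(2) by simp
    then show ?thesis
      using lft_monic(1)[OF A_differential, of "g \<cdot> elt C R M (u \<cdot> bang C R M) (Id C M)" ?B] g(1-3) B(1-3) by simp
  qed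
  then have g_eq: "g = mul A ?r (?B \<cdot> ?m)"
    by (intro smul_unique) (use B(1-4) g(1-3) gm gL in simp_all)
  let ?h = "elt C R M f (Id C M)"
  have h: "?h \<in> Ar C" "Dom C ?h = M" "Cod C ?h = RX M" "?r \<cdot> ?h = f" "?m \<cdot> ?h = Id C M"
    using elt_typing[of M f "Id C M"] assms(3-5) by simp_all
  have "g \<cdot> ?h = mul A f ?B"
    unfolding g_eq using smul_comp[OF A_differential, of ?r "?B \<cdot> ?m" ?h] B(1-3) h by simp
  with at[of f] assms(3-5) show ?thesis by simp
qed

text \<open>
  The product rule for \<open>T(f \<bullet> Y) \<rho> X\<close>, in which \<open>b\<close> is the derivative of \<open>f\<close> along \<open>\<rho> X\<close>.
\<close>

lemma T_smul_section:
  assumes "X \<in> sections C A" "Y \<in> sections C A" "f \<in> Ar C" "Dom C f = M" "Cod C f = tot R"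
  defines "b \<equiv> lie_derivative C R (\<rho> \<cdot> X) f"
  shows "b \<in> Ar C" "Dom C b = M" "Cod C b = tot R"
    "T (mul A f Y) \<cdot> (\<rho> \<cdot> X) =
      T_mul A (\<o> (tot R) \<cdot> f) (T Y \<cdot> (\<rho> \<cdot> X)) \<oplus>\<^bsub>T\<^sub>A\<^esub>
      ((lft A \<cdot> mul A b Y) \<oplus>\<^bsub>tb C E\<^esub> (T (zer A) \<cdot> (\<rho> \<cdot> X)))"
proof -
  note X = section_typing[OF assms(1)] and Y = section_typing[OF assms(2)]
  let ?v = "T Y \<cdot> (\<rho> \<cdot> X)" and ?s = "T f \<cdot> (\<rho> \<cdot> X)"
  have v: "?v \<in> Ar C" "Dom C ?v = M" "Cod C ?v = TO C E" "\<p> E \<cdot> ?v = Y" "T \<pi> \<cdot> ?v = \<rho> \<cdot> X"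
    using X Y by simp_all
  have s: "?s \<in> Ar C" "Dom C ?s = M" "Cod C ?s = TO C (tot R)" "\<p> (tot R) \<cdot> ?s = f"
    using X assms(3-5) by simp_all
  note p = phat_decomposition[OF s(1,3)]
  have b: "b = phat C R \<cdot> ?s" by (simp add: b_def lie_derivative_def)
  show bt: "b \<in> Ar C" "Dom C b = M" "Cod C b = tot R"
    unfolding b using p(1-3) s(1-3) by simp_all
  have sb: "?s = (\<o> (tot R) \<cdot> f) \<oplus>\<^bsub>T_bundle C R\<^esub> (lft R \<cdot> b)"
    using p(4) unfolding b s(4) .
  have "T (mul A f Y) \<cdot> (\<rho> \<cdot> X) = T_mul A ?s ?v"
    using X(1-3) Y(1-3) assms(3-5) by (simp add: T_smul smul_T_comp)
  also have "\<dots> = T_mul A (\<o> (tot R) \<cdot> f) ?v \<oplus>\<^bsub>T\<^sub>A\<^esub> T_mul A (lft R \<cdot> b) ?v"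
    unfolding sb by (rule smul_T_plus_T) (use v(1-3) bt assms(3-5) in simp_all)
  also have "T_mul A (lft R \<cdot> b) ?v = (lft A \<cdot> mul A b Y) \<oplus>\<^bsub>tb C E\<^esub> (T (zer A) \<cdot> (\<rho> \<cdot> X))"
    using smul_T_lft[OF A_differential bt(1) v(1) bt(3) v(3)] bt(2) v(2) unfolding v(4,5) by simp
  finally show "T (mul A f Y) \<cdot> (\<rho> \<cdot> X) =
      T_mul A (\<o> (tot R) \<cdot> f) ?v \<oplus>\<^bsub>T\<^sub>A\<^esub>
      ((lft A \<cdot> mul A b Y) \<oplus>\<^bsub>tb C E\<^esub> (T (zer A) \<cdot> (\<rho> \<cdot> X)))" .
qed

text \<open>
  The second argument \<open>\<lambda> e +\<^sub>p T(\<xi>) \<rho> X\<close> is paired with \<open>X = \<xi> + X\<close>, and \<open>\<alpha>\<close> is additive for this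
  addition on \<open>P\<close>, with \<open>\<alpha>(\<xi>, \<lambda> e) = \<lambda> e\<close> and \<open>\<alpha>(X, T(\<xi>) \<rho> X) = 0 X\<close>.
\<close>

lemma al_smul_section:
  assumes "X \<in> sections C A" "e \<in> sections C A"
    and w: "w \<in> Ar C" "Dom C w = M" "Cod C w = TO C E" "T \<pi> \<cdot> w = \<rho> \<cdot> X"
  shows "al X (w \<oplus>\<^bsub>T\<^sub>A\<^esub> ((lft A \<cdot> e) \<oplus>\<^bsub>tb C E\<^esub> (T (zer A) \<cdot> (\<rho> \<cdot> X)))) =
    al X w \<oplus>\<^bsub>tb C E\<^esub> ((lft A \<cdot> e) \<oplus>\<^bsub>T\<^sub>A\<^esub> (\<o> E \<cdot> X))"
proof -
  note X = section_typing[OF assms(1)] and e = section_typing[OF assms(2)]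
  let ?o = "T (zer A) \<cdot> (\<rho> \<cdot> X)"
  have o: "?o \<in> Ar C" "Dom C ?o = M" "Cod C ?o = TO C E" "T \<pi> \<cdot> ?o = \<rho> \<cdot> X" "\<p> E \<cdot> ?o = zer A"
    using T_eq[OF additive_prj(1)[of A], of "\<rho> \<cdot> X"] X by simp_all
  have z: "zer A \<oplus>\<^bsub>A\<^esub> X = X" using plus_zer(2)[of A X "Id C M"] X by simp
  have l: "lft A \<cdot> e \<in> Ar C" "Dom C (lft A \<cdot> e) = M" "Cod C (lft A \<cdot> e) = TO C E"
    "T \<pi> \<cdot> (lft A \<cdot> e) = \<o> M" "\<p> E \<cdot> (lft A \<cdot> e) = zer A"
    using e by simp_all
  have rz: "\<rho> \<cdot> zer A = \<o> M"
    using anchor_zer[of "Id C M"] by simp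
  have lo: "(lft A \<cdot> e) \<oplus>\<^bsub>tb C E\<^esub> ?o \<in> Ar C" "Dom C ((lft A \<cdot> e) \<oplus>\<^bsub>tb C E\<^esub> ?o) = M"
    "Cod C ((lft A \<cdot> e) \<oplus>\<^bsub>tb C E\<^esub> ?o) = TO C E" "T \<pi> \<cdot> ((lft A \<cdot> e) \<oplus>\<^bsub>tb C E\<^esub> ?o) = \<rho> \<cdot> X"
    using l o T_plus(1)[of \<pi> "lft A \<cdot> e" ?o E] plus_zer(2)[of "tb C M" "\<rho> \<cdot> X" "Id C M"] X by simp_all
  have "al X ((lft A \<cdot> e) \<oplus>\<^bsub>tb C E\<^esub> ?o) = al (zer A \<oplus>\<^bsub>A\<^esub> X) ((lft A \<cdot> e) \<oplus>\<^bsub>tb C E\<^esub> ?o)" by (simp only: z)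
  also have "\<dots> = al (zer A) (lft A \<cdot> e) \<oplus>\<^bsub>T\<^sub>A\<^esub> al X ?o"
    by (rule al_plus_p) (use l o X rz in simp_all)
  also have "al (zer A) (lft A \<cdot> e) = lft A \<cdot> e" using al_lft[of e] e by simp
  also have "al X ?o = \<o> E \<cdot> X" using al_zer[of X] X by simp
  finally have 1: "al X ((lft A \<cdot> e) \<oplus>\<^bsub>tb C E\<^esub> ?o) = (lft A \<cdot> e) \<oplus>\<^bsub>T\<^sub>A\<^esub> (\<o> E \<cdot> X)" .
  have "al X (w \<oplus>\<^bsub>T\<^sub>A\<^esub> ((lft A \<cdot> e) \<oplus>\<^bsub>tb C E\<^esub> ?o)) = al X w \<oplus>\<^bsub>tb C E\<^esub> al X ((lft A \<cdot> e) \<oplus>\<^bsub>tb C E\<^esub> ?o)"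
    by (rule al_plus_T) (use w lo X in simp_all)
  then show ?thesis unfolding 1 .
qed

lemma bracket_leibniz:
  assumes "X \<in> sections C A" "Y \<in> sections C A" "f \<in> hom C M (tot R)"
  shows "bracket C A \<rho> \<pi>\<^sub>0 \<pi>\<^sub>1 \<alpha> X (mul A f Y) =
    mul A f (bracket C A \<rho> \<pi>\<^sub>0 \<pi>\<^sub>1 \<alpha> X Y) \<oplus>\<^bsub>A\<^esub> mul A (lie_derivative C R (\<rho> \<cdot> X) f) Y"
proof -
  have f: "f \<in> Ar C" "Dom C f = M" "Cod C f = tot R" using assms(3) by auto
  note X = section_typing[OF assms(1)] and Y = section_typing[OF assms(2)] and Br = bracketD[OF assms(1,2)]
  note B = section_typing[OF Br(1)]
  let ?v = "T Y \<cdot> (\<rho> \<cdot> X)" and ?o = "\<o> E \<cdot> X" and ?b = "lie_derivative C R (\<rho> \<cdot> X) f"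
  define fY where "fY = mul A f Y"
  define e where "e = mul A f (bracket C A \<rho> \<pi>\<^sub>0 \<pi>\<^sub>1 \<alpha> X Y)"
  define e' where "e' = mul A ?b Y"
  define w where "w = T_mul A (\<o> (tot R) \<cdot> f) ?v"
  define z where "z = T X \<cdot> (\<rho> \<cdot> fY)"
  define D where "D = al X w \<ominus>\<^bsub>tb C E\<^esub> z"
  note T = T_smul_section[OF assms(1,2) f]
  have fY: "fY \<in> sections C A" using Y f by (simp add: sections_def fY_def)
  have es: "e \<in> sections C A" "e' \<in> sections C A" using B Y f T(1-3) by (simp_all add: sections_def e_def e'_def)
  note e = section_typing[OF es(1)] and e' = section_typing[OF es(2)] and fYt = section_typing[OF fY]
  have v: "?v \<in> Ar C" "Dom C ?v = M" "Cod C ?v = TO C E" "\<p> E \<cdot> ?v = Y" "T \<pi> \<cdot> ?v = \<rho> \<cdot> X"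
    using X Y by simp_all
  have w: "w \<in> Ar C" "Dom C w = M" "Cod C w = TO C E" "T \<pi> \<cdot> w = \<rho> \<cdot> X" "\<p> E \<cdot> w = fY"
    using smul_T_typing[OF A_differential, of "\<o> (tot R) \<cdot> f" ?v] v f unfolding w_def fY_def by simp_all
  have z: "z \<in> Ar C" "Dom C z = M" "Cod C z = TO C E" "\<p> E \<cdot> z = X" "T \<pi> \<cdot> z = \<rho> \<cdot> fY"
    using X fYt by (simp_all add: z_def)
  have adm: "admissible X w z" using X w z by (simp add: admissible_def)
  note d = admissible_difference[OF adm, folded D_def]
  have TB: "additive_bundle C T\<^sub>A" by simp
  have le: "lft A \<cdot> e = D \<ominus>\<^bsub>T\<^sub>A\<^esub> ?o"
    unfolding e_def smul_bracket[OF assms(1,2) f] by (simp add: bracket_term_def D_def w_def z_def fY_def)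
  let ?y = "(lft A \<cdot> e') \<oplus>\<^bsub>T\<^sub>A\<^esub> ?o"
  have lt: "lft A \<cdot> e'' \<in> Ar C" "Dom C (lft A \<cdot> e'') = M" "Cod C (lft A \<cdot> e'') = TO C E"
    "T \<pi> \<cdot> (lft A \<cdot> e'') = \<o> M" "\<p> E \<cdot> (lft A \<cdot> e'') = zer A"
    if "e'' \<in> sections C A" for e''
    using section_typing[OF that] by simp_all
  have o: "?o \<in> Ar C" "Dom C ?o = M" "Cod C ?o = TO C E" "T \<pi> \<cdot> ?o = \<o> M" "\<p> E \<cdot> ?o = X"
    using X by simp_all
  have y: "?y \<in> Ar C" "Dom C ?y = M" "Cod C ?y = TO C E" "\<p> E \<cdot> ?y = X"
    using plus_typing[OF TB, of "lft A \<cdot> e'" ?o] prj_plus_T(1)[of A "lft A \<cdot> e'" ?o] lt[OF es(2)] o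
      plus_zer(2)[of A X "Id C M"] X by simp_all
  have D: "D = (lft A \<cdot> e) \<oplus>\<^bsub>T\<^sub>A\<^esub> ?o"
    unfolding le using minus_plus_cancel(1)[OF TB, of D ?o] d o w X by simp
  \<comment> \<open>With \<open>\<lambda> e = D - 0 X\<close>, the sum \<open>\<lambda>(e + e') + 0 X\<close> is regrouped by the interchange law.\<close>
  have "lft A \<cdot> (e \<oplus>\<^bsub>A\<^esub> e') \<oplus>\<^bsub>T\<^sub>A\<^esub> ?o = ((lft A \<cdot> e) \<oplus>\<^bsub>tb C E\<^esub> (lft A \<cdot> e')) \<oplus>\<^bsub>T\<^sub>A\<^esub> (?o \<oplus>\<^bsub>tb C E\<^esub> ?o)"
    using lft_plus[of A e e'] plus_zer(1)[of "tb C E" ?o X] e(1-4) e'(1-4) X by simp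
  also have "\<dots> = ((lft A \<cdot> e) \<oplus>\<^bsub>T\<^sub>A\<^esub> ?o) \<oplus>\<^bsub>tb C E\<^esub> ?y"
    by (rule interchange[where Z = M]) (use lt[OF es(1)] lt[OF es(2)] o in simp_all)
  also have "\<dots> = D \<oplus>\<^bsub>tb C E\<^esub> ?y" unfolding D ..
  also have "\<dots> = (al X w \<oplus>\<^bsub>tb C E\<^esub> ?y) \<ominus>\<^bsub>tb C E\<^esub> z"
    unfolding D_def by (rule minus_plus_swap[symmetric]) (use X w z y in simp_all)
  also have "\<dots> = al X (T fY \<cdot> (\<rho> \<cdot> X)) \<ominus>\<^bsub>tb C E\<^esub> z"
    using al_smul_section[OF assms(1) es(2) w(1-4)] T(4) unfolding fY_def w_def e'_def by simp
  finally have 1: "lft A \<cdot> (e \<oplus>\<^bsub>A\<^esub> e') \<oplus>\<^bsub>T\<^sub>A\<^esub> ?o = al X (T fY \<cdot> (\<rho> \<cdot> X)) \<ominus>\<^bsub>tb C E\<^esub> z" .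
  have s: "e \<oplus>\<^bsub>A\<^esub> e' \<in> sections C A"
    using e(1-4) e'(1-4) by (simp add: sections_def)
  have "bracket_term X (T fY \<cdot> (\<rho> \<cdot> X)) z = lft A \<cdot> (e \<oplus>\<^bsub>A\<^esub> e')"
    unfolding bracket_term_def 1[symmetric]
    using minus_plus_cancel(2)[OF TB, of "lft A \<cdot> (e \<oplus>\<^bsub>A\<^esub> e')" ?o] lt[OF s] o by simp
  then have "bracket C A \<rho> \<pi>\<^sub>0 \<pi>\<^sub>1 \<alpha> X fY = e \<oplus>\<^bsub>A\<^esub> e'"
    using bracketI[OF s, of X fY] by (simp add: z_def)
  then show ?thesis unfolding fY_def e_def e'_def .
qed

end

section \<open>The Leibniz law\<close>

theorem proposition4p2p3p2:
  fixes C :: "('o, 'm, 'z) tangent_scheme"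
    and A R :: "('o, 'm) bundle_data"
    and u \<rho> \<pi>\<^sub>0 \<pi>\<^sub>1 \<alpha> X Y f :: 'm
    and P :: 'o
  assumes "tangent_category C"
    and "limits_exist C"
    and "unit_object C R u"
    and "involution_algebroid C A \<rho> P \<pi>\<^sub>0 \<pi>\<^sub>1 \<alpha>"
    and "X \<in> sections C A"
    and "Y \<in> sections C A"
    and "f \<in> hom C (base A) (tot R)"
  shows "bracket C A \<rho> \<pi>\<^sub>0 \<pi>\<^sub>1 \<alpha> X (smul C R u A f Y) =
         plus_in C A
           (smul C R u A f (bracket C A \<rho> \<pi>\<^sub>0 \<pi>\<^sub>1 \<alpha> X Y))
           (smul C R u A (lie_derivative C R (Comp C \<rho> X) f) Y)"
proof -
  interpret algebroid_setting C R u A \<rho> \<pi>\<^sub>0 \<pi>\<^sub>1 \<alpha> P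
    by unfold_locales (use assms in simp_all)
  show ?thesis by (rule bracket_leibniz[OF assms(5-7)])
qed

end
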